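(* Let $n,m\ge 1$ be integers, let $l_1\le l_2\le\dots\le l_n$ be integers, let $R=\mathbb{Z}[t_{i,j}\,:\,i,j\ge 0]$, let $I\subset R$ be the ideal generated by the $t_{i,j}$ with $0\le i\le j$, and let $$D=(x\partial_x-l_1)\cdots(x\partial_x-l_n)+\sum_{0\le j\le m,\ i\ge 0}t_{i,j}x^i\partial_x^j,\qquad \partial_x=\frac{d}{dx}.$$ Let $B(\varepsilon)=(b_{ij}(\varepsilon))_{i,j\in\mathbb{Z}}$ be the matrix of $D$ in the basis $\{x^{i+\varepsilon}\}_{i\in\mathbb{Z}}$, let $w_{-M,N}(\varepsilon)=\varepsilon^n-w_{1,-M,N}\varepsilon^{n-1}+\dots+(-1)^nw_{n,-M,N}$ be the Weierstrass polynomial of $\det B_{-M,N}(\varepsilon)$, and let $w(\varepsilon)=\lim_{M,N\to\infty}w_{-M,N}(\varepsilon)$ be its $I$-adic limit. Let $L(D)\in\hat R_I\hat\otimes_{\mathbb{Z}}\mathbb{Q}$ be the universal lift of the $p$-determinants $Det_p(D)$. Then $$L(D)=(-1)^n\,w(0).$$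
   Context: $\hat R_I\hat\otimes_{\mathbb{Z}}\mathbb{Q}:=\varprojlim_k\,(R/I^k)\otimes_{\mathbb{Z}}\mathbb{Q}$; write $S$ for this ring and $\hat I_{\mathbb{Q}}\subset S$ for the kernel of $S\to(R/I)\otimes\mathbb{Q}$. $I$-adic limits in $S$ are limits in the inverse limit topology (for polynomials in $\varepsilon$: coefficientwise). Definition of $Det_p(D)$: for a prime $p$ let $D^{(p)}$ be the reduction of $D$ modulo $p$, acting on (the completion, i.e. power series in $x$, of) the free $R/pR$-module $V$ with basis $1,x,x^2,\dots$. The (completed) submodule $V^{(p)}$ spanned by $x^p,x^{p+1},\dots$ is $D^{(p)}$-invariant, and $Det_p(D):=\det\big(D^{(p)}|_{V/V^{(p)}}\big)\in R/pR$, where $V/V^{(p)}$ has basis $1,x,\dots,x^{p-1}$. Definition of $L(D)$: the element of $S$, independent of $p$, for which there is a constant $C>0$ independent of $p$ such that for every prime $p$, with $s=\lceil Cp\rceil$, the image of $L(D)$ in $(R/I^s)\otimes\mathbb{Q}$ lies in $(R/I^s)\otimes\mathbb{Z}_{(p)}$ and its reduction modulo $p$ in $R/(pR+I^s)$ equals the image of $Det_p(D)$. (Such an element exists and is uniquely determined by this property.) The matrix $B(\varepsilon)$: $Dx^{j+\varepsilon}=\sum_{i\in\mathbb{Z}}b_{ij}(\varepsilon)x^{i+\varepsilon}$ with $b_{ij}(\varepsilon)\in R[\varepsilon]$; explicitly $$b_{ij}(\varepsilon)=\delta_{ij}\prod_{r=1}^n(i+\varepsilon-l_r)+\sum_{\max(0,j-i)\le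 k\le m}(j+\varepsilon)(j+\varepsilon-1)\cdots(j+\varepsilon-k+1)\,t_{k+i-j,k}.$$ For $a\le b$, $B_{a,b}(\varepsilon)=(b_{ij}(\varepsilon))_{a\le i,j\le b}$. Weierstrass polynomial: for $M,N>\max(|l_1|,|l_n|)$ one has $\det B_{-M,N}(\varepsilon)\equiv\varepsilon^n(k_0+k_1\varepsilon+\cdots)$ modulo $I$ with $k_0$ a nonzero integer, and there is a unique factorization $$\det B_{-M,N}(\varepsilon)=\big(\varepsilon^n-w_{1,-M,N}\varepsilon^{n-1}+\dots+(-1)^nw_{n,-M,N}\big)\,Q_{-M,N}(\varepsilon)$$ with $w_{i,-M,N}\in\hat I_{\mathbb{Q}}$ and $Q_{-M,N}(\varepsilon)$ an invertible element of $S[[\varepsilon]]$; the first factor is called the Weierstrass polynomial of $\det B_{-M,N}(\varepsilon)$. The $I$-adic limit $w(\varepsilon)$ of these polynomials as $M,N\to+\infty$ exists. *)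

theory Defs
  imports
    Complex_Main
    "HOL-Library.Poly_Mapping"
    "HOL-Computational_Algebra.Polynomial_FPS"
    "Jordan_Normal_Form.Determinant"
begin

section \<open>The polynomial ring and the powers of the ideal\<close>

text \<open>Polynomials over \<open>'c\<close> in the indeterminates \<open>t\<^sub>i\<^sub>j\<close> with \<open>i, j \<ge> 0\<close>.\<close>

type_synonym 'c tpoly = "((nat \<times> nat) \<Rightarrow>\<^sub>0 nat) \<Rightarrow>\<^sub>0 'c"

definition tvar :: "nat \<Rightarrow> nat \<Rightarrow> 'c::comm_ring_1 tpoly" where
  "tvar i j = Poly_Mapping.single (Poly_Mapping.single (i, j) 1) 1"

lemma module_times: "Modules.module ((*) :: 'a::comm_ring_1 \<Rightarrow> 'a \<Rightarrow> 'a)"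
  by unfold_locales (auto simp: algebra_simps)

definition ideal_gen :: "'a::comm_ring_1 set \<Rightarrow> 'a set" where
  "ideal_gen = Modules.module.span (*)"

definition ideal_power :: "'a::comm_ring_1 set \<Rightarrow> nat \<Rightarrow> 'a set" where
  "ideal_power J k = ideal_gen {\<Prod>i<k. a i | a. \<forall>i<k. a i \<in> J}"

definition tideal :: "int tpoly set" where
  "tideal = ideal_gen {tvar i j | i j. i \<le> j}"

definition rat_tpoly :: "int tpoly \<Rightarrow> rat tpoly" where
  "rat_tpoly = Poly_Mapping.map rat_of_int"

text \<open>With \<open>I = tideal\<close>, the ring \<open>(\<int>[t]/I\<^sup>k) \<otimes> \<rat>\<close> is the quotient of \<open>\<rat>[t]\<close> by the
  ideal generated by the image of \<open>I\<^sup>k\<close>.\<close>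

definition tideal_rat :: "nat \<Rightarrow> rat tpoly set" where
  "tideal_rat k = ideal_gen (rat_tpoly ` ideal_power tideal k)"

lemma ideal_gen_0: "0 \<in> ideal_gen X"
  by (simp add: ideal_gen_def Modules.module.span_zero[OF module_times])

lemma ideal_gen_base: "x \<in> X \<Longrightarrow> x \<in> ideal_gen X"
  by (simp add: ideal_gen_def Modules.module.span_base[OF module_times])

lemma ideal_gen_add: "x \<in> ideal_gen X \<Longrightarrow> y \<in> ideal_gen X \<Longrightarrow> x + y \<in> ideal_gen X"
  by (simp add: ideal_gen_def Modules.module.span_add[OF module_times])

lemma ideal_gen_diff: "x \<in> ideal_gen X \<Longrightarrow> y \<in> ideal_gen X \<Longrightarrow> x - y \<in> ideal_gen X"
  by (simp add: ideal_gen_def Modules.module.span_diff[OF module_times])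

lemma ideal_gen_minus: "x \<in> ideal_gen X \<Longrightarrow> - x \<in> ideal_gen X"
  by (simp add: ideal_gen_def Modules.module.span_neg[OF module_times])

lemma ideal_gen_mult: "x \<in> ideal_gen X \<Longrightarrow> c * x \<in> ideal_gen X"
  by (simp add: ideal_gen_def Modules.module.span_scale[OF module_times])

lemma ideal_gen_minimal:
  assumes "X \<subseteq> J" "0 \<in> J" "\<And>x y. x \<in> J \<Longrightarrow> y \<in> J \<Longrightarrow> x + y \<in> J"
    "\<And>c x. x \<in> J \<Longrightarrow> c * x \<in> J"
  shows "ideal_gen X \<subseteq> J"
  unfolding ideal_gen_def
  by (rule Modules.module.span_minimal[OF module_times assms(1)])
     (use assms(2-) in \<open>auto simp: Modules.module.subspace_def[OF module_times]\<close>)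

lemma ideal_power_Suc_subset: "ideal_power J (Suc k) \<subseteq> ideal_power J k"
  unfolding ideal_power_def
proof (rule ideal_gen_minimal)
  show "{\<Prod>i<Suc k. a i | a. \<forall>i<Suc k. a i \<in> J}
      \<subseteq> ideal_gen {\<Prod>i<k. a i | a. \<forall>i<k. a i \<in> J}"
  proof safe
    fix a assume "\<forall>i<Suc k. a i \<in> J"
    then have "(\<Prod>i<k. a i) \<in> {\<Prod>i<k. a i | a. \<forall>i<k. a i \<in> J}"
      by force
    from ideal_gen_mult[OF ideal_gen_base[OF this], of "a k"]
    show "(\<Prod>i<Suc k. a i) \<in> ideal_gen {\<Prod>i<k. a i | a. \<forall>i<k. a i \<in> J}"
      by (simp add: mult.commute)
  qed
qed (auto intro: ideal_gen_0 ideal_gen_add ideal_gen_mult)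

lemma tideal_rat_0: "0 \<in> tideal_rat k"
  by (simp add: tideal_rat_def ideal_gen_0)

lemma tideal_rat_add: "x \<in> tideal_rat k \<Longrightarrow> y \<in> tideal_rat k \<Longrightarrow> x + y \<in> tideal_rat k"
  by (simp add: tideal_rat_def ideal_gen_add)

lemma tideal_rat_diff: "x \<in> tideal_rat k \<Longrightarrow> y \<in> tideal_rat k \<Longrightarrow> x - y \<in> tideal_rat k"
  by (simp add: tideal_rat_def ideal_gen_diff)

lemma tideal_rat_minus: "x \<in> tideal_rat k \<Longrightarrow> - x \<in> tideal_rat k"
  by (simp add: tideal_rat_def ideal_gen_minus)

lemma tideal_rat_mult: "x \<in> tideal_rat k \<Longrightarrow> c * x \<in> tideal_rat k"
  by (simp add: tideal_rat_def ideal_gen_mult)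

lemma tideal_rat_Suc_subset: "tideal_rat (Suc k) \<subseteq> tideal_rat k"
proof -
  have "rat_tpoly ` ideal_power tideal (Suc k) \<subseteq> tideal_rat k"
    using ideal_power_Suc_subset[of tideal k] by (auto simp: tideal_rat_def intro!: ideal_gen_base)
  then have "ideal_gen (rat_tpoly ` ideal_power tideal (Suc k)) \<subseteq> tideal_rat k"
    by (rule ideal_gen_minimal) (auto intro: tideal_rat_0 tideal_rat_add tideal_rat_mult)
  then show ?thesis
    by (simp add: tideal_rat_def)
qed

lemma tideal_rat_antimono: "j \<le> k \<Longrightarrow> tideal_rat k \<subseteq> tideal_rat j"
  by (induction rule: dec_induct) (use tideal_rat_Suc_subset in blast)+

lemma monom_sum_eq_0_iff:
  fixes a b :: "(nat \<times> nat) \<Rightarrow>\<^sub>0 nat"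
  shows "a + b = 0 \<longleftrightarrow> a = 0 \<and> b = 0"
  by (auto simp: poly_mapping_eq_iff lookup_add fun_eq_iff)

lemma lookup_mult_0:
  fixes f g :: "'c::comm_ring_1 tpoly"
  shows "Poly_Mapping.lookup (f * g) 0 = Poly_Mapping.lookup f 0 * Poly_Mapping.lookup g 0"
proof -
  have *: "(0 = a + b) = (b = 0 \<and> a = 0)" for a b :: "(nat \<times> nat) \<Rightarrow>\<^sub>0 nat"
    using monom_sum_eq_0_iff[of a b] by auto
  have "Sum_any (\<lambda>q. Poly_Mapping.lookup g q when 0 = a + q)
      = (Poly_Mapping.lookup g 0 when a = 0)"
    for a :: "(nat \<times> nat) \<Rightarrow>\<^sub>0 nat"
    by (cases "a = 0") (simp_all add: *)
  then have "Poly_Mapping.lookup (f * g) 0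
      = Sum_any (\<lambda>a. Poly_Mapping.lookup f a * (Poly_Mapping.lookup g 0 when a = 0))"
    by (simp add: lookup_mult)
  also have "\<dots>
      = Sum_any (\<lambda>a. Poly_Mapping.lookup f a * Poly_Mapping.lookup g 0 when a = 0)"
    by (rule Sum_any.cong) (simp add: when_def)
  finally show ?thesis
    by simp
qed

lemma single_1_neq_0: "Poly_Mapping.single x (1::nat) \<noteq> 0"
  by (metis lookup_single_eq lookup_zero zero_neq_one)

lemma one_notin_tideal_rat: "1 \<notin> tideal_rat 1"
proof -
  have t: "tideal \<subseteq> {f. Poly_Mapping.lookup f 0 = 0}"
    unfolding tideal_def
    by (rule ideal_gen_minimal)
       (auto simp: single_1_neq_0[simplified] tvar_def lookup_single lookup_mult_0 lookup_add when_def)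
  have p: "ideal_power tideal 1 \<subseteq> {f. Poly_Mapping.lookup f 0 = 0}"
    unfolding ideal_power_def
    by (rule ideal_gen_minimal) (use t in \<open>auto simp: lookup_mult_0 lookup_add\<close>)
  have "tideal_rat 1 \<subseteq> {f. Poly_Mapping.lookup f 0 = 0}"
    unfolding tideal_rat_def
    by (rule ideal_gen_minimal)
       (use p in \<open>auto simp: lookup_mult_0 lookup_add rat_tpoly_def map.rep_eq when_def\<close>)
  then show ?thesis
    by (auto simp: lookup_one)
qed


section \<open>The completed ring \<open>S\<close>\<close>

text \<open>An element of the inverse limit is a compatible sequence of classes
  modulo \<open>tideal_rat k\<close>; it is presented by a sequence of representatives.\<close>

definition compatible_seq :: "(nat \<Rightarrow> rat tpoly) \<Rightarrow> bool" where
  "compatible_seq a \<longleftrightarrow> (\<forall>k. a (Suc k) - a k \<in> tideal_rat k)"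

definition lim_rel :: "(nat \<Rightarrow> rat tpoly) \<Rightarrow> (nat \<Rightarrow> rat tpoly) \<Rightarrow> bool" where
  "lim_rel a b \<longleftrightarrow> compatible_seq a \<and> compatible_seq b \<and> (\<forall>k. a k - b k \<in> tideal_rat k)"

lemma compatible_const: "compatible_seq (\<lambda>_. f)"
  by (simp add: compatible_seq_def tideal_rat_0)

lemma compatible_add:
  "compatible_seq a \<Longrightarrow> compatible_seq b \<Longrightarrow> compatible_seq (\<lambda>k. a k + b k)"
  unfolding compatible_seq_def using tideal_rat_add by (force simp: add_diff_add)

lemma compatible_minus: "compatible_seq a \<Longrightarrow> compatible_seq (\<lambda>k. - a k)"
  unfolding compatible_seq_def using tideal_rat_minus by (metis minus_diff_minus)

lemma tideal_rat_mult_cong: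
  assumes "x - x' \<in> tideal_rat k" "y - y' \<in> tideal_rat k"
  shows "x * y - x' * y' \<in> tideal_rat k"
proof -
  have "x * y - x' * y' = y * (x - x') + x' * (y - y')"
    by (simp add: algebra_simps)
  then show ?thesis
    by (simp add: assms tideal_rat_add tideal_rat_mult)
qed

lemma compatible_mult:
  "compatible_seq a \<Longrightarrow> compatible_seq b \<Longrightarrow> compatible_seq (\<lambda>k. a k * b k)"
  unfolding compatible_seq_def by (blast intro: tideal_rat_mult_cong)

lemma lim_rel_part_equivp: "part_equivp lim_rel"
proof (rule part_equivpI)
  show "\<exists>a. lim_rel a a"
    by (rule exI[of _ "\<lambda>_. 0"]) (simp add: lim_rel_def compatible_const tideal_rat_0)
  show "symp lim_rel"
  proof (rule sympI)
    fix a b assume "lim_rel a b"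
    then show "lim_rel b a"
      unfolding lim_rel_def using tideal_rat_minus by (metis minus_diff_eq)
  qed
  show "transp lim_rel"
  proof (rule transpI)
    fix a b c assume "lim_rel a b" "lim_rel b c"
    moreover have "a k - c k = (a k - b k) + (b k - c k)" for k
      by simp
    ultimately show "lim_rel a c"
      unfolding lim_rel_def using tideal_rat_add by metis
  qed
qed

quotient_type compl_ring = "nat \<Rightarrow> rat tpoly" / partial: lim_rel
  by (rule lim_rel_part_equivp)

instantiation compl_ring :: comm_ring_1
begin

lift_definition zero_compl_ring :: compl_ring is "\<lambda>_. 0"
  by (simp add: lim_rel_def compatible_const tideal_rat_0)

lift_definition one_compl_ring :: compl_ring is "\<lambda>_. 1"
  by (simp add: lim_rel_def compatible_const tideal_rat_0)

lift_definition plus_compl_ring :: "compl_ring \<Rightarrow> compl_ring \<Rightarrow> compl_ring"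
  is "\<lambda>a b k. a k + b k"
  by (auto simp: lim_rel_def compatible_add add_diff_add intro: tideal_rat_add)

lift_definition uminus_compl_ring :: "compl_ring \<Rightarrow> compl_ring" is "\<lambda>a k. - a k"
  unfolding lim_rel_def using compatible_minus tideal_rat_minus by (metis minus_diff_minus)

lift_definition times_compl_ring :: "compl_ring \<Rightarrow> compl_ring \<Rightarrow> compl_ring"
  is "\<lambda>a b k. a k * b k"
  by (auto simp: lim_rel_def compatible_mult intro: tideal_rat_mult_cong)

definition minus_compl_ring :: "compl_ring \<Rightarrow> compl_ring \<Rightarrow> compl_ring" where
  "minus_compl_ring a b = a + - b"

instance
proof
  fix a b c :: compl_ring
  show "a + b + c = a + (b + c)"
    by transfer (auto simp: lim_rel_def compatible_add add.assoc tideal_rat_0)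
  show "a + b = b + a"
    by transfer (auto simp: lim_rel_def compatible_add add.commute tideal_rat_0)
  show "0 + a = a"
    by transfer (auto simp: lim_rel_def tideal_rat_0)
  show "- a + a = 0"
    by transfer (auto simp: lim_rel_def compatible_const tideal_rat_0)
  show "a - b = a + - b"
    by (simp add: minus_compl_ring_def)
  show "a * b * c = a * (b * c)"
    by transfer (auto simp: lim_rel_def compatible_mult mult.assoc tideal_rat_0)
  show "a * b = b * a"
    by transfer (auto simp: lim_rel_def compatible_mult mult.commute tideal_rat_0)
  show "1 * a = a"
    by transfer (auto simp: lim_rel_def tideal_rat_0)
  show "(a + b) * c = a * c + b * c"
    by transfer
      (auto simp: lim_rel_def compatible_mult compatible_add distrib_right tideal_rat_0)
  show "(0::compl_ring) \<noteq> 1"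
  proof transfer
    show "\<not> lim_rel (\<lambda>_. 0) (\<lambda>_. 1)"
      using one_notin_tideal_rat tideal_rat_minus[of "-1" 1] by (auto simp: lim_rel_def)
  qed
qed

end

text \<open>\<open>level_ker k\<close> is the kernel of the projection \<open>S \<rightarrow> (\<int>[t]/I\<^sup>k) \<otimes> \<rat>\<close>.\<close>

lift_definition in_level_ker :: "nat \<Rightarrow> compl_ring \<Rightarrow> bool" is "\<lambda>k a. a k \<in> tideal_rat k"
proof -
  fix k :: nat and a b assume "lim_rel a b"
  then have d: "a k - b k \<in> tideal_rat k"
    by (simp add: lim_rel_def)
  show "(a k \<in> tideal_rat k) = (b k \<in> tideal_rat k)"
    using tideal_rat_add[OF d, of "b k"] tideal_rat_diff[OF _ d, of "a k"] by auto
qed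

definition level_ker :: "nat \<Rightarrow> compl_ring set" where
  "level_ker k = {a. in_level_ker k a}"

lift_definition of_tpoly :: "int tpoly \<Rightarrow> compl_ring" is "\<lambda>f _. rat_tpoly f"
  by (simp add: lim_rel_def compatible_const tideal_rat_0)

lemma level_ker_0: "0 \<in> level_ker k"
  unfolding level_ker_def mem_Collect_eq by transfer (simp add: tideal_rat_0)

lemma level_ker_add: "a \<in> level_ker k \<Longrightarrow> b \<in> level_ker k \<Longrightarrow> a + b \<in> level_ker k"
  unfolding level_ker_def mem_Collect_eq by transfer (simp add: tideal_rat_add)

lemma level_ker_minus: "a \<in> level_ker k \<Longrightarrow> - a \<in> level_ker k"
  unfolding level_ker_def mem_Collect_eq by transfer (simp add: tideal_rat_minus)

lemma compatible_le:
  assumes "compatible_seq a" "j \<le> k"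
  shows "a k - a j \<in> tideal_rat j"
  using assms(2)
proof (induction k rule: dec_induct)
  case base
  show ?case by (simp add: tideal_rat_0)
next
  case (step k)
  have "a (Suc k) - a k \<in> tideal_rat j"
    using assms(1) tideal_rat_antimono[OF step(1)] by (auto simp: compatible_seq_def)
  from tideal_rat_add[OF this step(3)] show ?case by simp
qed

lemma level_ker_antimono:
  assumes "j \<le> k"
  shows "level_ker k \<subseteq> level_ker j"
proof -
  have "in_level_ker k a \<longrightarrow> in_level_ker j a" for a
  proof (transfer fixing: j k, rule impI)
    fix a assume a: "lim_rel a a" "a k \<in> tideal_rat k"
    then have "a k - a j \<in> tideal_rat j"
      using compatible_le[OF _ assms] by (simp add: lim_rel_def)
    moreover have "a k \<in> tideal_rat j"
      using a(2) tideal_rat_antimono[OF assms] by blast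
    ultimately show "a j \<in> tideal_rat j"
      using tideal_rat_diff[of "a k" j "a k - a j"] by simp
  qed
  then show ?thesis
    by (auto simp: level_ker_def)
qed

lemma level_ker_separated:
  assumes "\<And>k. a \<in> level_ker k"
  shows "a = 0"
proof -
  have "\<forall>k. in_level_ker k a"
    using assms by (simp add: level_ker_def)
  then show ?thesis
    by transfer (auto simp: lim_rel_def compatible_const)
qed

text \<open>The inverse limit topology of the discrete rings \<open>(\<int>[t]/I\<^sup>k) \<otimes> \<rat>\<close>: the cosets of
  the subgroups \<open>level_ker k\<close> form a basis.\<close>

instantiation compl_ring :: t2_space
begin

definition open_compl_ring :: "compl_ring set \<Rightarrow> bool" where
  "open_compl_ring U \<longleftrightarrow> (\<forall>a\<in>U. \<exists>k. \<forall>b. b - a \<in> level_ker k \<longrightarrow> b \<in> U)"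

instance
proof
  show "open (UNIV :: compl_ring set)"
    by (simp add: open_compl_ring_def)
  show "open (U \<inter> V)" if UV: "open U" "open V" for U V :: "compl_ring set"
    unfolding open_compl_ring_def
  proof
    fix a assume "a \<in> U \<inter> V"
    then have "a \<in> U" "a \<in> V"
      by auto
    then obtain j k where j: "\<forall>b. b - a \<in> level_ker j \<longrightarrow> b \<in> U"
      and k: "\<forall>b. b - a \<in> level_ker k \<longrightarrow> b \<in> V"
      using UV unfolding open_compl_ring_def by meson
    show "\<exists>k. \<forall>b. b - a \<in> level_ker k \<longrightarrow> b \<in> U \<inter> V"
    proof (intro exI[of _ "max j k"] allI impI IntI)
      fix b assume "b - a \<in> level_ker (max j k)"
      then show "b \<in> U" "b \<in> V"
        using j k level_ker_antimono[of j "max j k"] level_ker_antimono[of k "max j k"]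
        by (meson max.cobounded1 max.cobounded2 subsetD)+
    qed
  qed
  show "open (\<Union>\<U>)" if "\<forall>U\<in>\<U>. open U" for \<U> :: "compl_ring set set"
    unfolding open_compl_ring_def
  proof
    fix a assume "a \<in> \<Union>\<U>"
    then obtain U where U: "U \<in> \<U>" "a \<in> U"
      by blast
    with that obtain k where "\<forall>b. b - a \<in> level_ker k \<longrightarrow> b \<in> U"
      unfolding open_compl_ring_def by meson
    with U show "\<exists>k. \<forall>b. b - a \<in> level_ker k \<longrightarrow> b \<in> \<Union>\<U>"
      by blast
  qed
  show "\<exists>U V. open U \<and> open V \<and> a \<in> U \<and> b \<in> V \<and> U \<inter> V = {}"
    if "a \<noteq> b" for a b :: compl_ring
  proof -
    from that have "a - b \<noteq> 0"
      by simp
    then obtain k where k: "a - b \<notin> level_ker k"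
      using level_ker_separated by blast
    have "open {c. c - d \<in> level_ker k}" for d
      unfolding open_compl_ring_def
    proof (intro ballI exI[of _ k] allI impI)
      fix c b assume "c \<in> {c. c - d \<in> level_ker k}" "b - c \<in> level_ker k"
      then have "(b - c) + (c - d) \<in> level_ker k"
        by (intro level_ker_add) simp_all
      then show "b \<in> {c. c - d \<in> level_ker k}"
        by simp
    qed
    moreover have "{c. c - a \<in> level_ker k} \<inter> {c. c - b \<in> level_ker k} = {}"
    proof safe
      fix c assume "c - a \<in> level_ker k" "c - b \<in> level_ker k"
      then have "(c - b) + - (c - a) \<in> level_ker k"
        by (intro level_ker_add level_ker_minus)
      with k show "c \<in> {}" by simp
    qed
    ultimately show ?thesis
      by (intro exI[of _ "{c. c - a \<in> level_ker k}"] exI[of _ "{c. c - b \<in> level_ker k}"])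
         (simp add: level_ker_0)
  qed
qed

end


section \<open>The operator, its \<open>p\<close>-determinants and their universal lift\<close>

text \<open>The parameters \<open>n\<close>, \<open>m\<close> and \<open>l 1, \<dots>, l n\<close> determine \<open>D\<close>, acting on power series in \<open>x\<close>.
  The sum over \<open>i\<close> of the \<open>t\<^sub>i\<^sub>j x\<^sup>i\<close> is multiplication by one power series.\<close>

definition diff_op :: "nat \<Rightarrow> nat \<Rightarrow> (nat \<Rightarrow> int) \<Rightarrow> int tpoly fps \<Rightarrow> int tpoly fps" where
  "diff_op n m l f =
     foldr (\<lambda>r g. fps_X * fps_deriv g - of_int (l r) * g) [1..<Suc n] f
     + (\<Sum>j\<le>m. Abs_fps (\<lambda>i. tvar i j) * (fps_deriv ^^ j) f)"

text \<open>The matrix of the map induced by \<open>D\<close> on \<open>V/V\<^sup>(\<^sup>p\<^sup>)\<close> consists of the coefficients of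
  \<open>x\<^sup>i\<close> in \<open>D x\<^sup>j\<close> for \<open>i, j < p\<close>. Its determinant is formed over \<open>\<int>[t]\<close> here, and only its
  class modulo \<open>p\<close> is used below: this class is the determinant of the reduced matrix.\<close>

definition Det_p :: "nat \<Rightarrow> nat \<Rightarrow> (nat \<Rightarrow> int) \<Rightarrow> nat \<Rightarrow> int tpoly" where
  "Det_p n m l p = det (mat p p (\<lambda>(i, j). fps_nth (diff_op n m l (fps_X ^ j)) i))"

text \<open>The image of \<open>a\<close> in \<open>(\<int>[t]/I\<^sup>s) \<otimes> \<rat>\<close> is a fraction \<open>f/q\<close> with \<open>f \<in> \<int>[t]/I\<^sup>s\<close> and
  \<open>q\<close> prime to \<open>p\<close>, i.e. lies in \<open>(\<int>[t]/I\<^sup>s) \<otimes> \<int>\<^sub>(\<^sub>p\<^sub>)\<close>, and its reduction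
  \<open>q\<^sup>-\<^sup>1 f\<close> in \<open>\<int>[t]/(p \<int>[t] + I\<^sup>s)\<close> is the class of \<open>d\<close>. The choice of the fraction does not
  matter because \<open>\<int>[t]/I\<^sup>s\<close> is torsion-free.\<close>

definition reduces_to :: "nat \<Rightarrow> nat \<Rightarrow> compl_ring \<Rightarrow> int tpoly \<Rightarrow> bool" where
  "reduces_to p s a d \<longleftrightarrow>
     (\<exists>f q. coprime q (int p) \<and> of_int q * a - of_tpoly f \<in> level_ker s \<and>
        (\<exists>g. \<exists>h\<in>ideal_power tideal s. f - of_int q * d = of_nat p * g + h))"

definition is_universal_lift :: "nat \<Rightarrow> nat \<Rightarrow> (nat \<Rightarrow> int) \<Rightarrow> compl_ring \<Rightarrow> bool" where
  "is_universal_lift n m l a \<longleftrightarrow>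
     (\<exists>C::real. C > 0 \<and> (\<forall>p. prime p \<longrightarrow> reduces_to p (nat \<lceil>C * real p\<rceil>) a (Det_p n m l p)))"

definition universal_lift :: "nat \<Rightarrow> nat \<Rightarrow> (nat \<Rightarrow> int) \<Rightarrow> compl_ring" where
  "universal_lift n m l = (THE a. is_universal_lift n m l a)"


section \<open>The matrix \<open>B(\<epsilon>)\<close> and the limit of the Weierstrass polynomials\<close>

text \<open>Polynomials in \<open>\<epsilon>\<close> over \<open>\<int>[t]\<close>; \<open>[:c, 1:]\<close> is \<open>c + \<epsilon>\<close>.\<close>

definition B_entry :: "nat \<Rightarrow> nat \<Rightarrow> (nat \<Rightarrow> int) \<Rightarrow> int \<Rightarrow> int \<Rightarrow> int tpoly poly" where
  "B_entry n m l i j =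
     (if i = j then \<Prod>r=1..n. [:of_int (i - l r), 1:] else 0)
     + (\<Sum>k \<in> {k. k \<le> m \<and> j - i \<le> int k}.
          (\<Prod>r<k. [:of_int (j - int r), 1:]) * [:tvar (nat (int k + i - j)) k:])"

definition B_matrix :: "nat \<Rightarrow> nat \<Rightarrow> (nat \<Rightarrow> int) \<Rightarrow> int \<Rightarrow> int \<Rightarrow> int tpoly poly mat" where
  "B_matrix n m l a b =
     mat (nat (b - a + 1)) (nat (b - a + 1)) (\<lambda>(i, j). B_entry n m l (a + int i) (a + int j))"

definition is_weierstrass_poly :: "nat \<Rightarrow> compl_ring fps \<Rightarrow> compl_ring poly \<Rightarrow> bool" where
  "is_weierstrass_poly n F W \<longleftrightarrow>
     degree W = n \<and> lead_coeff W = 1 \<and> (\<forall>i<n. coeff W i \<in> level_ker 1) \<and>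
     (\<exists>Q. Q dvd 1 \<and> F = fps_of_poly W * Q)"

definition weierstrass_poly :: "nat \<Rightarrow> compl_ring fps \<Rightarrow> compl_ring poly" where
  "weierstrass_poly n F = (THE W. is_weierstrass_poly n F W)"

text \<open>The Weierstrass polynomial of \<open>det B\<close> for the index range from \<open>-M\<close> to \<open>N\<close>; it is
  meaningful for \<open>M, N > max \<bar>l 1\<bar> \<bar>l n\<bar>\<close>.\<close>

definition B_weierstrass ::
  "nat \<Rightarrow> nat \<Rightarrow> (nat \<Rightarrow> int) \<Rightarrow> nat \<Rightarrow> nat \<Rightarrow> compl_ring poly" where
  "B_weierstrass n m l M N =
     weierstrass_poly n
       (fps_of_poly (map_poly of_tpoly (det (B_matrix n m l (- int M) (int N)))))"

definition limit_weierstrass :: "nat \<Rightarrow> nat \<Rightarrow> (nat \<Rightarrow> int) \<Rightarrow> compl_ring poly" where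
  "limit_weierstrass n m l =
     (THE w. \<forall>i. ((\<lambda>(M, N). coeff (B_weierstrass n m l M N) i) \<longlongrightarrow> coeff w i)
                   (sequentially \<times>\<^sub>F sequentially))"

end

theory Submission
  imports Defs "HOL-Library.Product_Lexorder"
begin

text \<open>Entries of \<open>B(\<epsilon>)\<close> above the diagonal lie in \<open>I\<close> and reach at most \<open>m\<close> places up, so the
  cross term of Dodgson's identity for the principal minors on long windows has high order. Up to
  high order, the ratio of two minors whose windows differ by one place at an end therefore depends
  on that end only. Far from the \<open>l r\<close> these ratios are units at \<open>\<epsilon> = 0\<close>, so the Weierstrass
  polynomials stabilize.

  Modulo a prime \<open>p\<close> the ratios are periodic, and their product over one period is a polynomial \<open>\<Pi>\<close>,
  invariant under \<open>\<epsilon> \<mapsto> \<epsilon> + 1\<close>, with \<open>\<Pi>(0) = Det\<^sub>p(D)\<close>. Weights bound its degree below \<open>(n + 1) p\<close>, so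
  it is a polynomial of degree \<open>n\<close> in \<open>\<epsilon>\<^sup>p - \<epsilon>\<close>, and finite differences show that it is monic. As
  \<open>\<epsilon>\<^sup>p - \<epsilon> \<equiv> -\<epsilon>\<close> modulo \<open>\<epsilon>\<^sup>p\<close>, the polynomial \<open>(-1)\<^sup>n \<Pi>\<close> agrees modulo \<open>\<epsilon>\<^sup>p\<close> with a monic polynomial of
  degree \<open>n\<close>, which must be the Weierstrass polynomial. Evaluation at \<open>0\<close> gives the theorem.\<close>

section \<open>Ideals and multiplicative filtrations\<close>

text \<open>The lift lives over the rationals, while its defining property is a congruence modulo p.
  The Weierstrass polynomial over the window used at p must therefore be shown p-integral up to
  order s before it can be compared with anything modulo p, and since s grows linearly with p, all
  bounds on windows, degrees and orders have to be linear in s.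

  Monicity of the periodic product is the delicate point. Weights bound its degree but do not
  determine the coefficient of eps^(n p), which compares the top coefficients of two minors, each
  only congruent to 1 modulo I. Modulo every power of I these top coefficients are polynomial in the
  length of the window, and a step of length p does not change such a function modulo p if its
  degree is below p.

  Quotient rings of R are not formed: a congruence is membership of a difference in an ideal, and
  division is cancellation of factors that are monic modulo I. Small primes, for which the size
  conditions fail, are covered by a constant C so small that their level is 1.\<close>

locale ideal_set =
  fixes A :: "'a::comm_ring_1 set"
  assumes zero: "0 \<in> A"
    and add: "x \<in> A \<Longrightarrow> y \<in> A \<Longrightarrow> x + y \<in> A"
    and absorb: "x \<in> A \<Longrightarrow> c * x \<in> A"
begin

lemma absorb_right: "x \<in> A \<Longrightarrow> x * c \<in> A"
  using absorb[of x c] by (simp add: mult.commute)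

lemma minus: "x \<in> A \<Longrightarrow> - x \<in> A"
  using absorb[of x "-1"] by simp

lemma diff: "x \<in> A \<Longrightarrow> y \<in> A \<Longrightarrow> x - y \<in> A"
  using add[OF _ minus] by simp

lemma sum: "(\<And>i. i \<in> S \<Longrightarrow> f i \<in> A) \<Longrightarrow> sum f S \<in> A"
  by (induction S rule: infinite_finite_induct) (auto intro: zero add)

lemma diff_commute: "x - y \<in> A \<Longrightarrow> y - x \<in> A"
  using minus[of "x - y"] by simp

lemma diff_trans: "x - y \<in> A \<Longrightarrow> y - z \<in> A \<Longrightarrow> x - z \<in> A"
  using add[of "x - y" "y - z"] by simp

lemma cong_add: "x - x' \<in> A \<Longrightarrow> y - y' \<in> A \<Longrightarrow> (x + y) - (x' + y') \<in> A"
  using add[of "x - x'" "y - y'"] by (simp add: algebra_simps)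

lemma cong_mult: "x - x' \<in> A \<Longrightarrow> y - y' \<in> A \<Longrightarrow> x * y - x' * y' \<in> A"
  using add[OF absorb[of "x - x'" y] absorb[of "y - y'" x']] by (simp add: algebra_simps)

lemma cong_mem: "x - y \<in> A \<Longrightarrow> x \<in> A \<longleftrightarrow> y \<in> A"
  using add[of "x - y" y] diff[of x "x - y"] by auto

lemma cong_sum: "(\<And>i. i \<in> S \<Longrightarrow> f i - g i \<in> A) \<Longrightarrow> sum f S - sum g S \<in> A"
  using sum[of S "\<lambda>i. f i - g i"] by (simp add: sum_subtractf)

lemma cong_prod: "(\<And>i. i \<in> S \<Longrightarrow> f i - g i \<in> A) \<Longrightarrow> prod f S - prod g S \<in> A"
  by (induction S rule: infinite_finite_induct) (auto intro: cong_mult simp: zero)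

lemma cong_power: "x - y \<in> A \<Longrightarrow> x ^ k - y ^ k \<in> A"
  by (induction k) (auto intro: cong_mult simp: zero)

lemma prod_mem: "finite S \<Longrightarrow> i \<in> S \<Longrightarrow> f i \<in> A \<Longrightarrow> prod f S \<in> A"
  by (simp add: prod.remove absorb_right)

lemma cong_det:
  assumes "M \<in> carrier_mat k k" "M' \<in> carrier_mat k k"
    and "\<And>i j. i < k \<Longrightarrow> j < k \<Longrightarrow> M $$ (i, j) - M' $$ (i, j) \<in> A"
  shows "det M - det M' \<in> A"
  unfolding det_def'[OF assms(1)] det_def'[OF assms(2)]
proof (rule cong_sum)
  fix q assume "q \<in> {q. q permutes {0..<k}}"
  then have q: "q i < k" if "i < k" for i
    using that permutes_in_image[of q "{0..<k}" i] by simp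
  show "signof q * (\<Prod>i = 0..<k. M $$ (i, q i)) - signof q * (\<Prod>i = 0..<k. M' $$ (i, q i)) \<in> A"
    using q by (intro cong_mult cong_prod assms(3)) (auto simp: zero)
qed

end

definition coeffs_in :: "'a::comm_ring_1 set \<Rightarrow> 'a poly set" where
  "coeffs_in A = {P. \<forall>i. coeff P i \<in> A}"

lemma coeffs_inI: "(\<And>i. coeff P i \<in> A) \<Longrightarrow> P \<in> coeffs_in A"
  and coeffs_inD: "P \<in> coeffs_in A \<Longrightarrow> coeff P i \<in> A"
  by (auto simp: coeffs_in_def)

lemma coeffs_in_UNIV [simp]: "coeffs_in UNIV = UNIV"
  by (auto simp: coeffs_in_def)

lemma coeffs_in_mono: "A \<subseteq> B \<Longrightarrow> coeffs_in A \<subseteq> coeffs_in B"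
  by (auto simp: coeffs_in_def)

context ideal_set
begin

lemma const_in: "c \<in> A \<Longrightarrow> [:c:] \<in> coeffs_in A"
  by (auto simp: coeffs_in_def coeff_pCons zero split: nat.split)

lemma ideal_coeffs_in: "ideal_set (coeffs_in A)"
proof
  show "c * P \<in> coeffs_in A" if "P \<in> coeffs_in A" for c P
    using that by (auto simp: coeffs_in_def coeff_mult intro!: sum absorb)
qed (auto simp: coeffs_in_def zero add)

text \<open>Used with \<open>c\<close> equal to p: minors over windows that differ by a translation
  by p become congruent modulo p.\<close>

lemma pcompose_shift:
  assumes "c \<in> A"
  shows "pcompose P [:c, 1:] - P \<in> coeffs_in A"
proof -
  interpret P: ideal_set "coeffs_in A" by (rule ideal_coeffs_in)
  have *: "[:c, 1:] - [:0, 1:] \<in> coeffs_in A"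
    using const_in[OF assms] by simp
  show ?thesis
  proof (induction P)
    case (pCons a P)
    have "pcompose (pCons a P) [:c, 1:] - pCons a P = [:c, 1:] * pcompose P [:c, 1:] - [:0, 1:] * P"
      by (simp add: pcompose_pCons)
    then show ?case
      using P.cong_mult[OF * pCons.IH] by simp
  qed (simp add: P.zero)
qed

lemma pcompose_mem:
  assumes "P \<in> coeffs_in A"
  shows "pcompose P Q \<in> coeffs_in A"
  using assms
proof (induction P)
  case (pCons a P)
  interpret P: ideal_set "coeffs_in A" by (rule ideal_coeffs_in)
  have "a \<in> A" "P \<in> coeffs_in A"
    using coeffs_inD[OF pCons.prems, of 0] coeffs_inD[OF pCons.prems, of "Suc i" for i]
    by (auto simp: coeffs_in_def)
  then show ?case
    by (simp add: pcompose_pCons P.add P.absorb const_in pCons.IH)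
qed (simp add: coeffs_in_def zero)

lemma poly_mem: "P \<in> coeffs_in A \<Longrightarrow> poly P x \<in> A"
  unfolding poly_altdef by (intro sum absorb_right coeffs_inD)

lemma poly_cong: "P - Q \<in> coeffs_in A \<Longrightarrow> poly P x - poly Q x \<in> A"
  using poly_mem[of "P - Q"] by simp

end

text \<open>One interface for the powers of I, their sums with the multiples of p, the
  coefficientwise versions of both, and the kernels of the projections of S.\<close>

locale filtration =
  fixes I :: "nat \<Rightarrow> 'a::comm_ring_1 set"
  assumes ideal: "ideal_set (I k)"
    and I_0: "I 0 = UNIV"
    and I_Suc: "I (Suc k) \<subseteq> I k"
    and I_mult: "x \<in> I j \<Longrightarrow> y \<in> I k \<Longrightarrow> x * y \<in> I (j + k)"
begin

sublocale ideal_set "I k" for k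
  by (rule ideal)

lemma antimono: "j \<le> k \<Longrightarrow> I k \<subseteq> I j"
  by (induction k rule: dec_induct) (use I_Suc in blast)+

lemma antimonoD: "x \<in> I k \<Longrightarrow> j \<le> k \<Longrightarrow> x \<in> I j"
  using antimono by blast

lemma I_mult_le: "x \<in> I j \<Longrightarrow> y \<in> I k \<Longrightarrow> i \<le> j + k \<Longrightarrow> x * y \<in> I i"
  using I_mult antimonoD by blast

lemma I_prod: "finite S \<Longrightarrow> (\<And>i. i \<in> S \<Longrightarrow> f i \<in> I (e i)) \<Longrightarrow> prod f S \<in> I (sum e S)"
  by (induction S rule: finite_induct) (auto simp: I_0 intro: I_mult)

lemma I_power: "x \<in> I 1 \<Longrightarrow> x ^ k \<in> I k"
  using I_mult[of x 1] by (induction k) (auto simp: I_0)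

lemma filtration_coeffs_in: "filtration (\<lambda>k. coeffs_in (I k))"
proof
  show "x * y \<in> coeffs_in (I (j + k))" if "x \<in> coeffs_in (I j)" "y \<in> coeffs_in (I k)" for x y j k
    using that by (auto simp: coeffs_in_def coeff_mult intro!: sum I_mult)
  show "coeffs_in (I (Suc k)) \<subseteq> coeffs_in (I k)" for k
    by (rule coeffs_in_mono[OF I_Suc])
qed (use ideal_coeffs_in in \<open>auto simp: I_0 ideal_set_def\<close>)

text \<open>The element \<open>c\<close> lies in every level. For \<open>c\<close> equal to p this
  is the I-adic filtration of R/pR pulled back to R, not the powers of the ideal generated by p and
  I.\<close>

lemma filtration_add_multiples: "filtration (\<lambda>k. {c * g + h | g h. h \<in> I k})"
proof
  fix k
  show "0 \<in> {c * g + h | g h. h \<in> I k}"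
    by (auto intro!: exI[of _ 0] zero)
  show "x + y \<in> {c * g + h | g h. h \<in> I k}"
    if "x \<in> {c * g + h | g h. h \<in> I k}" "y \<in> {c * g + h | g h. h \<in> I k}" for x y
  proof -
    from that obtain g h g' h' where "x = c * g + h" "h \<in> I k" "y = c * g' + h'" "h' \<in> I k"
      by blast
    then have "x + y = c * (g + g') + (h + h')" "h + h' \<in> I k"
      by (auto intro: add simp: algebra_simps)
    then show ?thesis by blast
  qed
  show "d * x \<in> {c * g + h | g h. h \<in> I k}" if "x \<in> {c * g + h | g h. h \<in> I k}" for x d
  proof -
    from that obtain g h where "x = c * g + h" "h \<in> I k"
      by blast
    then have "d * x = c * (d * g) + d * h" "d * h \<in> I k"
      by (auto intro: absorb simp: algebra_simps)
    then show ?thesis by blast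
  qed
  show "{c * g + h | g h. h \<in> I (Suc k)} \<subseteq> {c * g + h | g h. h \<in> I k}"
    using I_Suc by blast
next
  have "x = c * 0 + x" for x by simp
  then show "{c * g + h | g h. h \<in> I 0} = UNIV"
    unfolding I_0 by blast
next
  fix x y j k
  assume "x \<in> {c * g + h | g h. h \<in> I j}" "y \<in> {c * g + h | g h. h \<in> I k}"
  then obtain g h g' h' where "x = c * g + h" "h \<in> I j" "y = c * g' + h'" "h' \<in> I k"
    by blast
  then have "x * y = c * (g * c * g' + g * h' + h * g') + h * h'" "h * h' \<in> I (j + k)"
    by (simp_all add: I_mult) (simp add: algebra_simps)
  then show "x * y \<in> {c * g + h | g h. h \<in> I (j + k)}"
    by blast
qed

section \<open>Cancellation of factors that are monic modulo the ideal\<close>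

definition monic_mod :: "nat \<Rightarrow> 'a poly \<Rightarrow> bool" where
  "monic_mod d F \<longleftrightarrow> coeff F d - 1 \<in> I 1 \<and> (\<forall>i>d. coeff F i \<in> I 1)"

lemma monic_mod_cong: "F - G \<in> coeffs_in (I 1) \<Longrightarrow> monic_mod d F \<longleftrightarrow> monic_mod d G"
  unfolding monic_mod_def
  using cong_mem[of "coeff F d - 1" "coeff G d - 1" 1] cong_mem[of "coeff F i" "coeff G i" 1 for i]
  by (auto simp: coeffs_in_def)

lemma monic_mod_monic: "degree F = d \<Longrightarrow> coeff F d = 1 \<Longrightarrow> monic_mod d F"
  by (auto simp: monic_mod_def zero coeff_eq_0)

text \<open>Two nested inductions: on the order \<open>k\<close>, and within it downwards on the
  index of the coefficient. In coefficient \<open>d + i\<close> of the product, the terms with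
  \<open>j < d\<close> involve higher coefficients of \<open>P\<close>, and those with
  \<open>j > d\<close> gain one order from \<open>F\<close>.\<close>

lemma cancel_monic_mod:
  assumes F: "monic_mod d F" and FP: "F * P \<in> coeffs_in (I s)"
  shows "P \<in> coeffs_in (I s)"
proof -
  have "P \<in> coeffs_in (I k)" if "k \<le> s" for k
    using that
  proof (induction k)
    case (Suc k)
    then have P: "P \<in> coeffs_in (I k)" by simp
    have "\<forall>i\<ge>j. coeff P i \<in> I (Suc k)" if "j \<le> Suc (degree P)" for j
      using that
    proof (induction j rule: inc_induct)
      case base
      then show ?case by (auto simp: coeff_eq_0 zero)
    next
      case (step i)
      have "coeff (F * P) (d + i) \<in> I (Suc k)"
        using FP Suc.prems antimonoD coeffs_inD by blast
      moreover have "coeff (F * P) (d + i) =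
          coeff F d * coeff P i + (\<Sum>j\<in>{..d + i} - {d}. coeff F j * coeff P (d + i - j))"
        unfolding coeff_mult by (subst sum.remove[of _ d]) auto
      moreover have "coeff F j * coeff P (d + i - j) \<in> I (Suc k)" if "j \<in> {..d + i} - {d}" for j
      proof (cases "j < d")
        case True
        then show ?thesis
          using step.IH by (intro absorb) auto
      next
        case False
        then have "coeff F j \<in> I 1"
          using F that by (auto simp: monic_mod_def)
        from I_mult[OF this coeffs_inD[OF P]] show ?thesis
          by simp
      qed
      ultimately have "coeff F d * coeff P i \<in> I (Suc k)"
        using diff[of "coeff (F * P) (d + i)" "Suc k"]
        by (metis (no_types, lifting) add_diff_cancel_right' sum)
      moreover have "(coeff F d - 1) * coeff P i \<in> I (Suc k)"
        using I_mult[of "coeff F d - 1" 1 "coeff P i" k] F coeffs_inD[OF P]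
        by (auto simp: monic_mod_def)
      ultimately have "coeff P i \<in> I (Suc k)"
        using diff by (fastforce simp: algebra_simps)
      then show ?case
        using step.IH by (metis Suc_leI le_neq_implies_less)
    qed
    from this[of 0] show ?case
      by (auto simp: coeffs_in_def)
  qed (simp add: I_0)
  then show ?thesis by simp
qed

lemma monic_mod_cancel:
  assumes "monic_mod d F" "F * P - F * Q \<in> coeffs_in (I s)"
  shows "P - Q \<in> coeffs_in (I s)"
  by (rule cancel_monic_mod[OF assms(1)]) (use assms(2) in \<open>simp add: algebra_simps\<close>)

end

text \<open>The uniqueness of Weierstrass factorizations, in truncated form: only the coefficients
  below the bound \<open>T\<close> are controlled, and one level of the filtration \<open>B\<close> costs \<open>n\<close> of them.\<close>

lemma weierstrass_truncated:
  fixes w H :: "nat \<Rightarrow> 'a::comm_ring_1" and B :: "nat \<Rightarrow> 'a set"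
  assumes B: "\<And>k. 0 \<in> B k" "\<And>k x y. x \<in> B k \<Longrightarrow> y \<in> B k \<Longrightarrow> x - y \<in> B k"
      "\<And>j k x. x \<in> B k \<Longrightarrow> j \<le> k \<Longrightarrow> x \<in> B j"
    and low: "\<And>i k x. i < n \<Longrightarrow> x \<in> B k \<Longrightarrow> w i * x \<in> B (Suc k)"
    and top: "\<And>x. x \<in> B 0 \<Longrightarrow> (w n - 1) * x \<in> B s"
    and high: "\<And>i x. n < i \<Longrightarrow> i < T \<Longrightarrow> x \<in> B 0 \<Longrightarrow> w i * x \<in> B s"
    and H: "\<And>i. H i \<in> B 0"
    and conv: "\<And>i. n \<le> i \<Longrightarrow> i < T \<Longrightarrow> (\<Sum>j\<le>i. w j * H (i - j)) \<in> B s"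
  shows "k \<le> s \<Longrightarrow> i + n * k < T \<Longrightarrow> H i \<in> B k"
proof (induction k arbitrary: i)
  case (Suc k)
  have sum: "sum f S \<in> B j" if "\<And>i. i \<in> S \<Longrightarrow> f i \<in> B j" for f :: "nat \<Rightarrow> 'a" and S j
    using that
  proof (induction S rule: infinite_finite_induct)
    case (insert x S)
    then have "f x - (0 - sum f S) \<in> B j"
      by (intro B(1,2)) auto
    with insert show ?case by simp
  qed (auto simp: B)
  \<comment> \<open>In coefficient \<open>n + i\<close> the factor \<open>w n\<close>, which is
    nearly 1, meets \<open>H i\<close>. The terms with \<open>j < n\<close> reach up to
    \<open>H (n + i)\<close>; this is where each level costs \<open>n\<close> coefficients.\<close>
  have "(\<Sum>j\<le>n + i. w j * H (n + i - j)) =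
      w n * H i + (\<Sum>j\<in>{..n + i} - {n}. w j * H (n + i - j))"
    by (subst sum.remove[of _ n]) auto
  moreover have "(\<Sum>j\<le>n + i. w j * H (n + i - j)) \<in> B (Suc k)"
    using conv[of "n + i"] Suc.prems B(3) by auto
  moreover have "(\<Sum>j\<in>{..n + i} - {n}. w j * H (n + i - j)) \<in> B (Suc k)"
  proof (rule sum)
    fix j assume j: "j \<in> {..n + i} - {n}"
    show "w j * H (n + i - j) \<in> B (Suc k)"
    proof (cases "j < n")
      case True
      then show ?thesis
        using Suc.prems by (intro low Suc.IH) auto
    next
      case False
      then have "w j * H (n + i - j) \<in> B s"
        using j Suc.prems by (intro high H) auto
      then show ?thesis
        using Suc.prems(1) by (rule B(3))
    qed
  qed
  ultimately have *: "w n * H i \<in> B (Suc k)"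
    using B(2) by (metis (no_types, lifting) add_diff_cancel_right')
  have "(w n - 1) * H i \<in> B (Suc k)"
    using top[OF H] Suc.prems(1) by (rule B(3))
  from B(2)[OF * this] show ?case
    by (simp add: algebra_simps)
qed (use H in auto)

section \<open>Condensation of determinants\<close>

text \<open>Multiply \<open>A\<close> by the identity matrix whose first and last columns are replaced by those of
  the adjugate of \<open>A\<close>. The factor \<open>det A\<close> is not cancelled because it may be a zero divisor.\<close>

lemma dodgson_condensation:
  fixes A :: "'a::comm_ring_1 mat"
  assumes A: "A \<in> carrier_mat (k + 2) (k + 2)"
  shows "det A * (det A * det (mat k k (\<lambda>(i, j). A $$ (i + 1, j + 1)))) =
    det A * (det (mat (k + 1) (k + 1) (\<lambda>(i, j). A $$ (i + 1, j + 1))) *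
               det (mat (k + 1) (k + 1) (\<lambda>(i, j). A $$ (i, j)))
             - det (mat (k + 1) (k + 1) (\<lambda>(i, j). A $$ (i + 1, j))) *
               det (mat (k + 1) (k + 1) (\<lambda>(i, j). A $$ (i, j + 1))))"
proof -
  let ?N = "k + 2" and ?n = "k + 1"
  define ad where "ad = adj_mat A"
  define B where "B = mat ?N ?N (\<lambda>(i, j). if j = 0 \<or> j = ?n then ad $$ (i, j)
    else if i = j then 1 else 0)"
  \<comment> \<open>The product of \<open>A\<close> and \<open>B\<close>. Its outer columns are
    \<open>det A\<close> times unit vectors, because \<open>A\<close> times its adjugate is a scalar
    matrix.\<close>
  define E where "E = mat ?N ?N (\<lambda>(i, j). if j = 0 \<or> j = ?n then (if i = j then det A else 0)
    else A $$ (i, j))"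
  have B: "B \<in> carrier_mat ?N ?N" and E: "E \<in> carrier_mat ?N ?N" and ad: "ad \<in> carrier_mat ?N ?N"
    using adj_mat(1)[OF A] by (simp_all add: B_def E_def ad_def)
  have ad_entry: "ad $$ (i, j) = (-1) ^ (j + i) * det (mat_delete A j i)" if "i < ?N" "j < ?N" for i j
    using that A by (simp add: ad_def adj_mat_def cofactor_def)
  have AB: "A * B = E"
  proof (rule eq_matI)
    fix i j assume ij: "i < dim_row E" "j < dim_col E"
    then have ij': "i < ?N" "j < ?N" using E by auto
    have "(A * B) $$ (i, j) = (\<Sum>q = 0..<?N. A $$ (i, q) * B $$ (q, j))"
      using ij' A B by (simp add: times_mat_def scalar_prod_def)
    also have "\<dots> = E $$ (i, j)"
    proof (cases "j = 0 \<or> j = ?n")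
      case True
      have "(\<Sum>q = 0..<?N. A $$ (i, q) * B $$ (q, j)) = (\<Sum>q = 0..<?N. A $$ (i, q) * ad $$ (q, j))"
        using True ij' by (intro sum.cong) (auto simp: B_def)
      also have "\<dots> = (A * ad) $$ (i, j)"
        using ij' A ad by (simp add: times_mat_def scalar_prod_def)
      also have "\<dots> = E $$ (i, j)"
        using True ij' adj_mat(2)[OF A] by (auto simp: ad_def E_def)
      finally show ?thesis .
    next
      case False
      have "(\<Sum>q = 0..<?N. A $$ (i, q) * B $$ (q, j)) =
          (\<Sum>q = 0..<?N. if q = j then A $$ (i, q) else 0)"
        using False ij' by (intro sum.cong) (auto simp: B_def)
      also have "\<dots> = E $$ (i, j)"
        using False ij' by (simp add: E_def)
      finally show ?thesis .
    qed
    finally show "(A * B) $$ (i, j) = E $$ (i, j)" .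
  qed (use A B E in auto)
  have mid: "det E = det A * (det A * det (mat k k (\<lambda>(i, j). A $$ (i + 1, j + 1))))"
  proof -
    define E' where "E' = mat_delete E 0 0"
    have E': "E' \<in> carrier_mat ?n ?n"
      using E by (simp add: E'_def mat_delete_def)
    have E'_entry: "E' $$ (i, j) = (if j = k then (if i = k then det A else 0) else A $$ (i + 1, j + 1))"
      if "i < ?n" "j < ?n" for i j
      using that by (auto simp: E'_def mat_delete_def E_def)
    have "det E = (\<Sum>i<?N. E $$ (i, 0) * cofactor E i 0)"
      by (rule laplace_expansion_column[OF E]) simp
    also have "\<dots> = (\<Sum>i<?N. if i = 0 then det A * cofactor E i 0 else 0)"
      by (intro sum.cong) (auto simp: E_def)
    also have "\<dots> = det A * det E'"
      by (simp add: cofactor_def E'_def)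
    also have "det E' = (\<Sum>i<?n. E' $$ (i, k) * cofactor E' i k)"
      by (rule laplace_expansion_column[OF E']) simp
    also have "\<dots> = (\<Sum>i<?n. if i = k then det A * cofactor E' i k else 0)"
      by (intro sum.cong) (auto simp: E'_entry)
    also have "\<dots> = det A * det (mat_delete E' k k)"
      by (simp add: cofactor_def)
    also have "mat_delete E' k k = mat k k (\<lambda>(i, j). A $$ (i + 1, j + 1))"
      using E' by (intro eq_matI) (auto simp: mat_delete_def E'_entry)
    finally show ?thesis .
  qed
  \<comment> \<open>Away from the two replaced columns \<open>B\<close> is the identity, so only the
    2 by 2 minor of the adjugate at the corners is left.\<close>
  have "det B = ad $$ (0, 0) * ad $$ (?n, ?n) - ad $$ (0, ?n) * ad $$ (?n, 0)"
  proof -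
    define D where "D = mat_delete B 0 0"
    define D' where "D' = mat_delete B 0 ?n"
    have D: "D \<in> carrier_mat ?n ?n" and D': "D' \<in> carrier_mat ?n ?n"
      using B by (simp_all add: D_def D'_def mat_delete_def)
    have D_entry: "D $$ (i, j) = (if j = k then ad $$ (i + 1, ?n) else if i = j then 1 else 0)"
      if "i < ?n" "j < ?n" for i j
      using that by (auto simp: D_def mat_delete_def B_def)
    have D'_entry: "D' $$ (i, j) = (if j = 0 then ad $$ (i + 1, 0) else if i + 1 = j then 1 else 0)"
      if "i < ?n" "j < ?n" for i j
      using that by (auto simp: D'_def mat_delete_def B_def)
    have "det D = prod_list (diag_mat D)"
      by (rule det_upper_triangular[OF _ D]) (use D in \<open>auto simp: D_entry\<close>)
    also have "\<dots> = (\<Prod>i<?n. D $$ (i, i))"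
      using D by (simp add: prod_list_diag_prod atLeast0LessThan)
    also have "\<dots> = (\<Prod>i<?n. if i = k then ad $$ (?n, ?n) else 1)"
      by (intro prod.cong) (auto simp: D_entry)
    also have "\<dots> = ad $$ (?n, ?n)"
      by (simp only: prod.delta finite_lessThan) simp
    finally have detD: "det D = ad $$ (?n, ?n)" .
    have "det D' = (\<Sum>j<?n. D' $$ (k, j) * cofactor D' k j)"
      by (rule laplace_expansion_row[OF D']) simp
    also have "\<dots> = (\<Sum>j<?n. if j = 0 then ad $$ (?n, 0) * cofactor D' k j else 0)"
      by (intro sum.cong) (auto simp: D'_entry)
    also have "\<dots> = ad $$ (?n, 0) * ((-1) ^ k * det (mat_delete D' k 0))"
      by (simp add: cofactor_def)
    also have "mat_delete D' k 0 = 1\<^sub>m k"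
      using D' by (intro eq_matI) (auto simp: mat_delete_def D'_entry)
    finally have detD': "det D' = ad $$ (?n, 0) * (-1) ^ k"
      by simp
    have "det B = (\<Sum>j<?N. B $$ (0, j) * cofactor B 0 j)"
      by (rule laplace_expansion_row[OF B]) simp
    also have "\<dots> = (\<Sum>j<?N. (if j = 0 then ad $$ (0, 0) * cofactor B 0 0 else 0)
        + (if j = ?n then ad $$ (0, ?n) * cofactor B 0 ?n else 0))"
      by (intro sum.cong) (auto simp: B_def)
    also have "\<dots> = ad $$ (0, 0) * cofactor B 0 0 + ad $$ (0, ?n) * cofactor B 0 ?n"
      by (simp add: sum.distrib)
    also have "cofactor B 0 0 = ad $$ (?n, ?n)"
      using detD by (simp add: cofactor_def D_def)
    also have "cofactor B 0 ?n = - ad $$ (?n, 0)"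
    proof -
      have "cofactor B 0 ?n = (-1) ^ ?n * ((-1) ^ k * ad $$ (?n, 0))"
        using detD' by (simp add: cofactor_def D'_def mult.commute)
      also have "\<dots> = - (((-1) ^ k * (-1) ^ k) * ad $$ (?n, 0))"
        by simp
      also have "(-1) ^ k * (-1) ^ k = (1::'a)"
        by (simp flip: power_mult_distrib)
      finally show ?thesis by simp
    qed
    finally show ?thesis by simp
  qed
  moreover have "ad $$ (0, 0) = det (mat (k + 1) (k + 1) (\<lambda>(i, j). A $$ (i + 1, j + 1)))"
  proof -
    have "mat_delete A 0 0 = mat (k + 1) (k + 1) (\<lambda>(i, j). A $$ (i + 1, j + 1))"
      using A by (intro eq_matI) (auto simp: mat_delete_def)
    then show ?thesis by (simp add: ad_entry)
  qed
  moreover have "ad $$ (?n, ?n) = det (mat (k + 1) (k + 1) (\<lambda>(i, j). A $$ (i, j)))"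
  proof -
    have "mat_delete A ?n ?n = mat (k + 1) (k + 1) (\<lambda>(i, j). A $$ (i, j))"
      using A by (intro eq_matI) (auto simp: mat_delete_def)
    then show ?thesis by (simp add: ad_entry)
  qed
  moreover have "ad $$ (0, ?n) * ad $$ (?n, 0) =
      det (mat (k + 1) (k + 1) (\<lambda>(i, j). A $$ (i + 1, j))) *
      det (mat (k + 1) (k + 1) (\<lambda>(i, j). A $$ (i, j + 1)))"
  proof -
    have "mat_delete A 0 ?n = mat (k + 1) (k + 1) (\<lambda>(i, j). A $$ (i + 1, j))"
      "mat_delete A ?n 0 = mat (k + 1) (k + 1) (\<lambda>(i, j). A $$ (i, j + 1))"
      using A by (auto intro!: eq_matI simp: mat_delete_def)
    moreover have "(-1) ^ ?n * x * ((-1) ^ ?n * y) = y * x" for x y :: 'a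
    proof -
      have "(-1) ^ ?n * x * ((-1) ^ ?n * y) = ((-1) ^ ?n * (-1) ^ ?n) * (y * x)"
        by (simp only: mult_ac)
      also have "(-1) ^ ?n * (-1) ^ ?n = (1::'a)"
        by (simp flip: power_mult_distrib)
      finally show ?thesis by simp
    qed
    ultimately show ?thesis
      by (simp add: ad_entry del: power_Suc)
  qed
  moreover have "det E = det A * det B"
    using det_mult[OF A B] AB by simp
  ultimately show ?thesis
    using mid by simp
qed

section \<open>Powers of the ideal\<close>

lemma ideal_set_ideal_gen: "ideal_set (ideal_gen X)"
  by unfold_locales (auto intro: ideal_gen_0 ideal_gen_add ideal_gen_mult)

lemma ideal_power_0: "ideal_power J 0 = UNIV"
proof -
  have "1 \<in> ideal_power J 0"
    unfolding ideal_power_def by (rule ideal_gen_base) auto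
  then have "x * 1 \<in> ideal_power J 0" for x
    unfolding ideal_power_def by (rule ideal_gen_mult)
  then show ?thesis by auto
qed

lemma ideal_gen_times:
  assumes "x \<in> ideal_gen X" "y \<in> ideal_gen Y"
    and "\<And>u v. u \<in> X \<Longrightarrow> v \<in> Y \<Longrightarrow> u * v \<in> ideal_gen Z"
  shows "x * y \<in> ideal_gen Z"
proof -
  interpret Z: ideal_set "ideal_gen Z" by (rule ideal_set_ideal_gen)
  have "ideal_gen Y \<subseteq> {y. u * y \<in> ideal_gen Z}" if "u \<in> X" for u
    using assms(3)[OF that] by (intro ideal_gen_minimal)
      (auto simp: Z.zero Z.add distrib_left mult.left_commute intro: Z.absorb)
  then have "ideal_gen X \<subseteq> {x. x * y \<in> ideal_gen Z}"
    using assms(2) by (intro ideal_gen_minimal)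
      (auto simp: Z.zero Z.add distrib_right mult.assoc intro: Z.absorb)
  then show ?thesis
    using assms(1) by auto
qed

lemma filtration_ideal_power: "filtration (ideal_power J)"
proof -
  have "x * y \<in> ideal_power J (j + k)" if "x \<in> ideal_power J j" "y \<in> ideal_power J k" for x y j k
    using that unfolding ideal_power_def
  proof (rule ideal_gen_times)
    fix u v
    assume "u \<in> {\<Prod>i<j. a i | a. \<forall>i<j. a i \<in> J}" "v \<in> {\<Prod>i<k. a i | a. \<forall>i<k. a i \<in> J}"
    then obtain a b where ab: "u = (\<Prod>i<j. a i)" "\<forall>i<j. a i \<in> J" "v = (\<Prod>i<k. b i)" "\<forall>i<k. b i \<in> J"
      by auto
    define c where "c i = (if i < j then a i else b (i - j))" for i
    have "(\<Prod>i<j + k. c i) = (\<Prod>i<j. c i) * (\<Prod>i<k. c (j + i))"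
      by (induction k) (simp_all add: mult.assoc)
    then have "u * v = (\<Prod>i<j + k. c i)"
      by (simp add: ab c_def)
    moreover have "\<forall>i<j + k. c i \<in> J"
      using ab by (auto simp: c_def)
    ultimately show "u * v \<in> ideal_gen {\<Prod>i<j + k. a i | a. \<forall>i<j + k. a i \<in> J}"
      by (intro ideal_gen_base) auto
  qed
  then show ?thesis
    using ideal_power_0[of J] ideal_power_Suc_subset[of J]
    by (intro filtration.intro) (auto simp: ideal_power_def ideal_set_ideal_gen)
qed

lemma ideal_power_1: "x \<in> J \<Longrightarrow> x \<in> ideal_power J 1"
  unfolding ideal_power_def by (rule ideal_gen_base) (auto intro!: exI[of _ "\<lambda>_. x"])

declare One_nat_def [simp del]

section \<open>Principal minors of \<open>B(\<epsilon>)\<close>\<close>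

interpretation R: filtration "ideal_power tideal"
  by (rule filtration_ideal_power)

interpretation RP: filtration "\<lambda>k. coeffs_in (ideal_power tideal k)"
  by (rule R.filtration_coeffs_in)

abbreviation tideal_power :: "nat \<Rightarrow> int tpoly set" where
  "tideal_power \<equiv> ideal_power tideal"

lemma tvar_mem: "i \<le> j \<Longrightarrow> tvar i j \<in> tideal_power 1"
  by (rule ideal_power_1) (auto simp: tideal_def intro: ideal_gen_base)

lemma comm_ring_hom_pcompose: "comm_ring_hom (\<lambda>P :: 'a::comm_ring_1 poly. pcompose P Q)"
  by unfold_locales (simp_all add: pcompose_add pcompose_mult pcompose_1)

lemma comm_ring_hom_poly: "comm_ring_hom (\<lambda>P :: 'a::comm_ring_1 poly. poly P x)"
  by unfold_locales simp_all

lemma degree_prod_linear: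
  "finite S \<Longrightarrow> degree (\<Prod>i\<in>S. [:c i, 1::'a::comm_ring_1:]) = card S \<and>
    coeff (\<Prod>i\<in>S. [:c i, 1:]) (card S) = 1"
proof (induction S rule: finite_induct)
  case (insert x S)
  let ?P = "\<Prod>i\<in>S. [:c i, 1:]"
  have nz: "?P \<noteq> 0" using insert by auto
  have "[:c x, 1:] * ?P = pCons 0 ?P + Polynomial.smult (c x) ?P"
    by (simp add: mult_pCons_left)
  moreover have "degree (Polynomial.smult (c x) ?P) < degree (pCons 0 ?P)"
    using nz Polynomial.degree_smult_le[of "c x" ?P] by (simp add: degree_pCons_eq)
  ultimately have "degree ([:c x, 1:] * ?P) = Suc (degree ?P)"
      "coeff ([:c x, 1:] * ?P) (Suc (degree ?P)) = lead_coeff ?P"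
    using nz by (simp_all only: degree_add_eq_left coeff_add) (simp_all add: degree_pCons_eq coeff_eq_0)
  then show ?case
    using insert by simp
qed simp

locale diff_operator =
  fixes n m :: nat and l :: "nat \<Rightarrow> int"
  assumes n_pos: "n \<ge> 1" and m_pos: "m \<ge> 1"
begin

abbreviation entry :: "int \<Rightarrow> int \<Rightarrow> int tpoly poly" where
  "entry \<equiv> B_entry n m l"

definition minor :: "int \<Rightarrow> nat \<Rightarrow> int tpoly poly" where
  "minor a k = det (mat k k (\<lambda>(i, j). entry (a + int i) (a + int j)))"

lemma det_B_matrix: "det (B_matrix n m l (- int M) (int N)) = minor (- int M) (M + N + 1)"
proof -
  have "nat (int N - - int M + 1) = M + N + 1" by simp
  then show ?thesis by (simp only: B_matrix_def minor_def)
qed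

text \<open>The indicial polynomial of the unperturbed operator at the exponent \<open>i\<close>
  plus epsilon; its roots are the integers \<open>l r - i\<close>.\<close>

definition indicial :: "int \<Rightarrow> int tpoly poly" where
  "indicial i = (\<Prod>r=1..n. [:of_int (i - l r), 1:])"

text \<open>Entries depend on \<open>i\<close>, \<open>j\<close> and epsilon only through
  \<open>i - j\<close> and \<open>j\<close> plus epsilon, so an integer may be moved from the
  indices into the variable.\<close>

lemma entry_shift: "entry (i + x) (j + x) = pcompose (entry i j) [:of_int x, 1:]"
proof -
  have *: "k + (i + x) - (j + x) = k + i - j" for k by simp
  show ?thesis
    by (auto simp: B_entry_def pcompose_add pcompose_sum pcompose_prod pcompose_smult pcompose_pCons
        * algebra_simps intro!: prod.cong sum.cong)
qed

text \<open>Above the diagonal the first index \<open>k + i - j\<close> of each variable is below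
  its second index \<open>k\<close>.\<close>

lemma entry_upper_mem: "i < j \<Longrightarrow> entry i j \<in> coeffs_in (tideal_power 1)"
  unfolding B_entry_def
  by (intro RP.add RP.sum RP.absorb R.const_in tvar_mem) (auto simp: RP.zero)

lemma entry_upper_0: "int m < j - i \<Longrightarrow> entry i j = 0"
  by (auto simp: B_entry_def intro!: sum.neutral)

lemma entry_diagonal: "entry i i - indicial i \<in> coeffs_in (tideal_power 1)"
  unfolding B_entry_def indicial_def if_P[OF refl] add_diff_cancel_left'
  by (intro RP.sum RP.absorb R.const_in tvar_mem) simp

lemma minor_shift: "minor (a + x) k = pcompose (minor a k) [:of_int x, 1:]"
proof -
  interpret h: comm_ring_hom "\<lambda>P. pcompose P [:of_int x :: int tpoly, 1:]"
    by (rule comm_ring_hom_pcompose)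
  show ?thesis
    unfolding minor_def h.hom_det[symmetric]
  proof (rule arg_cong[of _ _ det], rule eq_matI, goal_cases)
    case (1 i j)
    have "entry (a + x + int i) (a + x + int j)
        = pcompose (entry (a + int i) (a + int j)) [:of_int x, 1:]"
      using entry_shift[of "a + int i" x "a + int j"] by (simp add: ac_simps)
    with 1 show ?case by simp
  qed auto
qed

lemma minor_mod_ideal:
  "minor a k - (\<Prod>j<k. indicial (a + int j)) \<in> coeffs_in (tideal_power 1)"
proof -
  define C where "C = mat k k (\<lambda>(i, j). if i < j then 0 else if i = j then indicial (a + int i)
    else entry (a + int i) (a + int j))"
  have C: "C \<in> carrier_mat k k" by (simp add: C_def)
  have "minor a k - det C \<in> coeffs_in (tideal_power 1)"
    unfolding minor_def
    by (rule RP.cong_det[OF _ C]) (auto simp: C_def entry_upper_mem entry_diagonal RP.zero)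
  moreover have "det C = prod_list (diag_mat C)"
    by (rule det_lower_triangular[OF _ C]) (simp add: C_def)
  then have "det C = (\<Prod>j<k. indicial (a + int j))"
    using C by (simp add: prod_list_diag_prod atLeast0LessThan) (simp add: C_def)
  ultimately show ?thesis by simp
qed

lemma indicial_prod:
  "(\<Prod>j<k. indicial (a + int j)) = (\<Prod>(j, r)\<in>{..<k} \<times> {1..n}. [:of_int (a + int j - l r), 1:])"
  by (simp add: indicial_def prod.cartesian_product)

lemma monic_minor: "R.monic_mod (n * k) (minor a k)"
proof -
  have "R.monic_mod (n * k) (\<Prod>j<k. indicial (a + int j))"
    using degree_prod_linear[of "{..<k} \<times> {1..n}"
        "\<lambda>x. of_int (a + int (fst x) - l (snd x)) :: int tpoly"]
    unfolding indicial_prod split_beta by (intro R.monic_mod_monic) (simp_all add: mult.commute)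
  then show ?thesis
    using R.monic_mod_cong[OF minor_mod_ideal] by blast
qed

lemma poly_minor_mod_ideal:
  "poly (minor a k) 0 - of_int (\<Prod>j<k. \<Prod>r=1..n. a + int j - l r) \<in> tideal_power 1"
  using R.poly_cong[OF minor_mod_ideal, of a k 0]
  by (simp add: poly_prod indicial_def)

text \<open>For a permutation \<open>q\<close> the offsets \<open>q i + 1 - i\<close> add up to
  \<open>k\<close>, the shift by one column giving 1 in each row. In a nonzero product each offset
  is at most \<open>m\<close>, so at least \<open>k / m\<close> of them are positive, and a positive
  offset means an entry in I.\<close>

lemma cross_minor_mem:
  assumes "m * s \<le> k"
  shows "det (mat k k (\<lambda>(i, j). entry (a + int i) (a + int j + 1))) \<in> coeffs_in (tideal_power s)"
    (is "det ?C \<in> _")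
proof -
  have C: "?C \<in> carrier_mat k k" by simp
  show ?thesis
    unfolding det_def'[OF C]
  proof (intro RP.sum RP.absorb)
    fix q assume "q \<in> {q. q permutes {0..<k}}"
    then have q: "q permutes {0..<k}" by simp
    have qk: "q i < k" if "i < k" for i
      using that permutes_in_image[OF q, of i] by simp
    have *: "(\<Prod>i=0..<k. ?C $$ (i, q i)) = (\<Prod>i=0..<k. entry (a + int i) (a + int (q i) + 1))"
      using qk by (intro prod.cong) auto
    show "(\<Prod>i=0..<k. ?C $$ (i, q i)) \<in> coeffs_in (tideal_power s)"
    proof (cases "\<exists>i<k. int m < int (q i) + 1 - int i")
      case True
      then obtain i where "i < k" "entry (a + int i) (a + int (q i) + 1) = 0"
        using entry_upper_0 by force
      then show ?thesis
        unfolding * by (intro RP.prod_mem[of _ i]) (auto simp: RP.zero)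
    next
      case False
      define e where "e i = (if int i < int (q i) + 1 then 1 else 0::nat)" for i
      have "(\<Sum>i=0..<k. int (q i)) = (\<Sum>i=0..<k. int i)"
        using sum.permute[OF q, of int] by (simp add: o_def)
      then have "int k = (\<Sum>i=0..<k. int (q i) + 1 - int i)"
        by (simp add: sum_subtractf sum.distrib)
      also have "\<dots> \<le> (\<Sum>i=0..<k. int m * int (e i))"
      proof (rule sum_mono)
        fix i assume "i \<in> {0..<k}"
        then have "int (q i) + 1 - int i \<le> int m"
          using False by (meson atLeastLessThan_iff not_less)
        then show "int (q i) + 1 - int i \<le> int m * int (e i)"
          by (simp add: e_def)
      qed
      finally have "k \<le> m * sum e {0..<k}"
        by (metis of_nat_le_iff of_nat_mult of_nat_sum sum_distrib_left)
      then have "s \<le> sum e {0..<k}"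
        using assms m_pos by (metis le_trans nat_mult_le_cancel_disj less_eq_Suc_le One_nat_def)
      moreover have "(\<Prod>i=0..<k. entry (a + int i) (a + int (q i) + 1))
          \<in> coeffs_in (tideal_power (sum e {0..<k}))"
        by (rule RP.I_prod) (use entry_upper_mem in \<open>auto simp: e_def R.I_0\<close>)
      ultimately show ?thesis
        unfolding * using RP.antimonoD by blast
    qed
  qed
qed

text \<open>The off-diagonal minor in Dodgson's identity has size \<open>k + 1\<close>, whence the
  hypothesis. The extra factor \<open>minor a (k + 2)\<close> is cancelled because it is monic
  modulo I.\<close>

lemma minor_condensation:
  assumes "m * s \<le> k + 1"
  shows "minor a (k + 2) * minor (a + 1) k - minor a (k + 1) * minor (a + 1) (k + 1)
    \<in> coeffs_in (tideal_power s)"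
proof -
  define A where "A = mat (k + 2) (k + 2) (\<lambda>(i, j). entry (a + int i) (a + int j))"
  have A: "A \<in> carrier_mat (k + 2) (k + 2)" by (simp add: A_def)
  have e: "mat k k (\<lambda>(i, j). A $$ (i + 1, j + 1)) = mat k k (\<lambda>(i, j). entry (a + 1 + int i) (a + 1 + int j))"
    "mat (k + 1) (k + 1) (\<lambda>(i, j). A $$ (i + 1, j + 1)) =
      mat (k + 1) (k + 1) (\<lambda>(i, j). entry (a + 1 + int i) (a + 1 + int j))"
    "mat (k + 1) (k + 1) (\<lambda>(i, j). A $$ (i, j)) = mat (k + 1) (k + 1) (\<lambda>(i, j). entry (a + int i) (a + int j))"
    "mat (k + 1) (k + 1) (\<lambda>(i, j). A $$ (i, j + 1)) =
      mat (k + 1) (k + 1) (\<lambda>(i, j). entry (a + int i) (a + int j + 1))"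
    by (auto intro!: eq_matI simp: A_def ac_simps)
  have "det A = minor a (k + 2)"
    by (simp add: minor_def A_def)
  then have "minor a (k + 2) * (minor a (k + 2) * minor (a + 1) k) =
      minor a (k + 2) * (minor (a + 1) (k + 1) * minor a (k + 1)
        - det (mat (k + 1) (k + 1) (\<lambda>(i, j). A $$ (i + 1, j)))
          * det (mat (k + 1) (k + 1) (\<lambda>(i, j). entry (a + int i) (a + int j + 1))))"
    using dodgson_condensation[OF A] unfolding e minor_def[symmetric] by simp
  then have "minor a (k + 2) * (minor a (k + 2) * minor (a + 1) k)
      - minor a (k + 2) * (minor a (k + 1) * minor (a + 1) (k + 1))
      = - (minor a (k + 2) * det (mat (k + 1) (k + 1) (\<lambda>(i, j). A $$ (i + 1, j)))
          * det (mat (k + 1) (k + 1) (\<lambda>(i, j). entry (a + int i) (a + int j + 1))))"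
    by (simp add: algebra_simps)
  also have "\<dots> \<in> coeffs_in (tideal_power s)"
    by (intro RP.minus RP.absorb cross_minor_mem assms)
  finally show ?thesis
    by (rule R.monic_mod_cancel[OF monic_minor])
qed

text \<open>Induction on the right end: condensation is chained with the induction hypothesis
  through \<open>minor (a + 1) (k + j)\<close>, which then cancels.\<close>

lemma minor_cluster_1:
  assumes "m * s \<le> k + 1"
  shows "minor a (k + j + 1) * minor (a + 1) k - minor a (k + 1) * minor (a + 1) (k + j)
    \<in> coeffs_in (tideal_power s)"
proof (induction j)
  case (Suc j)
  let ?A = "coeffs_in (tideal_power s)"
  have 1: "minor a (k + j + 2) * minor (a + 1) (k + j) * minor (a + 1) k
      - minor a (k + j + 1) * minor (a + 1) (k + j + 1) * minor (a + 1) k \<in> ?A"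
    using RP.absorb_right[OF minor_condensation[of s "k + j" a], of "minor (a + 1) k"] assms
    by (simp add: left_diff_distrib)
  have 2: "minor a (k + j + 1) * minor (a + 1) k * minor (a + 1) (k + j + 1)
      - minor a (k + 1) * minor (a + 1) (k + j) * minor (a + 1) (k + j + 1) \<in> ?A"
    using RP.absorb_right[OF Suc.IH, of "minor (a + 1) (k + j + 1)"]
    by (simp only: left_diff_distrib)
  have "minor (a + 1) (k + j) * (minor a (k + j + 2) * minor (a + 1) k)
      - minor (a + 1) (k + j) * (minor a (k + 1) * minor (a + 1) (k + j + 1)) \<in> ?A"
    using RP.add[OF 1 2] by (simp add: mult_ac)
  from R.monic_mod_cancel[OF monic_minor this] show ?case
    by (simp add: One_nat_def)
qed (simp add: RP.zero)

text \<open>Up to terms of high order, the ratio of two minors whose windows end at the same place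
  depends only on the positions where the windows begin.\<close>

lemma minor_cluster:
  assumes "m * s \<le> k + 1"
  shows "minor a (i + k + j) * minor (a + int i) k - minor a (i + k) * minor (a + int i) (k + j)
    \<in> coeffs_in (tideal_power s)"
proof (induction i arbitrary: a)
  case (Suc i)
  let ?A = "coeffs_in (tideal_power s)"
  have 1: "minor a (i + k + j + 1) * minor (a + 1) (i + k) * minor (a + 1 + int i) k
      - minor a (i + k + 1) * minor (a + 1) (i + k + j) * minor (a + 1 + int i) k \<in> ?A"
    using RP.absorb_right[OF minor_cluster_1[of s "i + k" a j], of "minor (a + 1 + int i) k"] assms
    by (simp add: left_diff_distrib)
  have 2: "minor a (i + k + 1) * (minor (a + 1) (i + k + j) * minor (a + 1 + int i) k)
      - minor a (i + k + 1) * (minor (a + 1) (i + k) * minor (a + 1 + int i) (k + j)) \<in> ?A"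
    using RP.absorb[OF Suc.IH[of "a + 1"], of "minor a (i + k + 1)"]
    by (simp only: right_diff_distrib)
  have "minor (a + 1) (i + k) * (minor a (i + k + j + 1) * minor (a + 1 + int i) k)
      - minor (a + 1) (i + k) * (minor a (i + k + 1) * minor (a + 1 + int i) (k + j)) \<in> ?A"
    using RP.add[OF 1 2] by (simp add: mult_ac)
  from R.monic_mod_cancel[OF monic_minor this] show ?case
    by (simp add: One_nat_def ac_simps)
qed (simp add: RP.zero mult.commute)

section \<open>Low coefficients of the minors and their values at epsilon zero\<close>

lemma minor_coeff_small:
  assumes "\<And>r. r \<in> {1..n} \<Longrightarrow> a \<le> l r \<and> l r < a + int k"
  shows "i < n \<Longrightarrow> coeff (minor a k) i \<in> tideal_power 1"
    and "coeff (minor a k) n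
      - of_int (\<Prod>r=1..n. \<Prod>j\<in>{j. j < k \<and> a + int j \<noteq> l r}. a + int j - l r) \<in> tideal_power 1"
proof -
  define G where "G = (\<Prod>r=1..n. \<Prod>j\<in>{j. j < k \<and> a + int j \<noteq> l r}.
    [:of_int (a + int j - l r), 1::int tpoly:])"
  have *: "(\<Prod>j<k. [:of_int (a + int j - l r), 1:]) = [:0, 1::int tpoly:] *
      (\<Prod>j\<in>{j. j < k \<and> a + int j \<noteq> l r}. [:of_int (a + int j - l r), 1:])" if "r \<in> {1..n}" for r
  proof -
    define j where "j = nat (l r - a)"
    have j: "a + int j = l r" "j < k"
      using assms[OF that] by (auto simp: j_def)
    then have e: "{..<k} - {j} = {j. j < k \<and> a + int j \<noteq> l r}"
      by auto
    show ?thesis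
      using j by (subst prod.remove[of _ j]) (auto simp: e)
  qed
  have "(\<Prod>j<k. indicial (a + int j)) = (\<Prod>r=1..n. \<Prod>j<k. [:of_int (a + int j - l r), 1:])"
    unfolding indicial_def by (rule prod.swap)
  also have "\<dots> = monom 1 n * G"
    unfolding G_def by (subst prod.cong[OF refl *]) (assumption, simp only: prod.distrib, simp add: monom_altdef)
  finally have c: "coeff (minor a k) i - coeff (monom 1 n * G) i \<in> tideal_power 1" for i
    using coeffs_inD[OF minor_mod_ideal] by (metis coeff_diff)
  show "i < n \<Longrightarrow> coeff (minor a k) i \<in> tideal_power 1"
    using c[of i] by (simp add: coeff_monom_mult)
  have "coeff G 0 = of_int (\<Prod>r=1..n. \<Prod>j\<in>{j. j < k \<and> a + int j \<noteq> l r}. a + int j - l r)"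
    by (simp add: G_def poly_0_coeff_0[symmetric] poly_prod)
  then show "coeff (minor a k) n
      - of_int (\<Prod>r=1..n. \<Prod>j\<in>{j. j < k \<and> a + int j \<noteq> l r}. a + int j - l r) \<in> tideal_power 1"
    using c[of n] by (simp add: coeff_monom_mult)
qed

lemma entry_at_0:
  "poly (entry i (int j)) 0 = (if i = int j then \<Prod>r=1..n. of_int (i - l r) else 0)
    + (\<Sum>k\<in>{k. k \<le> m \<and> int j - i \<le> int k}.
        (\<Prod>r<k. of_int (int j - int r)) * tvar (nat (int k + i - int j)) k)"
  by (simp add: B_entry_def poly_prod poly_sum mult.commute)

text \<open>At epsilon zero D preserves power series: for \<open>i < 0 <= j\<close> the falling
  factorial of \<open>j\<close> has length \<open>k >= j - i > j\<close> and contains the factor 0.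
  The matrix is thus block triangular with respect to the sign of the index.\<close>

lemma minor_block:
  "poly (minor (- int u) (u + v)) 0 = poly (minor (- int u) u) 0 * poly (minor 0 v) 0"
proof -
  interpret h: comm_ring_hom "\<lambda>P. poly P (0 :: int tpoly)"
    by (rule comm_ring_hom_poly)
  define A where "A a k = map_mat (\<lambda>P. poly P 0) (mat k k (\<lambda>(i, j). entry (a + int i) (a + int j)))" for a k
  define L where "L = mat v u (\<lambda>(i, j). poly (entry (int i) (int j - int u)) 0)"
  have z: "poly (entry (- int u + int i) (int j)) 0 = 0" if "i < u" for i j
  proof -
    have "(\<Prod>r<k. of_int (int j - int r)) = (0 :: int tpoly)"
      if "int j - (- int u + int i) \<le> int k" for k
      using that \<open>i < u\<close> by (intro prod_zero) (auto intro!: bexI[of _ j])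
    then show ?thesis
      using that by (subst entry_at_0) (auto intro!: sum.neutral)
  qed
  have "A (- int u) (u + v) = four_block_mat (A (- int u) u) (0\<^sub>m u v) L (A 0 v)"
  proof (rule eq_matI, goal_cases)
    case (1 i j)
    have "- int u + int j = int (j - u)" if "u \<le> j" for j
      using that by simp
    with 1 show ?case
      using z[of i "j - u"] by (auto simp: A_def L_def)
  qed (simp_all add: A_def)
  then have "det (A (- int u) (u + v)) = det (A (- int u) u) * det (A 0 v)"
    by (simp add: det_four_block_mat_upper_right_zero[of _ u _ v] A_def L_def)
  then show ?thesis
    by (simp add: A_def minor_def)
qed

lemma Det_p_eq: "Det_p n m l p = poly (minor 0 p) 0"
proof -
  interpret h: comm_ring_hom "\<lambda>P. poly P (0 :: int tpoly)"
    by (rule comm_ring_hom_poly)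
  have foldr_X: "foldr (\<lambda>r g. fps_X * fps_deriv g - of_int (l r) * g) xs (fps_X ^ j)
      = of_int (\<Prod>r\<leftarrow>xs. int j - l r) * (fps_X ^ j :: int tpoly fps)" for xs j
  proof (induction xs)
    case (Cons r xs)
    have "fps_X * fps_deriv (fps_X ^ j :: int tpoly fps) = of_nat j * fps_X ^ j"
      by (rule fps_ext) (auto simp: fps_of_nat[symmetric] simp del: fps_of_nat)
    define c where "c = (\<Prod>r\<leftarrow>xs. int j - l r)"
    have "foldr (\<lambda>r g. fps_X * fps_deriv g - of_int (l r) * g) (r # xs) (fps_X ^ j) =
        fps_X * fps_deriv (of_int c * fps_X ^ j) - of_int (l r) * (of_int c * fps_X ^ j :: int tpoly fps)"
      by (simp add: Cons c_def)
    also have "fps_deriv (of_int c * fps_X ^ j) = of_int c * fps_deriv (fps_X ^ j :: int tpoly fps)"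
      by (simp add: fps_of_int[symmetric] del: fps_of_int)
    also have "fps_X * (of_int c * fps_deriv (fps_X ^ j)) - of_int (l r) * (of_int c * fps_X ^ j)
        = of_int ((int j - l r) * c) * (fps_X ^ j :: int tpoly fps)"
      using \<open>fps_X * fps_deriv (fps_X ^ j) = of_nat j * fps_X ^ j\<close>
      by (simp add: mult.left_commute[of fps_X]) (simp add: algebra_simps)
    finally show ?case
      by (simp add: c_def)
  qed simp
  have deriv_X: "(fps_deriv ^^ k) (fps_X ^ j)
      = of_int (\<Prod>r<k. int j - int r) * (fps_X ^ (j - k) :: int tpoly fps)" for j k
  proof (induction k)
    case (Suc k)
    define c where "c = (\<Prod>r<k. int j - int r)"
    \<comment> \<open>For \<open>j < k\<close> the exponent \<open>j - k\<close> is truncated to 0,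
      which is harmless since the coefficient has already vanished.\<close>
    have c: "c = 0" if "j < k"
      unfolding c_def using that by (intro prod_zero) auto
    have X: "fps_deriv (fps_X ^ i) = of_nat i * (fps_X ^ (i - 1) :: int tpoly fps)" for i
      by (cases i) (auto intro!: fps_ext simp: One_nat_def fps_of_nat[symmetric] simp del: fps_of_nat)
    have "(fps_deriv ^^ Suc k) (fps_X ^ j) = fps_deriv (of_int c * fps_X ^ (j - k) :: int tpoly fps)"
      by (simp add: Suc c_def)
    also have "\<dots> = of_int c * fps_deriv (fps_X ^ (j - k))"
      by (simp add: fps_of_int[symmetric] del: fps_of_int)
    also have "\<dots> = of_int (c * (int j - int k)) * fps_X ^ (j - Suc k)"
      using c by (cases "j < k") (simp_all add: X of_nat_diff One_nat_def)
    finally show ?case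
      by (simp add: c_def)
  qed simp
  have "fps_nth (diff_op n m l (fps_X ^ j)) i = poly (entry (int i) (int j)) 0" for i j
  proof -
    have 1: "of_int (\<Prod>r\<leftarrow>[1..<Suc n]. int j - l r) = (\<Prod>r=1..n. of_int (int j - l r) :: int tpoly)"
      by (simp add: prod.distinct_set_conv_list[symmetric] atLeastLessThanSuc_atLeastAtMost del: upt_Suc)
    have 2: "fps_nth (Abs_fps (\<lambda>i. tvar i k) * (fps_deriv ^^ k) (fps_X ^ j)) i
        = (if int j - int i \<le> int k then (\<Prod>r<k. of_int (int j - int r)) * tvar (nat (int k + int i - int j)) k
           else 0 :: int tpoly)" for k
    proof (cases "j < k")
      case True
      then have "(\<Prod>r<k. int j - int r) = 0"
        by (intro prod_zero) auto
      moreover from this have "(\<Prod>r<k. of_int (int j - int r)) = (0 :: int tpoly)"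
        by (metis of_int_0 of_int_prod)
      ultimately show ?thesis
        by (simp only: deriv_X of_int_0 mult_zero_left mult_zero_right fps_zero_nth if_cancel)
    next
      case False
      define c where "c = (\<Prod>r<k. int j - int r)"
      have c: "(\<Prod>r<k. of_int (int j - int r)) = (of_int c :: int tpoly)"
        by (simp only: c_def of_int_prod)
      have "Abs_fps (\<lambda>i. tvar i k) * (fps_deriv ^^ k) (fps_X ^ j)
          = fps_const (of_int c) * (Abs_fps (\<lambda>i. tvar i k) * fps_X ^ (j - k) :: int tpoly fps)"
        by (simp only: deriv_X c_def[symmetric] fps_of_int mult.left_commute)
      moreover have "nat (int k + int i - int j) = i - (j - k)" "int j - int i \<le> int k \<longleftrightarrow> \<not> i < j - k"
        using False by auto
      ultimately show ?thesis
        by (simp only: c fps_mult_left_const_nth fps_X_power_mult_right_nth) simp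
    qed
    have 3: "fps_nth (of_int c * fps_X ^ j) i = (if int i = int j then of_int c else 0 :: int tpoly)" for c
      by (auto simp: fps_of_int[symmetric] simp del: fps_of_int)
    have 4: "(\<Sum>k\<le>m. if int j - int i \<le> int k then g k else 0) =
        (\<Sum>k\<in>{k. k \<le> m \<and> int j - int i \<le> int k}. g k)" for g :: "nat \<Rightarrow> int tpoly"
      by (rule sum.mono_neutral_cong_right) auto
    have 5: "of_int (\<Prod>r\<leftarrow>[1..<Suc n]. int j - l r)
        = (if int i = int j then \<Prod>r=1..n. of_int (int i - l r) else of_int (\<Prod>r\<leftarrow>[1..<Suc n]. int j - l r) :: int tpoly)"
      by (simp only: 1 split: if_splits) simp
    show ?thesis
      unfolding entry_at_0 diff_op_def foldr_X fps_add_nth fps_sum_nth 2 3 4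
      by (subst 5) simp
  qed
  then have "mat p p (\<lambda>(i, j). fps_nth (diff_op n m l (fps_X ^ j)) i)
      = map_mat (\<lambda>P. poly P 0) (mat p p (\<lambda>(i, j). entry (0 + int i) (0 + int j)))"
    by (intro eq_matI) auto
  then show ?thesis
    by (simp add: Det_p_def minor_def)
qed

end

section \<open>Finite differences and weights\<close>

definition fdiff :: "(nat \<Rightarrow> 'a::ab_group_add) \<Rightarrow> nat \<Rightarrow> 'a" where
  "fdiff g x = g (Suc x) - g x"

lemma fdiff_add: "(fdiff ^^ a) (\<lambda>x. g x + h x) x = (fdiff ^^ a) g x + (fdiff ^^ a) h x"
  by (induction a arbitrary: x) (simp_all add: fdiff_def)

lemma fdiff_minus: "(fdiff ^^ a) (\<lambda>x. - g x) x = - (fdiff ^^ a) g x"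
  by (induction a arbitrary: x) (simp_all add: fdiff_def)

lemma fdiff_const: "(fdiff ^^ a) (\<lambda>_. c) x = (if a = 0 then c else 0)"
  by (induction a arbitrary: x) (auto simp: fdiff_def)

lemma fdiff_sum: "(fdiff ^^ a) (\<lambda>x. \<Sum>i\<in>S. g i x) x = (\<Sum>i\<in>S. (fdiff ^^ a) (g i) x)"
  by (induction S rule: infinite_finite_induct) (simp_all add: fdiff_add fdiff_const)

lemma fdiff_Suc_shift: "(fdiff ^^ a) (\<lambda>x. g (Suc x)) x = (fdiff ^^ a) g (Suc x)"
  by (induction a arbitrary: x) (simp_all add: fdiff_def)

lemma fdiff_funpow_Suc: "(fdiff ^^ Suc a) g = (fdiff ^^ a) (fdiff g)"
  by (simp only: funpow_Suc_right o_apply)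

lemma newton_forward:
  fixes g :: "nat \<Rightarrow> 'a::comm_ring_1"
  shows "g (x + k) = (\<Sum>i\<le>k. of_nat (k choose i) * (fdiff ^^ i) g x)"
proof (induction k arbitrary: g)
  case (Suc k)
  let ?d = "\<lambda>i. (fdiff ^^ i) g x"
  have "g (x + Suc k) = g (x + k) + fdiff g (x + k)"
    by (simp add: fdiff_def)
  also have "\<dots> = (\<Sum>i\<le>k. of_nat (k choose i) * ?d i) + (\<Sum>i\<le>k. of_nat (k choose i) * ?d (Suc i))"
    using Suc.IH[of g] Suc.IH[of "fdiff g"] by (simp only: fdiff_funpow_Suc)
  also have "(\<Sum>i\<le>k. of_nat (k choose i) * ?d i) = ?d 0 + (\<Sum>i\<le>k. of_nat (k choose Suc i) * ?d (Suc i))"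
    using sum.atMost_Suc_shift[of "\<lambda>i. of_nat (k choose i) * ?d i" k] by (simp add: binomial_eq_0)
  also have "?d 0 + (\<Sum>i\<le>k. of_nat (k choose Suc i) * ?d (Suc i)) + (\<Sum>i\<le>k. of_nat (k choose i) * ?d (Suc i))
      = (\<Sum>i\<le>Suc k. of_nat (Suc k choose i) * ?d i)"
    using sum.atMost_Suc_shift[of "\<lambda>i. of_nat (Suc k choose i) * ?d i" k]
    by (simp add: sum.distrib algebra_simps)
  finally show ?case .
qed simp

context ideal_set
begin

lemma fdiff_mem: "(\<And>x. g x \<in> A) \<Longrightarrow> (fdiff ^^ a) g x \<in> A"
  by (induction a arbitrary: x) (simp_all add: fdiff_def diff)

text \<open>Leibniz rule: a difference of order \<open>a\<close> of a product is a sum of products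
  of differences, at shifted points, with orders adding up to \<open>a\<close>. Only membership in
  an ideal is wanted, so points and multiplicities are left open.\<close>

lemma fdiff_mult_mem:
  assumes "\<And>b b' y z. b + b' = a \<Longrightarrow> (fdiff ^^ b) g y * (fdiff ^^ b') h z \<in> A"
  shows "(fdiff ^^ a) (\<lambda>x. g x * h x) x \<in> A"
  using assms
proof (induction a arbitrary: g h)
  case 0
  then show ?case using 0[of 0 0] by simp
next
  case (Suc a)
  have "fdiff (\<lambda>x. g x * h x) = (\<lambda>x. fdiff g x * h (Suc x) + g x * fdiff h x)"
    by (simp add: fdiff_def fun_eq_iff algebra_simps)
  then have "(fdiff ^^ Suc a) (\<lambda>x. g x * h x) x = (fdiff ^^ a) (\<lambda>x. fdiff g x * h (Suc x)) x
      + (fdiff ^^ a) (\<lambda>x. g x * fdiff h x) x"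
    by (simp only: fdiff_funpow_Suc fdiff_add)
  moreover have "(fdiff ^^ a) (\<lambda>x. fdiff g x * h (Suc x)) x \<in> A"
  proof (rule Suc.IH)
    fix b b' y z assume "b + b' = a"
    then show "(fdiff ^^ b) (fdiff g) y * (fdiff ^^ b') (\<lambda>x. h (Suc x)) z \<in> A"
      using Suc.prems[of "Suc b" b' y "Suc z"]
      unfolding fdiff_funpow_Suc fdiff_Suc_shift by simp
  qed
  moreover have "(fdiff ^^ a) (\<lambda>x. g x * fdiff h x) x \<in> A"
  proof (rule Suc.IH)
    fix b b' y z assume "b + b' = a"
    then show "(fdiff ^^ b) g y * (fdiff ^^ b') (fdiff h) z \<in> A"
      using Suc.prems[of b "Suc b'" y z] unfolding fdiff_funpow_Suc by simp
  qed
  ultimately show ?case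
    by (simp only: add)
qed

end

context filtration
begin

text \<open>\<open>poly_like M w g\<close>: the part of \<open>g\<close> of order \<open>j\<close> in the filtration is a polynomial function
  of degree at most \<open>w + M j\<close> (zero if this is negative). For families of polynomials, \<open>weighted\<close>
  gives degree one to the variable of the polynomials and to the parameter of the family.\<close>

definition poly_like :: "nat \<Rightarrow> int \<Rightarrow> (nat \<Rightarrow> 'a) \<Rightarrow> bool" where
  "poly_like M w g \<longleftrightarrow> (\<forall>a j x. w + int M * (int j - 1) < int a \<longrightarrow> (fdiff ^^ a) g x \<in> I j)"

definition weighted :: "nat \<Rightarrow> int \<Rightarrow> (nat \<Rightarrow> 'a poly) \<Rightarrow> bool" where
  "weighted M c P \<longleftrightarrow> (\<forall>e. poly_like M (c - int e) (\<lambda>x. coeff (P x) e))"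

lemma poly_like_sum: "(\<And>i. i \<in> S \<Longrightarrow> poly_like M w (g i)) \<Longrightarrow> poly_like M w (\<lambda>x. \<Sum>i\<in>S. g i x)"
  by (auto simp: poly_like_def fdiff_sum intro: sum)

lemma poly_like_add: "poly_like M w g \<Longrightarrow> poly_like M w h \<Longrightarrow> poly_like M w (\<lambda>x. g x + h x)"
  by (auto simp: poly_like_def fdiff_add intro: add)

lemma poly_like_minus: "poly_like M w g \<Longrightarrow> poly_like M w (\<lambda>x. - g x)"
  by (auto simp: poly_like_def fdiff_minus intro: minus)

lemma poly_like_mono: "poly_like M w g \<Longrightarrow> w \<le> w' \<Longrightarrow> poly_like M w' g"
  unfolding poly_like_def by fastforce

lemma poly_like_0: "poly_like M w (\<lambda>_. 0)"
  by (simp add: poly_like_def fdiff_const zero)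

lemma poly_like_const: "poly_like M 0 (\<lambda>_. c)"
proof -
  have "c \<in> I j" if "int M * (int j - 1) < 0" for j
  proof -
    have "j = 0"
      using that by (simp add: mult_less_0_iff)
    then show ?thesis by (simp add: I_0)
  qed
  then show ?thesis
    by (simp add: poly_like_def fdiff_const zero)
qed

lemma poly_like_const_mem:
  assumes "c \<in> I 1"
  shows "poly_like M (- int M) (\<lambda>_. c)"
proof -
  have "j \<le> 1" if "- int M + int M * (int j - 1) < 0" for j
  proof (rule ccontr)
    assume "\<not> j \<le> 1"
    then have "int M * 1 \<le> int M * (int j - 1)"
      by (intro mult_left_mono) auto
    with that show False by simp
  qed
  then show ?thesis
    using assms antimonoD by (auto simp: poly_like_def fdiff_const zero)
qed

lemma poly_like_linear: "poly_like M 1 (\<lambda>x. of_int (i + int x))"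
  unfolding poly_like_def
proof (intro allI impI)
  fix a j x assume a: "1 + int M * (int j - 1) < int a"
  have "fdiff (\<lambda>x. of_int (i + int x)) = (\<lambda>_. 1::'a)"
    by (simp add: fdiff_def fun_eq_iff)
  then have d: "(fdiff ^^ Suc a) (\<lambda>x. of_int (i + int x)) x = (if a = 0 then 1 else 0::'a)" for a
    by (simp only: fdiff_funpow_Suc fdiff_const)
  show "(fdiff ^^ a) (\<lambda>x. of_int (i + int x)) x \<in> I j"
  proof (cases "a \<le> 1")
    case True
    then have "int M * (int j - 1) < 0"
      using a by simp
    then have "j = 0"
      by (simp add: mult_less_0_iff)
    then show ?thesis by (simp add: I_0)
  next
    case False
    then show ?thesis
      using d[of "a - 1"] by (simp add: zero)
  qed
qed

text \<open>Finds the best order that \<open>poly_like\<close> guarantees for a difference of order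
  \<open>b\<close>: the parts of order below \<open>j\<close> have degree below \<open>b\<close> and
  are annihilated.\<close>

lemma least_level:
  fixes b :: nat
  assumes "M \<ge> 1"
  obtains j where "int b \<le> w + int M * int j" "j = 0 \<or> w + int M * (int j - 1) < int b"
proof -
  define j where "j = (LEAST j. int b \<le> w + int M * int j)"
  have "int (b + nat \<bar>w\<bar>) * 1 \<le> int (b + nat \<bar>w\<bar>) * int M"
    using assms by (intro mult_left_mono) auto
  then have ex: "int b \<le> w + int M * int (b + nat \<bar>w\<bar>)"
    by (simp add: mult.commute)
  have "int b \<le> w + int M * int j"
    unfolding j_def by (rule LeastI[of "\<lambda>j. int b \<le> w + int M * int j", OF ex])
  moreover have "w + int M * (int j - 1) < int b" if "j \<noteq> 0"
    using not_less_Least[of "j - 1" "\<lambda>j. int b \<le> w + int M * int j"] that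
    by (simp add: j_def[symmetric] not_le of_nat_diff)
  ultimately show ?thesis
    by (intro that[of j]) auto
qed

text \<open>Each factor of a Leibniz term is put at its least level. Adding the two degree bounds
  gives \<open>j - 1 < i + i'\<close>, so the orders add up to at least \<open>j\<close>.\<close>

lemma poly_like_mult:
  assumes "M \<ge> 1" "poly_like M w g" "poly_like M w' h"
  shows "poly_like M (w + w') (\<lambda>x. g x * h x)"
  unfolding poly_like_def
proof (intro allI impI fdiff_mult_mem)
  fix a j b b' :: nat and y z
  assume a: "w + w' + int M * (int j - 1) < int a" and b: "b + b' = a"
  obtain i where i: "int b \<le> w + int M * int i" "i = 0 \<or> w + int M * (int i - 1) < int b"
    using least_level[OF assms(1)] .
  obtain i' where i': "int b' \<le> w' + int M * int i'" "i' = 0 \<or> w' + int M * (int i' - 1) < int b'"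
    using least_level[OF assms(1)] .
  have "(fdiff ^^ b) g y \<in> I i" "(fdiff ^^ b') h z \<in> I i'"
    using assms(2,3) i(2) i'(2) unfolding poly_like_def by (metis I_0 UNIV_I)+
  moreover have "int a = int b + int b'"
    using b by simp
  then have "int M * (int j - 1) < int M * (int i + int i')"
    using a i(1) i'(1) unfolding distrib_left by linarith
  then have "j \<le> i + i'"
    by (simp add: mult_less_cancel_left)
  ultimately show "(fdiff ^^ b) g y * (fdiff ^^ b') h z \<in> I j"
    by (rule I_mult_le)
qed

lemma poly_like_fdiff_mem: "poly_like M w g \<Longrightarrow> w + int M * (int j - 1) < 0 \<Longrightarrow> g x \<in> I j"
  unfolding poly_like_def by (drule spec[of _ 0], drule spec[of _ j]) simp

lemma weighted_sum: "(\<And>i. i \<in> S \<Longrightarrow> weighted M c (P i)) \<Longrightarrow> weighted M c (\<lambda>x. \<Sum>i\<in>S. P i x)"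
  by (auto simp: weighted_def coeff_sum intro: poly_like_sum)

lemma weighted_add: "weighted M c P \<Longrightarrow> weighted M c Q \<Longrightarrow> weighted M c (\<lambda>x. P x + Q x)"
  by (auto simp: weighted_def intro: poly_like_add)

lemma weighted_minus: "weighted M c P \<Longrightarrow> weighted M c (\<lambda>x. - P x)"
  by (auto simp: weighted_def intro: poly_like_minus)

lemma weighted_mono: "weighted M c P \<Longrightarrow> c \<le> c' \<Longrightarrow> weighted M c' P"
  unfolding weighted_def by (meson diff_right_mono poly_like_mono)

lemma weighted_0: "weighted M c (\<lambda>_. 0)"
  by (simp add: weighted_def poly_like_0)

lemma weighted_const: "weighted M 0 (\<lambda>_. [:c:])"
  unfolding weighted_def
proof
  show "poly_like M (0 - int e) (\<lambda>x. coeff [:c:] e)" for e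
    by (cases e) (simp_all add: poly_like_const poly_like_0)
qed

lemma weighted_const_mem: "c \<in> I 1 \<Longrightarrow> weighted M (- int M) (\<lambda>_. [:c:])"
  unfolding weighted_def
proof
  show "c \<in> I 1 \<Longrightarrow> poly_like M (- int M - int e) (\<lambda>x. coeff [:c:] e)" for e
    by (cases e) (simp_all add: poly_like_const_mem poly_like_0)
qed

lemma weighted_linear: "weighted M 1 (\<lambda>x. [:of_int (i + int x), 1:])"
  unfolding weighted_def
proof
  show "poly_like M (1 - int e) (\<lambda>x. coeff [:of_int (i + int x), 1:] e)" for e
    using poly_like_linear[of M i] poly_like_const[of M 1]
    by (cases e; cases "e - 1") (simp_all add: poly_like_0 coeff_pCons)
qed

lemma weighted_monom: "weighted M (int d) (\<lambda>_. monom 1 d)"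
  unfolding weighted_def
proof
  show "poly_like M (int d - int e) (\<lambda>x. coeff (monom 1 d) e)" for e
    by (cases "e = d") (simp_all add: poly_like_const poly_like_0)
qed

lemma weighted_mult:
  assumes "M \<ge> 1" "weighted M c P" "weighted M c' Q"
  shows "weighted M (c + c') (\<lambda>x. P x * Q x)"
  unfolding weighted_def coeff_mult
proof (intro allI poly_like_sum)
  fix e i :: nat
  assume "i \<in> {..e}"
  then have "c + c' - int e = (c - int i) + (c' - int (e - i))"
    by simp
  then show "poly_like M (c + c' - int e) (\<lambda>x. coeff (P x) i * coeff (Q x) (e - i))"
    using assms(2,3) unfolding weighted_def by (simp only:) (rule poly_like_mult[OF assms(1)]; blast)
qed

lemma weighted_prod:
  assumes "M \<ge> 1" "finite S" "\<And>i. i \<in> S \<Longrightarrow> weighted M (c i) (P i)"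
  shows "weighted M (sum c S) (\<lambda>x. \<Prod>i\<in>S. P i x)"
  using assms(2,3)
proof (induction S rule: finite_induct)
  case empty
  then show ?case using weighted_const[of M 1] by (simp flip: one_pCons)
qed (simp add: weighted_mult[OF assms(1)])

lemma weighted_prod_linear:
  fixes c :: "'b \<Rightarrow> int"
  assumes "M \<ge> 1" "finite S"
  shows "weighted M (int (card S)) (\<lambda>x. \<Prod>i\<in>S. [:of_int (c i + int x), 1:])"
  using weighted_prod[OF assms, of "\<lambda>_. 1"] weighted_linear by simp

lemma weighted_coeff_mem: "weighted M c P \<Longrightarrow> c + int M * (int j - 1) < int e \<Longrightarrow> coeff (P x) e \<in> I j"
  unfolding weighted_def using poly_like_fdiff_mem[of M "c - int e" "\<lambda>x. coeff (P x) e" j x] by simp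

end

context diff_operator
begin

text \<open>An entry \<open>m\<close> places above the diagonal is assigned weight
  \<open>n - m * m\<close>, but carries a polynomial of degree up to \<open>m\<close> times a
  variable in I. The slope \<open>m * m + m\<close> credited for this variable covers the
  difference.\<close>

abbreviation slope :: nat where "slope \<equiv> m * (m + 1)"

lemma slope_pos: "slope \<ge> 1"
  using m_pos by (cases m) simp_all

text \<open>The summand \<open>m * (i - j)\<close> makes room for entries below the diagonal, whose
  degree may be \<open>m\<close> even if \<open>n\<close> is smaller. It cancels when summed over a
  permutation, so that minors get weight \<open>n * k\<close>.\<close>

lemma weighted_entry:
  "R.weighted slope (int n + int m * (i - j)) (\<lambda>x. entry (i + int x) (j + int x))"
proof (cases "int m < j - i")
  case True
  then show ?thesis
    using entry_upper_0 by (simp add: R.weighted_0)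
next
  case False
  have 1: "R.weighted slope (int n + int m * (i - j))
      (\<lambda>x. if i = j then \<Prod>r=1..n. [:of_int (i + int x - l r), 1:] else 0)"
  proof (cases "i = j")
    case True
    then show ?thesis
      using R.weighted_prod_linear[OF slope_pos, of "{1..n}" "\<lambda>r. i - l r"]
      by (simp add: algebra_simps)
  qed (simp add: R.weighted_0)
  have 2: "R.weighted slope (int n + int m * (i - j))
      (\<lambda>x. (\<Prod>r<k. [:of_int (j + int x - int r), 1:]) * [:tvar (nat (int k + i - j)) k:])"
    if k: "k \<le> m" "j - i \<le> int k" for k
  proof -
    have lin: "R.weighted slope (int k) (\<lambda>x. \<Prod>r<k. [:of_int (j + int x - int r), 1:])"
      using R.weighted_prod_linear[OF slope_pos, of "{..<k}" "\<lambda>r. j - int r"]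
      by (simp add: algebra_simps)
    show ?thesis
    proof (cases "i \<le> j")
      case True
      then have "tvar (nat (int k + i - j)) k \<in> tideal_power 1"
        by (intro tvar_mem) auto
      from R.weighted_mult[OF slope_pos lin R.weighted_const_mem[OF this]]
      have "R.weighted slope (int k + - int slope)
        (\<lambda>x. (\<Prod>r<k. [:of_int (j + int x - int r), 1:]) * [:tvar (nat (int k + i - j)) k:])" .
      moreover have "int m * - int m \<le> int m * (i - j)"
        using False by (intro mult_left_mono) auto
      then have "int k + - int slope \<le> int n + int m * (i - j)"
        using k by (simp add: algebra_simps)
      ultimately show ?thesis
        by (rule R.weighted_mono)
    next
      case False
      from R.weighted_mult[OF slope_pos lin R.weighted_const]
      have "R.weighted slope (int k + 0)
        (\<lambda>x. (\<Prod>r<k. [:of_int (j + int x - int r), 1:]) * [:tvar (nat (int k + i - j)) k:])" .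
      moreover have "int m * 1 \<le> int m * (i - j)"
        using False by (intro mult_left_mono) auto
      then have "int k + 0 \<le> int n + int m * (i - j)"
        using k by simp
      ultimately show ?thesis
        by (rule R.weighted_mono)
    qed
  qed
  have s: "{k. k \<le> m \<and> j + int x - (i + int x) \<le> int k} = {k. k \<le> m \<and> j - i \<le> int k}"
    "int k + (i + int x) - (j + int x) = int k + i - j" for x k
    by auto
  have e: "entry (i + int x) (j + int x) =
      (if i = j then \<Prod>r=1..n. [:of_int (i + int x - l r), 1:] else 0) +
      (\<Sum>k\<in>{k. k \<le> m \<and> j - i \<le> int k}.
        (\<Prod>r<k. [:of_int (j + int x - int r), 1:]) * [:tvar (nat (int k + i - j)) k:])" for x
    unfolding B_entry_def by (simp only: s add_right_cancel)
  show ?thesis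
    unfolding e by (intro R.weighted_add R.weighted_sum 1 2) auto
qed

lemma weighted_minor: "R.weighted slope (int (n * k)) (\<lambda>x. minor (a + int x) k)"
proof -
  define A where "A x = mat k k (\<lambda>(i, j). entry (a + int i + int x) (a + int j + int x))" for x
  have A: "A x \<in> carrier_mat k k" for x by (simp add: A_def)
  have "R.weighted slope (int (n * k)) (\<lambda>x. det (A x))"
    unfolding det_def'[OF A]
  proof (rule R.weighted_sum)
    fix q assume "q \<in> {q. q permutes {0..<k}}"
    then have q: "q permutes {0..<k}" by simp
    have qk: "q i < k" if "i < k" for i
      using that permutes_in_image[OF q, of i] by simp
    have "R.weighted slope (\<Sum>i=0..<k. int n + int m * ((a + int i) - (a + int (q i))))
        (\<lambda>x. \<Prod>i=0..<k. entry (a + int i + int x) (a + int (q i) + int x))"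
      by (rule R.weighted_prod[OF slope_pos]) (simp, rule weighted_entry)
    moreover have "(\<Sum>i=0..<k. int (q i)) = (\<Sum>i=0..<k. int i)"
      using sum.permute[OF q, of int] by (simp add: o_def)
    then have "(\<Sum>i=0..<k. int n + int m * ((a + int i) - (a + int (q i)))) = int (n * k)"
      by (simp add: sum.distrib sum_subtractf flip: sum_distrib_left)
    moreover have "(\<Prod>i=0..<k. A x $$ (i, q i))
        = (\<Prod>i=0..<k. entry (a + int i + int x) (a + int (q i) + int x))" for x
      using qk by (intro prod.cong) (auto simp: A_def)
    ultimately have "R.weighted slope (int (n * k)) (\<lambda>x. \<Prod>i=0..<k. A x $$ (i, q i))"
      by simp
    then show "R.weighted slope (int (n * k)) (\<lambda>x. signof q * (\<Prod>i=0..<k. A x $$ (i, q i)))"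
      using R.weighted_minus by (simp add: sign_def)
  qed
  then show ?thesis
    by (simp add: A_def minor_def ac_simps)
qed

lemma minor_coeff_large:
  "n * k + slope * j < e + slope \<Longrightarrow> coeff (minor a k) e \<in> tideal_power j"
  using R.weighted_coeff_mem[OF weighted_minor, of k j e a 0]
  by (simp add: algebra_simps flip: of_nat_mult of_nat_add)

end

section \<open>The leading coefficients of the minors\<close>

text \<open>Indices measured relative to the top degree of a product can become negative, and
  natural subtraction would turn them into 0.\<close>

definition int_coeff :: "'a::zero poly \<Rightarrow> int \<Rightarrow> 'a" where
  "int_coeff P d = (if d < 0 then 0 else coeff P (nat d))"

lemma int_coeff_of_nat [simp]: "int_coeff P (int d) = coeff P d"
  by (simp add: int_coeff_def)

lemma (in ideal_set) int_coeff_mult: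
  assumes "\<And>u. U < u \<Longrightarrow> coeff P u \<in> A"
  shows "int_coeff (P * Q) d - (\<Sum>u\<le>U. coeff P u * int_coeff Q (d - int u)) \<in> A"
proof (cases "d < 0")
  case True
  then show ?thesis by (simp add: int_coeff_def zero)
next
  case False
  define D where "D = nat d"
  have d: "d = int D" using False by (simp add: D_def)
  have "int_coeff (P * Q) d = (\<Sum>u\<le>D. coeff P u * int_coeff Q (d - int u))"
    unfolding d int_coeff_of_nat coeff_mult
    by (intro sum.cong refl) (simp add: int_coeff_def nat_diff_distrib')
  also have "\<dots> = (\<Sum>u\<le>max U D. coeff P u * int_coeff Q (d - int u))"
    by (intro sum.mono_neutral_left) (auto simp: int_coeff_def d)
  also have "\<dots> = (\<Sum>u\<le>U. coeff P u * int_coeff Q (d - int u))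
      + (\<Sum>u\<in>{..max U D} - {..U}. coeff P u * int_coeff Q (d - int u))"
    by (subst sum.subset_diff[of "{..U}"]) (auto simp: add.commute)
  also have "\<dots> - (\<Sum>u\<le>U. coeff P u * int_coeff Q (d - int u)) \<in> A"
    by (auto intro!: sum absorb_right[OF assms])
  finally show ?thesis .
qed

context filtration
begin

text \<open>Think of \<open>\<tau> e\<close> as a coefficient \<open>e\<close> places above the
  top degree. The slope \<open>2 (M + 1)\<close> makes the degree of a product drop strictly below that of
  \<open>\<tau> e\<close>, so that one further difference can be afforded.\<close>

lemma fdiff_product_mem:
  fixes \<tau> :: "int \<Rightarrow> nat \<Rightarrow> 'a"
  assumes M: "M \<ge> 1" and \<gamma>: "poly_like M i \<gamma>" "i \<le> 0 \<Longrightarrow> \<forall>x. \<gamma> x \<in> I 1"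
    and IH: "\<And>j2 a x. j2 \<le> j \<Longrightarrow> int (M + 1) * int j2 - (e + i) < int (M + 1) * int j - e \<Longrightarrow>
      2 * int (M + 1) * (int j2 - 1) - 2 * (e + i) < int a \<Longrightarrow> (fdiff ^^ a) (\<tau> (e + i)) x \<in> I j2"
    and a: "2 * int (M + 1) * (int j - 1) - 2 * e \<le> int a"
  shows "(fdiff ^^ a) (\<lambda>x. \<gamma> x * \<tau> (e + i) x) x \<in> I j"
    and "(fdiff ^^ a) (\<lambda>x. \<gamma> x * \<tau> (e + i) (Suc x)) x \<in> I j"
proof -
  have main: "(fdiff ^^ b) \<gamma> y * (fdiff ^^ b') (\<tau> (e + i)) z \<in> I j" if b: "b + b' = a" for b b' y z
  proof -
    obtain j0 where j0: "int b \<le> i + int M * int j0" "j0 = 0 \<or> i + int M * (int j0 - 1) < int b"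
      using least_level[OF M] .
    \<comment> \<open>For \<open>i <= 0\<close> the order is raised to at least 1, so that the
      measure of the other factor drops strictly in this case too.\<close>
    define j1 where "j1 = (if i \<le> 0 then max 1 j0 else j0)"
    have "(fdiff ^^ b) \<gamma> y \<in> I j0"
      using j0(2)
    proof
      assume "i + int M * (int j0 - 1) < int b"
      then show ?thesis using \<gamma>(1) by (simp add: poly_like_def)
    qed (simp add: I_0)
    moreover have "(fdiff ^^ b) \<gamma> y \<in> I 1" if "i \<le> 0"
      using \<gamma>(2)[OF that] by (intro fdiff_mem) blast
    ultimately have g: "(fdiff ^^ b) \<gamma> y \<in> I j1"
      by (auto simp: j1_def max_def)
    have j1: "int b \<le> i + int M * int j1"
    proof -
      have "int M * int j0 \<le> int M * int j1"
        by (intro mult_left_mono) (auto simp: j1_def)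
      then show ?thesis using j0(1) by linarith
    qed
    have j1_pos: "i \<le> 0 \<Longrightarrow> 1 \<le> j1"
      by (simp add: j1_def)
    show ?thesis
    proof (cases "j \<le> j1")
      case True
      then show ?thesis
        using g antimonoD absorb_right by blast
    next
      case False
      obtain k0 where k0: "int b' \<le> - 2 * (e + i) + int (2 * (M + 1)) * int k0"
        "k0 = 0 \<or> - 2 * (e + i) + int (2 * (M + 1)) * (int k0 - 1) < int b'"
        using least_level[of "2 * (M + 1)"] by auto
      have eq: "int (2 * (M + 1)) = 2 * int (M + 1)" by simp
      \<comment> \<open>Cut off at the order still missing, since the hypothesis on the factor
        \<open>\<tau>\<close> reaches no further.\<close>
      define k where "k = min k0 (j - j1)"
      have M_j1: "0 < int (M + 1) * int j1 + i"
      proof (cases "0 < i")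
        case True
        moreover have "0 \<le> int (M + 1) * int j1" by simp
        ultimately show ?thesis by linarith
      next
        case False
        then have "0 < int j1" using j1_pos by simp
        moreover have "int (M + 1) * int j1 = int M * int j1 + int j1"
          by (simp add: algebra_simps)
        ultimately show ?thesis using j1 by linarith
      qed
      have t: "(fdiff ^^ b') (\<tau> (e + i)) z \<in> I k"
      proof (cases "k = 0")
        case False
        then have "k0 \<noteq> 0" by (simp add: k_def)
        have "int (2 * (M + 1)) * (int k - 1) \<le> int (2 * (M + 1)) * (int k0 - 1)"
          by (intro mult_left_mono) (simp_all add: k_def)
        then have "2 * int (M + 1) * (int k - 1) - 2 * (e + i) < int b'"
          using k0(2) \<open>k0 \<noteq> 0\<close> unfolding eq by linarith
        moreover have "int (M + 1) * int k - (e + i) < int (M + 1) * int j - e"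
        proof -
          have "int (M + 1) * int k \<le> int (M + 1) * (int j - int j1)"
            using \<open>\<not> j \<le> j1\<close> by (intro mult_left_mono) (auto simp: k_def)
          then show ?thesis
            using M_j1 by (simp add: right_diff_distrib)
        qed
        ultimately show ?thesis
          by (intro IH) (auto simp: k_def)
      qed (simp add: I_0)
      have "j \<le> j1 + k"
      proof (cases "k = k0")
        case True
        have "int a = int b + int b'" using b by simp
        then have *: "2 * int (M + 1) * (int j - 1) \<le> int M * int j1 - i + 2 * int (M + 1) * int k"
          using a j1 k0(1) True by (simp add: algebra_simps)
        have "int M * int j1 - i < 2 * int (M + 1) * int j1 \<or> (j1 = 0 \<and> 0 < i)"
        proof (cases "0 < i")
          case True
          then show ?thesis
            by (cases "j1 = 0") (auto simp: algebra_simps intro!: add_strict_increasing2)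
        next
          case False
          then have "0 < int j1" using j1_pos by simp
          moreover have "2 * int (M + 1) * int j1 = 2 * (int M * int j1) + 2 * int j1"
            by (simp add: algebra_simps)
          ultimately show ?thesis using j1 by linarith
        qed
        then have "int M * int j1 - i < 2 * int (M + 1) * int j1"
          by auto
        with * have "2 * int (M + 1) * (int j - 1) < 2 * int (M + 1) * (int j1 + int k)"
          unfolding distrib_left by linarith
        then have "int j - 1 < int j1 + int k"
          by (subst (asm) mult_less_cancel_left_pos) auto
        then show ?thesis by simp
      qed (auto simp: k_def min_def split: if_splits)
      then show ?thesis
        by (rule I_mult_le[OF g t])
    qed
  qed
  show "(fdiff ^^ a) (\<lambda>x. \<gamma> x * \<tau> (e + i) x) x \<in> I j"
    by (rule fdiff_mult_mem) (rule main)
  show "(fdiff ^^ a) (\<lambda>x. \<gamma> x * \<tau> (e + i) (Suc x)) x \<in> I j"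
    by (rule fdiff_mult_mem) (simp only: fdiff_Suc_shift, rule main)
qed

end

context diff_operator
begin

text \<open>Modulo I the minor has degree \<open>n * (K + x)\<close>. The argument of the function
  is the length of the window, counted from \<open>K\<close>, and \<open>e\<close> measures the
  distance above that degree.\<close>

definition top_coeff :: "nat \<Rightarrow> int \<Rightarrow> nat \<Rightarrow> int tpoly" where
  "top_coeff K e x = int_coeff (minor 0 (K + x)) (int (n * (K + x)) + e)"

text \<open>Without the leading monomial all coefficients from index \<open>n * k\<close> on lie in
  I; \<open>fdiff_product_mem\<close> needs this gain of order where the weight does not
  help.\<close>

definition reduced_minor :: "nat \<Rightarrow> nat \<Rightarrow> int tpoly poly" where
  "reduced_minor k x = minor (int x) k - monom 1 (n * k)"

lemma weighted_reduced_minor: "R.weighted slope (int (n * k)) (reduced_minor k)"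
proof -
  have "R.weighted slope (int (n * k)) (\<lambda>x. minor (0 + int x) k + - monom 1 (n * k))"
    by (intro R.weighted_add weighted_minor R.weighted_minus R.weighted_monom)
  then show ?thesis by (simp add: reduced_minor_def[abs_def])
qed

lemma reduced_minor_mem: "n * k \<le> u \<Longrightarrow> coeff (reduced_minor k x) u \<in> tideal_power 1"
  using monic_minor[of k "int x"] by (auto simp: reduced_minor_def R.monic_mod_def le_eq_less_or_eq)

lemma int_coeff_minor_mult:
  assumes "n * k + slope * s \<le> U"
  shows "int_coeff (minor (int x) k * Q) (int (n * k) + d)
    - (int_coeff Q d + (\<Sum>u\<le>U. coeff (reduced_minor k x) u * int_coeff Q (d + (int (n * k) - int u))))
    \<in> tideal_power s"
proof -
  have "coeff (minor (int x) k) u \<in> tideal_power s" if "U < u" for u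
    using that assms slope_pos by (intro minor_coeff_large) linarith
  then have "int_coeff (minor (int x) k * Q) (int (n * k) + d)
    - (\<Sum>u\<le>U. coeff (minor (int x) k) u * int_coeff Q (int (n * k) + d - int u)) \<in> tideal_power s"
    by (rule R.int_coeff_mult)
  moreover have "(\<Sum>u\<le>U. coeff (minor (int x) k) u * int_coeff Q (int (n * k) + d - int u))
    = int_coeff Q d + (\<Sum>u\<le>U. coeff (reduced_minor k x) u * int_coeff Q (d + (int (n * k) - int u)))"
  proof -
    have "coeff (minor (int x) k) u = (if u = n * k then 1 else 0) + coeff (reduced_minor k x) u" for u
      by (simp add: reduced_minor_def)
    then have "(\<Sum>u\<le>U. coeff (minor (int x) k) u * int_coeff Q (int (n * k) + d - int u))
        = (\<Sum>u\<le>U. (if u = n * k then int_coeff Q d else 0)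
          + coeff (reduced_minor k x) u * int_coeff Q (d + (int (n * k) - int u)))"
      by (intro sum.cong refl) (auto simp: distrib_right algebra_simps)
    also have "\<dots> = int_coeff Q d + (\<Sum>u\<le>U. coeff (reduced_minor k x) u * int_coeff Q (d + (int (n * k) - int u)))"
      using assms by (simp add: sum.distrib)
    finally show ?thesis .
  qed
  ultimately show ?thesis by simp
qed

text \<open>The cluster relation for windows beginning at 0 and at \<open>x\<close> is compared in
  one degree. The leading terms give the first difference of \<open>top_coeff K e\<close>; all other
  terms are products to which the induction on \<open>(slope + 1) * j - e\<close> applies.\<close>

lemma top_coeff_poly_like:
  assumes K: "m * s \<le> K + 1"
  shows "j \<le> s \<Longrightarrow> 2 * int (slope + 1) * (int j - 1) - 2 * e < int a \<Longrightarrow>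
    (fdiff ^^ a) (top_coeff K e) x \<in> tideal_power j"
proof (induction "nat (int (slope + 1) * int j - e)" arbitrary: j e a x rule: less_induct)
  case less
  show ?case
  proof (cases "j = 0 \<or> int (slope + 1) * (int j - 1) < e")
    case True
    \<comment> \<open>So far above the top degree the weight bound puts the coefficient itself into
      the ideal, and no difference has to be taken.\<close>
    have "top_coeff K e y \<in> tideal_power j" for y
    proof (cases "j = 0")
      case False
      then have e: "int (slope + 1) * (int j - 1) < e" using True by simp
      have "0 \<le> int (slope + 1) * (int j - 1)" "int slope * (int j - 1) \<le> int (slope + 1) * (int j - 1)"
        using False by (auto intro!: mult_right_mono)
      then have e': "0 < e" "int slope * (int j - 1) < e"
        using e by linarith+
      then have "int (n * (K + y)) + int slope * (int j - 1) < int (nat (int (n * (K + y)) + e))"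
        by simp
      then have "coeff (minor (0 + int 0) (K + y)) (nat (int (n * (K + y)) + e)) \<in> tideal_power j"
        by (rule R.weighted_coeff_mem[OF weighted_minor])
      then show ?thesis
        using e' by (simp add: top_coeff_def int_coeff_def R.zero)
    qed (simp add: R.I_0)
    then show ?thesis by (rule R.fdiff_mem)
  next
    case False
    then have j: "j \<ge> 1" and e: "0 \<le> int (slope + 1) * (int j - 1) - e" by auto
    have "1 \<le> a" using less.prems(2) e by linarith
    then obtain a' where a': "a = Suc a'" by (cases a) auto
    \<comment> \<open>Beyond \<open>U\<close> the coefficients of the minors of length
      \<open>K\<close> and \<open>K + 1\<close> are negligible at order \<open>s\<close>, so one
      range serves both sums.\<close>
    define U where "U = n * (K + 1) + slope * s"
    define \<alpha> where "\<alpha> u = (\<lambda>x. coeff (reduced_minor K x) u)" for u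
    define \<beta> where "\<beta> u = (\<lambda>x. coeff (reduced_minor (K + 1) x) u)" for u
    define g where "g x = (\<Sum>u\<le>U. \<beta> u x * top_coeff K (e + (int (n * (K + 1)) - int u)) x)
      + - (\<Sum>u\<le>U. \<alpha> u x * top_coeff K (e + (int (n * K) - int u)) (Suc x))" for x
    have "fdiff (top_coeff K e) x - g x \<in> tideal_power s" for x
    proof -
      have c: "minor (int x) K * minor 0 (K + Suc x) - minor (int x) (K + 1) * minor 0 (K + x)
          \<in> coeffs_in (tideal_power s)"
        using minor_cluster[OF K, of 0 x 1] by (simp add: One_nat_def ac_simps)
      define d where "d = int (n * K) + (int (n * (K + Suc x)) + e)"
      have d': "d = int (n * (K + 1)) + (int (n * (K + x)) + e)"
        by (simp add: d_def algebra_simps)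
      have 0: "int_coeff (minor (int x) K * minor 0 (K + Suc x)) d
          - int_coeff (minor (int x) (K + 1) * minor 0 (K + x)) d \<in> tideal_power s"
        using coeffs_inD[OF c, of "nat d"] by (simp add: int_coeff_def R.zero)
      have 1: "int_coeff (minor (int x) K * minor 0 (K + Suc x)) d
          - (top_coeff K e (Suc x) + (\<Sum>u\<le>U. \<alpha> u x * top_coeff K (e + (int (n * K) - int u)) (Suc x)))
          \<in> tideal_power s"
        using int_coeff_minor_mult[of K s U x "minor 0 (K + Suc x)" "int (n * (K + Suc x)) + e"]
        unfolding d_def top_coeff_def \<alpha>_def add.assoc by (simp add: U_def)
      have 2: "int_coeff (minor (int x) (K + 1) * minor 0 (K + x)) d
          - (top_coeff K e x + (\<Sum>u\<le>U. \<beta> u x * top_coeff K (e + (int (n * (K + 1)) - int u)) x))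
          \<in> tideal_power s"
        using int_coeff_minor_mult[of "K + 1" s U x "minor 0 (K + x)" "int (n * (K + x)) + e"]
        unfolding d' top_coeff_def \<beta>_def add.assoc by (simp add: U_def)
      show ?thesis
        using R.add[OF R.diff[OF 0 1] 2] by (simp add: fdiff_def g_def algebra_simps)
    qed
    then have "(fdiff ^^ a') (\<lambda>x. fdiff (top_coeff K e) x - g x) x \<in> tideal_power j"
      using R.antimonoD[OF _ less.prems(1)] by (intro R.fdiff_mem) blast
    moreover have "(fdiff ^^ a') g x \<in> tideal_power j"
    proof -
      have a'': "2 * int (slope + 1) * (int j - 1) - 2 * e \<le> int a'"
        using less.prems(2) a' by simp
      have IH: "(fdiff ^^ a) (top_coeff K e') x \<in> tideal_power j2"
        if "j2 \<le> j" "int (slope + 1) * int j2 - e' < int (slope + 1) * int j - e"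
          "2 * int (slope + 1) * (int j2 - 1) - 2 * e' < int a" for j2 e' a x
      proof (rule less.hyps)
        have "0 < int (slope + 1)" by simp
        then have "0 < int (slope + 1) * int j - e"
          using e unfolding right_diff_distrib mult_1_right by linarith
        then show "nat (int (slope + 1) * int j2 - e') < nat (int (slope + 1) * int j - e)"
          using that by simp
      qed (use that less.prems(1) in auto)
      have "(fdiff ^^ a') (\<lambda>x. \<beta> u x * top_coeff K (e + (int (n * (K + 1)) - int u)) x) x
          \<in> tideal_power j" for u
      proof (rule R.fdiff_product_mem(1)[OF slope_pos _ _ IH a''])
        show "R.poly_like slope (int (n * (K + 1)) - int u) (\<beta> u)"
          using weighted_reduced_minor[of "K + 1"] by (simp add: R.weighted_def \<beta>_def)
        show "\<forall>x. \<beta> u x \<in> tideal_power 1" if "int (n * (K + 1)) - int u \<le> 0"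
          using reduced_minor_mem[of "K + 1" u] that unfolding \<beta>_def by (simp add: of_nat_le_iff[symmetric] del: of_nat_le_iff)
      qed
      moreover have "(fdiff ^^ a') (\<lambda>x. \<alpha> u x * top_coeff K (e + (int (n * K) - int u)) (Suc x)) x
          \<in> tideal_power j" for u
      proof (rule R.fdiff_product_mem(2)[OF slope_pos _ _ IH a''])
        show "R.poly_like slope (int (n * K) - int u) (\<alpha> u)"
          using weighted_reduced_minor[of K] by (simp add: R.weighted_def \<alpha>_def)
        show "\<forall>x. \<alpha> u x \<in> tideal_power 1" if "int (n * K) - int u \<le> 0"
          using reduced_minor_mem[of K u] that unfolding \<alpha>_def by (simp add: of_nat_le_iff[symmetric] del: of_nat_le_iff)
      qed
      ultimately show ?thesis
        unfolding g_def fdiff_add fdiff_minus fdiff_sum by (intro R.add R.minus R.sum)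
    qed
    ultimately have "(fdiff ^^ a') (\<lambda>x. (fdiff (top_coeff K e) x - g x) + g x) x \<in> tideal_power j"
      unfolding fdiff_add by (rule R.add)
    then show ?thesis
      unfolding a' fdiff_funpow_Suc by simp
  qed
qed

end

section \<open>Reduction modulo a prime\<close>

definition pfilt :: "nat \<Rightarrow> nat \<Rightarrow> int tpoly set" where
  "pfilt p k = {of_nat p * g + h | g h. h \<in> tideal_power k}"

interpretation N: filtration "pfilt p" for p
  unfolding pfilt_def[abs_def] by (rule R.filtration_add_multiples)

interpretation NP: filtration "\<lambda>k. coeffs_in (pfilt p k)" for p
  by (rule N.filtration_coeffs_in)

lemma ideal_power_pfilt: "tideal_power k \<subseteq> pfilt p k"
proof
  fix h assume "h \<in> tideal_power k"
  moreover have "h = of_nat p * 0 + h" by simp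
  ultimately show "h \<in> pfilt p k"
    unfolding pfilt_def by blast
qed

lemma of_nat_pfilt: "of_nat p \<in> pfilt p k"
proof -
  have "(of_nat p :: int tpoly) = of_nat p * 1 + 0" by simp
  then show ?thesis
    unfolding pfilt_def using R.zero by blast
qed

lemma coeffs_in_pfilt: "P \<in> coeffs_in (tideal_power k) \<Longrightarrow> P \<in> coeffs_in (pfilt p k)"
  using coeffs_in_mono[OF ideal_power_pfilt] by blast

section \<open>Quotients, units and comaximality in a filtered ring\<close>

context filtration
begin

text \<open>A quotient inherits the difference of the weights. Coefficient \<open>d + e\<close>
  isolates \<open>coeff P e\<close>: terms with \<open>j < d\<close> involve higher coefficients of
  \<open>P\<close>, and for \<open>j = d + q\<close> the order of \<open>coeff F j\<close> and the
  order already known for \<open>coeff P (e - q)\<close> add up to the required one.\<close>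

lemma monic_mod_weight:
  assumes M: "M \<ge> 1" and F: "monic_mod d F" "\<And>e j. d + M * j < e + M \<Longrightarrow> coeff F e \<in> I j"
    and G: "\<And>e j. d + c + M * j < e + M \<Longrightarrow> coeff G e \<in> I j"
    and eq: "F * P - G \<in> coeffs_in (I s)"
  shows "k \<le> s \<Longrightarrow> c + M * k < e + M \<Longrightarrow> coeff P e \<in> I k"
proof (induction k arbitrary: e rule: less_induct)
  case step: (less k')
  show ?case
  proof (cases k')
    case 0
    then show ?thesis by (simp add: I_0)
  next
    case (Suc k)
    have IH: "i \<le> k \<Longrightarrow> c + M * i < e + M \<Longrightarrow> coeff P e \<in> I i" for i e
      using step.IH[of i] step.prems(1) by (simp add: Suc)
    have k: "Suc k \<le> s"
      using step.prems(1) by (simp add: Suc)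
    have "c + M * k < e \<Longrightarrow> coeff P e \<in> I (Suc k)" for e
    proof (induction "Suc (degree P) - e" arbitrary: e rule: less_induct)
      case less
      show ?case
      proof (cases "degree P < e")
        case False
        have "coeff (F * P - G) (d + e) \<in> I (Suc k)"
          using eq k antimonoD coeffs_inD by blast
        moreover have "coeff G (d + e) \<in> I (Suc k)"
          using less.prems by (intro G) simp
        ultimately have "coeff (F * P) (d + e) \<in> I (Suc k)"
          using cong_mem[of "coeff (F * P) (d + e)" "coeff G (d + e)" "Suc k"] by simp
        moreover have "coeff (F * P) (d + e) =
            coeff F d * coeff P e + (\<Sum>j\<in>{..d + e} - {d}. coeff F j * coeff P (d + e - j))"
          unfolding coeff_mult by (subst sum.remove[of _ d]) auto
        moreover have "(\<Sum>j\<in>{..d + e} - {d}. coeff F j * coeff P (d + e - j)) \<in> I (Suc k)"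
        proof (rule sum)
          fix j assume j: "j \<in> {..d + e} - {d}"
          show "coeff F j * coeff P (d + e - j) \<in> I (Suc k)"
          proof (cases "j < d")
            case True
            then show ?thesis
              using less.prems \<open>\<not> degree P < e\<close> by (intro absorb less.hyps) auto
          next
            case False
            define q where "q = j - d"
            have q: "q \<ge> 1" "j = d + q" "d + e - j = e - q" "q \<le> e"
              using False j unfolding q_def by (simp_all, linarith+)
            obtain i where i: "int q \<le> 0 + int M * int i" "i = 0 \<or> 0 + int M * (int i - 1) < int q"
              using least_level[OF M] .
            have "i \<noteq> 0" using i(1) q(1) by (intro notI) simp
            then obtain i' where i': "i = Suc i'" using not0_implies_Suc by blast
            have "int (M * i') < int q" "int q \<le> int (M + M * i')"
              using i i' by (simp_all add: algebra_simps)
            then have iq: "M * i' < q" "q \<le> M + M * i'"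
              by (simp_all only: of_nat_less_iff of_nat_le_iff)
            have "coeff F j \<in> I i"
              using iq by (intro F(2)) (simp add: i' q)
            moreover have "coeff P (e - q) \<in> I (k - i')"
            proof (cases "k \<le> i'")
              case False
              then have "M * k = M * i' + M * (k - i')"
                by (simp flip: distrib_left)
              then show ?thesis
                using less.prems iq q by (intro IH) auto
            qed (simp add: I_0)
            ultimately show ?thesis
              unfolding q(3) by (rule I_mult_le) (simp add: i')
          qed
        qed
        ultimately have "coeff F d * coeff P e \<in> I (Suc k)"
          using diff by (metis (no_types, lifting) add_diff_cancel_right')
        moreover have "(coeff F d - 1) * coeff P e \<in> I (Suc k)"
          using I_mult[of "coeff F d - 1" 1 "coeff P e" k] F(1) IH[of k e] less.prems
          by (simp add: monic_mod_def plus_1_eq_Suc)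
        ultimately show ?thesis
          using diff by (fastforce simp: algebra_simps)
      qed (simp add: coeff_eq_0 zero)
    qed
    then show ?thesis using step.prems by (simp add: Suc)
  qed
qed

lemma cancel_unit: "u - 1 \<in> I 1 \<Longrightarrow> u * x \<in> I s \<Longrightarrow> x \<in> I s"
proof -
  assume u: "u - 1 \<in> I 1" "u * x \<in> I s"
  then have "monic_mod 0 [:u:]"
    by (auto simp: monic_mod_def zero coeff_pCons split: nat.split)
  moreover have "[:u:] * [:x:] \<in> coeffs_in (I s)"
    using const_in[OF u(2)] by (simp add: mult.commute)
  ultimately have "[:x:] \<in> coeffs_in (I s)"
    by (rule cancel_monic_mod)
  from coeffs_inD[OF this, of 0] show ?thesis by simp
qed

text \<open>The truncated geometric series in \<open>1 - e\<close>.\<close>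

lemma unit_lift:
  assumes "e - 1 \<in> I 1"
  obtains f where "f * e - 1 \<in> I s"
proof -
  have "(1 - e) ^ s \<in> I s"
    using assms by (intro I_power) (rule diff_commute)
  moreover have "1 - (1 - e) ^ s = e * (\<Sum>i<s. (1 - e) ^ i)"
    by (simp add: one_diff_power_eq)
  then have "(\<Sum>i<s. (1 - e) ^ i) * e - 1 = - ((1 - e) ^ s)"
    by (simp add: algebra_simps)
  ultimately show ?thesis
    using that minus by metis
qed

end

context ideal_set
begin

definition comaximal :: "'a \<Rightarrow> 'a \<Rightarrow> bool" where
  "comaximal x y \<longleftrightarrow> (\<exists>u v. u * x + v * y - 1 \<in> A)"

lemma comaximal_sym: "comaximal x y \<Longrightarrow> comaximal y x"
  unfolding comaximal_def by (metis add.commute)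

lemma comaximal_mult:
  assumes "comaximal x y" "comaximal x z"
  shows "comaximal x (y * z)"
proof -
  obtain u v u' v' where "u * x + v * y - 1 \<in> A" "u' * x + v' * z - 1 \<in> A"
    using assms unfolding comaximal_def by blast
  then have "(u * x + v * y) * (u' * x + v' * z) - 1 * 1 \<in> A"
    by (rule cong_mult)
  moreover have "(u * x + v * y) * (u' * x + v' * z)
      = (u * x * u' + u * v' * z + v * y * u') * x + v * v' * (y * z)"
    by (simp add: algebra_simps)
  ultimately show ?thesis
    unfolding comaximal_def by (metis mult_1)
qed

lemma comaximal_1: "comaximal x 1"
  unfolding comaximal_def by (intro exI[of _ 0] exI[of _ 1]) (simp add: zero)

lemma comaximal_prod: "(\<And>i. i \<in> S \<Longrightarrow> comaximal x (f i)) \<Longrightarrow> comaximal x (prod f S)"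
  by (induction S rule: infinite_finite_induct) (auto intro: comaximal_mult comaximal_1)

lemma comaximal_cong:
  assumes "comaximal x y" "x - x' \<in> A" "y - y' \<in> A"
  shows "comaximal x' y'"
proof -
  obtain u v where "u * x + v * y - 1 \<in> A"
    using assms unfolding comaximal_def by blast
  moreover have "u * x' + v * y' - (u * x + v * y) \<in> A"
    using assms by (intro cong_add cong_mult) (auto simp: zero intro: diff_commute)
  ultimately show ?thesis
    unfolding comaximal_def using diff_trans by blast
qed

end

lemma coprime_inverse_pfilt:
  assumes "prime p" "\<not> int p dvd D"
  obtains c where "of_int c * of_int D - (1 :: int tpoly) \<in> pfilt p k"
proof -
  have "coprime (int p) D"
    using assms by (simp add: prime_imp_coprime)
  then obtain c d where "d * int p + c * D = 1"
    using bezout_int[of "int p" D] by auto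
  then have "c * D - 1 = - d * int p"
    by simp
  then have "of_int (c * D - 1) = (of_int (- d * int p) :: int tpoly)"
    by simp
  then have "of_int c * of_int D - (1 :: int tpoly) = - (of_int d * of_nat p)"
    by simp
  then show ?thesis
    using that[of c] N.minus[OF N.absorb[OF of_nat_pfilt]] by metis
qed

lemma pfilt_cancel_coprime:
  assumes "prime p" "\<not> int p dvd D" "of_int D * x \<in> pfilt p k"
  shows "x \<in> pfilt p k"
proof -
  obtain c where c: "of_int c * of_int D - (1 :: int tpoly) \<in> pfilt p k"
    using coprime_inverse_pfilt[OF assms(1,2)] .
  have "x = of_int c * (of_int D * x) - (of_int c * of_int D - 1) * x"
    by (simp add: algebra_simps)
  then show ?thesis
    using N.diff[OF N.absorb[OF assms(3), of "of_int c"] N.absorb_right[OF c, of x]] by simp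
qed

subsection \<open>Polynomials invariant under a unit shift\<close>

abbreviation artin_schreier :: "nat \<Rightarrow> int tpoly poly" where
  "artin_schreier p \<equiv> monom 1 p - [:0, 1:]"

lemma coeff_pcompose_shift:
  "coeff (pcompose P [:1, 1:]) j = (\<Sum>i\<le>degree P. coeff P i * of_nat (i choose j))"
  for P :: "int tpoly poly"
proof -
  have "coeff ([:1, 1 :: int tpoly:] ^ i) j = of_nat (i choose j)" for i
  proof (cases "j \<le> i")
    case False
    have "degree ([:1, 1 :: int tpoly:] ^ i) \<le> i"
      using degree_power_le[of "[:1, 1 :: int tpoly:]" i] by simp
    then show ?thesis
      using False by (simp add: coeff_eq_0 binomial_eq_0)
  qed (simp add: coeff_linear_poly_power)
  moreover have "pcompose P [:1, 1:] = (\<Sum>i\<le>degree P. Polynomial.smult (coeff P i) ([:1, 1:] ^ i))"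
    unfolding pcompose_altdef poly_altdef by (simp add: coeff_map_poly degree_map_poly)
  ultimately show ?thesis
    by (simp add: coeff_sum)
qed

lemma artin_schreier_shift:
  assumes "prime p"
  shows "pcompose (artin_schreier p) [:1, 1:] - artin_schreier p \<in> coeffs_in (pfilt p k)"
proof (rule coeffs_inI)
  fix j
  have "p > 1" using assms prime_gt_1_nat by blast
  have "pcompose (artin_schreier p) [:1, 1:] = pcompose (monom 1 p) [:1, 1:] - [:1, 1:]"
    by (simp add: pcompose_diff pcompose_pCons)
  then have c: "coeff (pcompose (artin_schreier p) [:1, 1:] - artin_schreier p) j
      = of_nat (p choose j) - coeff (monom 1 p) j - coeff 1 j"
    by (simp add: coeff_pcompose_shift degree_monom_eq coeff_pCons One_nat_def
        if_distrib[of "\<lambda>x. x * _"] sum.delta' cong: if_cong split: nat.split)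
  show "coeff (pcompose (artin_schreier p) [:1, 1:] - artin_schreier p) j \<in> pfilt p k"
  proof (cases "0 < j \<and> j < p")
    case True
    then obtain q where "p choose j = p * q"
      using dvd_choose_prime[of j p] assms by (auto elim: dvdE)
    then show ?thesis
      unfolding c using True of_nat_pfilt N.absorb_right by (simp add: coeff_pCons split: nat.split)
  next
    case False
    then show ?thesis
      unfolding c using \<open>p > 1\<close> by (auto simp: N.zero binomial_eq_0 not_less le_less)
  qed
qed

lemma artin_schreier_degree:
  assumes "1 < p"
  shows "degree (artin_schreier p ^ q) = p * q" "coeff (artin_schreier p ^ q) (p * q) = 1"
proof -
  have d: "degree (artin_schreier p) = p" "lead_coeff (artin_schreier p) = 1"
  proof -
    have "degree [:0, 1 :: int tpoly:] < degree (monom (1 :: int tpoly) p)"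
      using assms by (simp add: degree_monom_eq)
    then have "degree (- [:0, 1 :: int tpoly:]) < degree (monom (1 :: int tpoly) p)"
      by (simp only: degree_minus)
    then have "degree (monom (1 :: int tpoly) p + - [:0, 1:]) = degree (monom (1 :: int tpoly) p)"
      by (rule degree_add_eq_left)
    then show *: "degree (artin_schreier p) = p"
      by (simp only: diff_conv_add_uminus) (simp add: degree_monom_eq)
    show "lead_coeff (artin_schreier p) = 1"
      unfolding * using assms by (simp add: coeff_pCons split: nat.split)
  qed
  then have "artin_schreier p \<noteq> 0"
    by (metis leading_coeff_0_iff zero_neq_one)
  then show *: "degree (artin_schreier p ^ q) = p * q"
    by (simp add: degree_power_eq d)
  show "coeff (artin_schreier p ^ q) (p * q) = 1"
    using lead_coeff_power[of "artin_schreier p" q] unfolding * d(2) by simp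
qed

text \<open>If \<open>Suc d\<close> is prime to p, the coefficient of degree \<open>d\<close> in
  P(eps + 1) - P(eps) is \<open>Suc d\<close> times the top coefficient of \<open>P\<close>, which
  therefore vanishes. If p divides \<open>Suc d\<close>, the top term is removed by a multiple of a
  power of eps^p - eps, which is itself invariant.\<close>

lemma periodic_poly:
  assumes p: "prime p" and P: "pcompose P [:1, 1:] - P \<in> coeffs_in (pfilt p k)"
    and deg: "\<And>e. d < e \<Longrightarrow> coeff P e \<in> pfilt p k"
  shows "\<exists>c. P - (\<Sum>i\<le>d div p. Polynomial.smult (c i) (artin_schreier p ^ i)) \<in> coeffs_in (pfilt p k)"
  using P deg
proof (induction d arbitrary: P)
  case 0
  have "P - [:coeff P 0:] \<in> coeffs_in (pfilt p k)"
    by (rule coeffs_inI) (use 0(2) in \<open>auto simp: coeff_pCons N.zero split: nat.split\<close>)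
  then show ?case
    by (intro exI[of _ "\<lambda>_. coeff P 0"]) simp
next
  case (Suc d)
  have p1: "1 < p" using p prime_gt_1_nat by blast
  show ?case
  proof (cases "p dvd Suc d")
    case False
    define f where "f i = coeff P i * of_nat (i choose d)" for i
    have "coeff (pcompose P [:1, 1:]) d = (\<Sum>i\<le>max (degree P) (Suc d). f i)"
      unfolding coeff_pcompose_shift f_def by (rule sum.mono_neutral_left) (auto simp: coeff_eq_0)
    also have "\<dots> = (\<Sum>i\<in>{d, Suc d}. f i) + (\<Sum>i\<in>{..max (degree P) (Suc d)} - {d, Suc d}. f i)"
      by (subst sum.subset_diff[of "{d, Suc d}"]) (auto simp: add.commute)
    also have "(\<Sum>i\<in>{d, Suc d}. f i) = coeff P d + of_nat (Suc d) * coeff P (Suc d)"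
      by (simp add: f_def mult.commute)
    finally have e: "of_nat (Suc d) * coeff P (Suc d) = coeff (pcompose P [:1, 1:] - P) d
        - (\<Sum>i\<in>{..max (degree P) (Suc d)} - {d, Suc d}. f i)"
      by (simp add: algebra_simps)
    have "f i \<in> pfilt p k" if "i \<notin> {d, Suc d}" for i
      using that Suc.prems(2)[of i] by (cases "i < d") (auto simp: f_def N.zero binomial_eq_0 intro: N.absorb_right)
    then have "of_int (int (Suc d)) * coeff P (Suc d) \<in> pfilt p k"
      unfolding of_int_of_nat_eq e by (intro N.diff N.sum coeffs_inD[OF Suc.prems(1)]) auto
    then have "coeff P (Suc d) \<in> pfilt p k"
      by (rule pfilt_cancel_coprime[OF p, rotated]) (simp only: of_nat_dvd_iff False not_False_eq_True)
    then have deg: "coeff P e \<in> pfilt p k" if "d < e" for e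
      using that Suc.prems(2)[of e] by (cases "e = Suc d") auto
    obtain c where "P - (\<Sum>i\<le>d div p. Polynomial.smult (c i) (artin_schreier p ^ i)) \<in> coeffs_in (pfilt p k)"
      using Suc.IH[OF Suc.prems(1) deg] by blast
    moreover have "Suc d div p = d div p"
      using False by (simp add: div_Suc dvd_eq_mod_eq_0)
    ultimately show ?thesis by auto
  next
    case True
    then obtain q where q: "Suc d = p * q" by (elim dvdE)
    have "q \<noteq> 0" using q by (intro notI) simp
    define a where "a = coeff P (Suc d)"
    define P' where "P' = P - Polynomial.smult a (artin_schreier p ^ q)"
    have d_div: "d div p = q - 1"
    proof (rule div_nat_eqI)
      show "p * (q - 1) \<le> d" "d < p * Suc (q - 1)"
        using q \<open>q \<noteq> 0\<close> p1 by (auto simp: algebra_simps diff_mult_distrib2)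
    qed
    interpret h: comm_ring_hom "\<lambda>P :: int tpoly poly. pcompose P [:1, 1:]"
      by (rule comm_ring_hom_pcompose)
    have sh: "pcompose (artin_schreier p ^ q) [:1, 1:] - artin_schreier p ^ q \<in> coeffs_in (pfilt p k)"
      unfolding h.hom_power by (rule NP.cong_power[OF artin_schreier_shift[OF p]])
    have "pcompose P' [:1, 1:] - P' = (pcompose P [:1, 1:] - P)
        - [:a:] * (pcompose (artin_schreier p ^ q) [:1, 1:] - artin_schreier p ^ q)"
      by (simp add: P'_def pcompose_diff pcompose_smult smult_diff_right)
    then have P'_shift: "pcompose P' [:1, 1:] - P' \<in> coeffs_in (pfilt p k)"
      using NP.diff[OF Suc.prems(1) NP.absorb[OF sh, of "[:a:]"]] by (simp only:)
    have P'_deg: "coeff P' e \<in> pfilt p k" if "d < e" for e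
    proof (cases "e = Suc d")
      case True
      then show ?thesis
        using artin_schreier_degree(2)[OF p1, of q] by (simp add: P'_def a_def q N.zero)
    next
      case False
      then have "coeff (artin_schreier p ^ q) e = 0"
        using that q by (intro coeff_eq_0) (simp add: artin_schreier_degree[OF p1])
      then show ?thesis
        using Suc.prems(2)[of e] False that by (simp add: P'_def)
    qed
    obtain c where c: "P' - (\<Sum>i\<le>d div p. Polynomial.smult (c i) (artin_schreier p ^ i))
        \<in> coeffs_in (pfilt p k)"
      using Suc.IH[OF P'_shift P'_deg] by blast
    define c' where "c' i = (if i = q then a else c i)" for i
    have "{..q} = insert q {..q - 1}" using \<open>q \<noteq> 0\<close> by auto
    then have "(\<Sum>i\<le>Suc d div p. Polynomial.smult (c' i) (artin_schreier p ^ i))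
        = Polynomial.smult a (artin_schreier p ^ q) + (\<Sum>i\<le>d div p. Polynomial.smult (c' i) (artin_schreier p ^ i))"
      using p1 \<open>q \<noteq> 0\<close> by (simp add: q d_div c'_def)
    also have "(\<Sum>i\<le>d div p. Polynomial.smult (c' i) (artin_schreier p ^ i))
        = (\<Sum>i\<le>d div p. Polynomial.smult (c i) (artin_schreier p ^ i))"
      using \<open>q \<noteq> 0\<close> by (intro sum.cong) (auto simp: c'_def d_div)
    finally show ?thesis
      using c by (intro exI[of _ c']) (simp add: P'_def algebra_simps)
  qed
qed

text \<open>The exponents run from \<open>i\<close> to \<open>p * i\<close> in steps of
  \<open>p - 1\<close>. The gaps between them isolate the coefficients of degree \<open>n\<close>
  and \<open>n * p\<close> later on.\<close>

lemma artin_schreier_coeff: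
  assumes "1 < p"
  shows "(\<And>k. k \<le> i \<Longrightarrow> e \<noteq> i + (p - 1) * k) \<Longrightarrow> coeff (artin_schreier p ^ i) e = 0"
    and "coeff (artin_schreier p ^ i) i = (-1) ^ i"
proof -
  have "artin_schreier p = monom 1 1 * (monom 1 (p - 1) + (- 1))"
    using assms by (intro poly_eqI) (auto simp: coeff_monom_mult coeff_pCons split: nat.split)
  then have "artin_schreier p ^ i = monom 1 i * (monom 1 (p - 1) + (- 1)) ^ i"
    by (simp add: power_mult_distrib monom_power)
  also have "\<dots> = (\<Sum>k\<le>i. monom 1 i * (of_nat (i choose k) * monom 1 (p - 1) ^ k * (- 1) ^ (i - k)))"
    by (simp only: binomial_ring sum_distrib_left)
  also have "\<dots> = (\<Sum>k\<le>i. monom (of_nat (i choose k) * (- 1) ^ (i - k)) (i + (p - 1) * k))"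
  proof (intro sum.cong refl)
    fix k
    have "monom 1 i * (of_nat (i choose k) * monom 1 (p - 1) ^ k * (- 1) ^ (i - k))
        = monom 1 i * (monom 1 (p - 1) ^ k * [:of_nat (i choose k) * (- 1 :: int tpoly) ^ (i - k):])"
      by (simp add: of_nat_poly) (simp add: minus_one_power_iff)
    also have "\<dots> = monom (of_nat (i choose k) * (- 1) ^ (i - k)) (i + (p - 1) * k)"
      by (simp add: monom_power mult_monom smult_monom mult.commute)
    finally show "monom 1 i * (of_nat (i choose k) * monom 1 (p - 1) ^ k * (- 1) ^ (i - k))
        = monom (of_nat (i choose k) * (- 1 :: int tpoly) ^ (i - k)) (i + (p - 1) * k)" .
  qed
  finally have c: "coeff (artin_schreier p ^ i) e
      = (\<Sum>k\<le>i. if i + (p - 1) * k = e then of_nat (i choose k) * (- 1) ^ (i - k) else 0)" for e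
    by (simp add: coeff_sum)
  show "(\<And>k. k \<le> i \<Longrightarrow> e \<noteq> i + (p - 1) * k) \<Longrightarrow> coeff (artin_schreier p ^ i) e = 0"
    unfolding c by (intro sum.neutral) auto
  have "(\<Sum>k\<le>i. if i + (p - 1) * k = i then of_nat (i choose k) * (- 1) ^ (i - k) else 0)
      = (\<Sum>k\<le>i. if k = 0 then (- 1 :: int tpoly) ^ i else 0)"
    using assms by (intro sum.cong) auto
  then show "coeff (artin_schreier p ^ i) i = (-1) ^ i"
    unfolding c by simp
qed

lemma ideal_power_pfiltD: "x \<in> tideal_power k \<Longrightarrow> x \<in> pfilt p k"
  using ideal_power_pfilt by blast

section \<open>Minors modulo a prime and their quotient over one period\<close>

context diff_operator
begin

lemma monic_minor_pfilt: "N.monic_mod p (n * k) (minor a k)"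
  using monic_minor[of k a] ideal_power_pfiltD by (auto simp: R.monic_mod_def N.monic_mod_def)

lemma minor_period: "minor (a + int p) k - minor a k \<in> coeffs_in (pfilt p j)"
  using N.pcompose_shift[OF of_nat_pfilt, of "minor a k" p j] by (simp add: minor_shift)

lemma poly_minor_pfilt:
  "poly (minor a k) 0 - of_int (\<Prod>j<k. \<Prod>r=1..n. a + int j - l r) \<in> pfilt p 1"
  by (rule ideal_power_pfiltD[OF poly_minor_mod_ideal])

text \<open>The window of length \<open>K + p + 1\<close> from \<open>a\<close> is compared with the
  windows that omit its last or its first place. By periodicity the factor for the last place is
  \<open>minor a (K + 1)\<close> over \<open>minor a K\<close>, so both comparisons contain
  \<open>minor a (K + 1)\<close>, which cancels.\<close>

lemma minor_ratio_step:
  assumes "m * s \<le> K + 1"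
  shows "minor a (K + p) * minor (a + 1) K - minor (a + 1) (K + p) * minor a K \<in> coeffs_in (pfilt p s)"
proof -
  let ?A = "coeffs_in (pfilt p s)"
  let ?G = "minor a (K + 1)" and ?T = "minor a (K + p + 1)"
  have 1: "?T * minor (a + int p) K - minor a (K + p) * minor (a + int p) (K + 1) \<in> ?A"
    using coeffs_in_pfilt[OF minor_cluster[OF assms, of a p 1]] by (simp add: ac_simps)
  have "?T * minor a K - ?T * minor (a + int p) K \<in> ?A"
    by (intro NP.cong_mult NP.diff_commute[OF minor_period]) (simp add: NP.zero)
  from NP.diff_trans[OF this 1]
  have "?T * minor a K - minor a (K + p) * minor (a + int p) (K + 1) \<in> ?A" .
  moreover have "minor a (K + p) * minor (a + int p) (K + 1) - minor a (K + p) * ?G \<in> ?A"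
    by (intro NP.cong_mult minor_period) (simp add: NP.zero)
  ultimately have 2: "?T * minor a K - minor a (K + p) * ?G \<in> ?A"
    by (rule NP.diff_trans)
  have 3: "?T * minor (a + 1) K - ?G * minor (a + 1) (K + p) \<in> ?A"
    using coeffs_in_pfilt[OF minor_cluster_1[OF assms, of a p]] by simp
  have "?G * (minor a (K + p) * minor (a + 1) K) - ?G * (minor (a + 1) (K + p) * minor a K) \<in> ?A"
    using NP.diff[OF NP.absorb_right[OF 3, of "minor a K"] NP.absorb_right[OF 2, of "minor (a + 1) K"]]
    by (simp add: algebra_simps)
  then show ?thesis
    by (rule N.monic_mod_cancel[OF monic_minor_pfilt])
qed

lemma minor_ratio:
  assumes "m * s \<le> K + 1"
  shows "minor a (K + p) * minor (a + int i) K - minor (a + int i) (K + p) * minor a K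
    \<in> coeffs_in (pfilt p s)"
proof (induction i)
  case (Suc i)
  let ?A = "coeffs_in (pfilt p s)" and ?b = "a + int i"
  have 1: "minor ?b (K + p) * minor (?b + 1) K - minor (?b + 1) (K + p) * minor ?b K \<in> ?A"
    by (rule minor_ratio_step[OF assms])
  have "minor ?b K * (minor a (K + p) * minor (?b + 1) K)
      - minor ?b K * (minor (?b + 1) (K + p) * minor a K) \<in> ?A"
    using NP.add[OF NP.absorb_right[OF Suc.IH, of "minor (?b + 1) K"] NP.absorb_right[OF 1, of "minor a K"]]
    by (simp add: algebra_simps)
  from N.monic_mod_cancel[OF monic_minor_pfilt this] show ?case
    by (simp add: ac_simps)
qed (simp add: NP.zero mult.commute)

text \<open>Modulo I both minors are products of linear factors. A root of one and a root of the
  other differ by an integer strictly between 0 and p in absolute value, because the windows are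
  disjoint beyond the spread of the \<open>l r\<close> and yet within one period.\<close>

lemma comaximal_minors:
  assumes p: "prime p" and l: "\<And>r. r \<in> {1..n} \<Longrightarrow> \<bar>l r\<bar> \<le> int Lm"
    and H: "K + 2 * Lm < H" "K + 2 * Lm + H < p"
  obtains u v where "u * minor 0 K + v * minor (int H) K - 1 \<in> coeffs_in (pfilt p s)"
proof -
  let ?cm = "ideal_set.comaximal (coeffs_in (pfilt p 1))"
  have lin: "?cm [:of_int a, 1:] [:of_int b, 1:]" if "0 < b - a" "b - a < int p" for a b
  proof -
    have "\<not> int p dvd b - a"
      using that zdvd_imp_le by force
    then obtain c where "of_int c * of_int (b - a) - (1 :: int tpoly) \<in> pfilt p 1"
      using coprime_inverse_pfilt[OF p] by blast
    from N.const_in[OF this]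
    have "[:- of_int c:] * [:of_int a, 1:] + [:of_int c:] * [:of_int b, 1:] - 1 \<in> coeffs_in (pfilt p 1)"
      by (simp add: one_pCons algebra_simps)
    then show ?thesis
      unfolding NP.comaximal_def by blast
  qed
  have "?cm (\<Prod>j<K. indicial (0 + int j)) (\<Prod>j<K. indicial (int H + int j))"
    unfolding indicial_def
  proof (intro NP.comaximal_prod)
    fix i r assume i: "i \<in> {..<K}" "r \<in> {1..n}"
    have "?cm [:of_int (int H + int i - l r), 1:] (\<Prod>j<K. \<Prod>r=1..n. [:of_int (0 + int j - l r), 1:])"
    proof (intro NP.comaximal_prod)
      fix j r' assume j: "j \<in> {..<K}" "r' \<in> {1..n}"
      show "?cm [:of_int (int H + int i - l r), 1:] [:of_int (0 + int j - l r'), 1:]"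
        using l[OF i(2)] l[OF j(2)] i(1) j(1) H by (intro NP.comaximal_sym[OF lin]) auto
    qed
    then show "?cm (\<Prod>j<K. \<Prod>r=1..n. [:of_int (0 + int j - l r), 1:]) [:of_int (int H + int i - l r), 1:]"
      by (rule NP.comaximal_sym)
  qed
  then have "?cm (minor 0 K) (minor (int H) K)"
    by (rule NP.comaximal_cong) (intro NP.diff_commute[OF coeffs_in_pfilt[OF minor_mod_ideal]])+
  then obtain u v where uv: "u * minor 0 K + v * minor (int H) K - 1 \<in> coeffs_in (pfilt p 1)"
    unfolding NP.comaximal_def by blast
  obtain f where "f * (u * minor 0 K + v * minor (int H) K) - 1 \<in> coeffs_in (pfilt p s)"
    using NP.unit_lift[OF uv] .
  then have "(f * u) * minor 0 K + (f * v) * minor (int H) K - 1 \<in> coeffs_in (pfilt p s)"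
    by (simp add: algebra_simps)
  then show ?thesis by (rule that)
qed

text \<open>\<open>P\<close> is the polynomial \<open>\<Pi>\<close> above. It plays the role of the determinant of the reduction of \<open>D\<close> on
  \<open>x\<^sup>\<epsilon> V / (x\<^sup>p - z)\<close> at \<open>z = 0\<close>: it is the product of the ratios of consecutive
  minors over one period.\<close>

lemma periodic_quotient:
  assumes p: "prime p" and l: "\<And>r. r \<in> {1..n} \<Longrightarrow> \<bar>l r\<bar> \<le> int Lm"
    and K: "m * s \<le> K + 1" and large: "2 * K + 4 * Lm + 1 < p"
  obtains P where "\<And>a. minor a K * P - minor a (K + p) \<in> coeffs_in (pfilt p s)"
proof -
  let ?A = "coeffs_in (pfilt p s)"
  \<comment> \<open>The least translation that \<open>comaximal_minors\<close> admits.\<close>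
  define H where "H = K + 2 * Lm + 1"
  obtain u v where uv: "u * minor 0 K + v * minor (int H) K - 1 \<in> ?A"
    using comaximal_minors[OF p l, of K H s] large by (auto simp: H_def)
  \<comment> \<open>If two fractions agree and their denominators combine to 1, the same combination
    of the numerators is their common value.\<close>
  define P where "P = u * minor 0 (K + p) + v * minor (int H) (K + p)"
  have "v * (minor 0 K * minor (int H) (K + p)) - v * (minor 0 (K + p) * minor (int H) K) \<in> ?A"
    using NP.absorb[OF NP.minus[OF minor_ratio[OF K, of 0 p H]], of v] by (simp add: algebra_simps)
  from NP.add[OF this NP.absorb_right[OF uv, of "minor 0 (K + p)"]]
  have P0: "minor 0 K * P - minor 0 (K + p) \<in> ?A"
    by (simp add: P_def algebra_simps)
  have "minor a K * P - minor a (K + p) \<in> ?A" for a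
  proof -
    have r: "minor 0 (K + p) * minor a K - minor a (K + p) * minor 0 K \<in> ?A"
    proof (cases "0 \<le> a")
      case True
      then show ?thesis using minor_ratio[OF K, of 0 p "nat a"] by simp
    next
      case False
      then show ?thesis
        using NP.minus[OF minor_ratio[OF K, of a p "nat (- a)"]] by (simp add: mult.commute)
    qed
    have "minor 0 K * (minor a K * P) - minor 0 K * minor a (K + p) \<in> ?A"
      using NP.add[OF NP.absorb_right[OF P0, of "minor a K"] r] by (simp add: algebra_simps)
    then show ?thesis
      by (rule N.monic_mod_cancel[OF monic_minor_pfilt])
  qed
  then show ?thesis by (rule that)
qed

text \<open>In Newton's formula for the step from 0 to p the binomial coefficients with
  \<open>0 < i < p\<close> are divisible by p, and the p-th difference has order \<open>s\<close> by
  the degree bound.\<close>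

lemma top_coeff_prime:
  assumes p: "prime p" and K: "m * s \<le> K + 1" and s: "1 \<le> s" "2 * (slope + 1) * (s - 1) < p"
  shows "coeff (minor 0 (K + p)) (n * (K + p)) - coeff (minor 0 K) (n * K) \<in> pfilt p s"
proof -
  have "0 < p" using p prime_gt_0_nat by blast
  let ?d = "\<lambda>i. (fdiff ^^ i) (top_coeff K 0) 0"
  have "top_coeff K 0 (0 + p) = (\<Sum>i\<le>p. of_nat (p choose i) * ?d i)"
    by (rule newton_forward)
  also have "{..p} = insert 0 {0<..p}" by auto
  finally have "top_coeff K 0 p - top_coeff K 0 0 = (\<Sum>i\<in>{0<..p}. of_nat (p choose i) * ?d i)"
    by simp
  also have "\<dots> \<in> pfilt p s"
  proof (rule N.sum)
    fix i assume i: "i \<in> {0<..p}"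
    show "of_nat (p choose i) * ?d i \<in> pfilt p s"
    proof (cases "i = p")
      case True
      have "int (2 * (slope + 1) * (s - 1)) < int p"
        using s(2) by (simp only: of_nat_less_iff)
      moreover have "int (2 * (slope + 1) * (s - 1)) = 2 * int (slope + 1) * (int s - 1)"
        unfolding of_nat_mult[of "2 * (slope + 1)"] of_nat_diff[OF s(1)] by simp
      ultimately have "2 * int (slope + 1) * (int s - 1) - 2 * 0 < int p"
        by linarith
      then have "?d p \<in> tideal_power s"
        using top_coeff_poly_like[OF K, of s 0 p 0] by simp
      then show ?thesis
        unfolding True by (intro N.absorb ideal_power_pfiltD)
    next
      case False
      then have "p dvd p choose i"
        using i p \<open>0 < p\<close> by (intro dvd_choose_prime) auto
      then obtain q where "p choose i = p * q" by (elim dvdE)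
      then have e: "of_nat (p choose i) * ?d i = of_nat p * (of_nat q * ?d i)"
        by simp
      show ?thesis
        unfolding e by (rule N.absorb_right[OF of_nat_pfilt])
    qed
  qed
  finally show ?thesis
    by (simp only: top_coeff_def add_0_right int_coeff_of_nat)
qed

text \<open>\<open>P\<close> is a combination of the powers up to \<open>n\<close> of eps^p - eps.
  The top power alone contributes to degree \<open>n\<close> and to degree \<open>n * p\<close>,
  with coefficients (-1)^n and 1, so the claim about degree \<open>n\<close> reduces to the top
  coefficients of the minors.\<close>

lemma periodic_quotient_coeffs:
  assumes p: "prime p" and P: "\<And>a. minor a K * P - minor a (K + p) \<in> coeffs_in (pfilt p s)"
    and K: "m * s \<le> K + 1" and s: "1 \<le> s" "2 * (slope + 1) * s + n + 1 \<le> p"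
  shows "coeff P n - (-1) ^ n \<in> pfilt p s"
    and "\<And>e. n < e \<Longrightarrow> e < p \<Longrightarrow> coeff P e \<in> pfilt p s"
proof -
  let ?A = "pfilt p s" and ?X = "artin_schreier p"
  have p1: "1 < p" using p prime_gt_1_nat by blast
  obtain s' where s': "s = Suc s'" using s(1) by (cases s) auto
  have sl: "slope * s + 1 < p" "slope * s' + 1 < p" "n < p"
    using s(2) slope_pos by (auto simp: s' algebra_simps)
  have weight: "coeff P e \<in> pfilt p k" if "k \<le> s" "n * p + slope * k < e + slope" for k e
  proof (rule N.monic_mod_weight[OF slope_pos monic_minor_pfilt _ _ P[of 0] that])
    fix e j assume "n * K + n * p + slope * j < e + slope"
    then show "coeff (minor 0 (K + p)) e \<in> pfilt p j"
      by (intro ideal_power_pfiltD minor_coeff_large) (simp only: distrib_left)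
  qed (rule ideal_power_pfiltD, rule minor_coeff_large)
  have shift: "pcompose P [:1, 1:] - P \<in> coeffs_in ?A"
  proof -
    have "minor 1 k = pcompose (minor 0 k) [:1, 1:]" for k
      using minor_shift[of 0 1 k] by simp
    then have "minor 1 K * pcompose P [:1, 1:] - minor 1 (K + p) \<in> coeffs_in ?A"
      using N.pcompose_mem[OF P[of 0], of "[:1, 1:]"] by (simp add: pcompose_diff pcompose_mult)
    from NP.diff[OF this P[of 1]]
    have "minor 1 K * pcompose P [:1, 1:] - minor 1 K * P \<in> coeffs_in ?A"
      by simp
    then show ?thesis
      by (rule N.monic_mod_cancel[OF monic_minor_pfilt])
  qed
  have deg: "coeff P e \<in> ?A" if "n * p + slope * s' < e" for e
    by (rule weight[OF order_refl]) (use that in \<open>simp add: s'\<close>)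
  obtain c where "P - (\<Sum>i\<le>(n * p + slope * s') div p. Polynomial.smult (c i) (?X ^ i))
      \<in> coeffs_in ?A"
    using periodic_poly[OF p shift deg] by blast
  moreover have "(n * p + slope * s') div p = n"
    using sl p1 by simp
  ultimately have c: "coeff P e - (\<Sum>i\<le>n. c i * coeff (?X ^ i) e) \<in> ?A" for e
    using coeffs_inD[of "P - (\<Sum>i\<le>n. Polynomial.smult (c i) (?X ^ i))" ?A e]
    by (simp add: coeff_sum)
  have vanish: "coeff P e \<in> ?A" if "\<And>i k. i \<le> n \<Longrightarrow> k \<le> i \<Longrightarrow> e \<noteq> i + (p - 1) * k" for e
  proof -
    have "(\<Sum>i\<le>n. c i * coeff (?X ^ i) e) = 0"
      using that by (intro sum.neutral) (simp add: artin_schreier_coeff(1)[OF p1])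
    then show ?thesis using c[of e] by simp
  qed
  have low: "i + (p - 1) * k = i \<or> p \<le> i + (p - 1) * k" if "k \<le> i" for i k
  proof (cases k)
    case (Suc k')
    then have "p - 1 \<le> (p - 1) * k" "1 \<le> i" using that by simp_all
    then show ?thesis using p1 by linarith
  qed simp
  have high: "i + (p - 1) * k = n * p \<and> i = n \<or> i + (p - 1) * k + (p - 1) \<le> n * p" if "i \<le> n" "k \<le> i" for i k
  proof (cases "i = n \<and> k = n")
    case True
    then show ?thesis using p1 by (cases p) (auto simp: algebra_simps)
  next
    case False
    then have "k + 1 \<le> n" using that by auto
    then have "(p - 1) * (k + 1) \<le> (p - 1) * n" by (rule mult_left_mono) simp
    then have "i + (p - 1) * k + (p - 1) \<le> n + (p - 1) * n"
      using that by (simp add: algebra_simps)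
    also have "n + (p - 1) * n = n * p" using p1 by (cases p) (auto simp: algebra_simps)
    finally show ?thesis by simp
  qed
  show mid: "coeff P e \<in> ?A" if "n < e" "e < p" for e
  proof (rule vanish)
    fix i k assume "i \<le> n" "k \<le> i"
    then show "e \<noteq> i + (p - 1) * k"
      using low[of k i] that by auto
  qed
  have "(\<Sum>i\<le>n. c i * coeff (?X ^ i) n) = (\<Sum>i\<le>n. if i = n then c n * (-1) ^ n else 0)"
  proof (rule sum.cong[OF refl])
    fix i assume i: "i \<in> {..n}"
    show "c i * coeff (?X ^ i) n = (if i = n then c n * (-1) ^ n else 0)"
    proof (cases "i = n")
      case False
      then have "coeff (?X ^ i) n = 0"
      proof (intro artin_schreier_coeff(1)[OF p1])
        fix k assume "k \<le> i"
        then show "n \<noteq> i + (p - 1) * k"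
          using low[of k i] sl False by auto
      qed
      with False show ?thesis by simp
    qed (simp add: artin_schreier_coeff(2)[OF p1])
  qed
  then have Pn: "coeff P n - c n * (-1) ^ n \<in> ?A"
    using c[of n] by simp
  have "(\<Sum>i\<le>n. c i * coeff (?X ^ i) (n * p)) = (\<Sum>i\<le>n. if i = n then c n else 0)"
  proof (rule sum.cong[OF refl])
    fix i assume i: "i \<in> {..n}"
    show "c i * coeff (?X ^ i) (n * p) = (if i = n then c n else 0)"
    proof (cases "i = n")
      case True
      then show ?thesis
        using artin_schreier_degree(2)[OF p1, of n] by (simp add: mult.commute)
    next
      case False
      then have "coeff (?X ^ i) (n * p) = 0"
      proof (intro artin_schreier_coeff(1)[OF p1])
        fix k assume "k \<le> i"
        then show "n * p \<noteq> i + (p - 1) * k"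
          using high[of i k] i p1 False by auto
      qed
      with False show ?thesis by simp
    qed
  qed
  then have Pnp: "coeff P (n * p) - c n \<in> ?A"
    using c[of "n * p"] by simp
  \<comment> \<open>One term of the convolution survives: from index \<open>n * K + (p - 1)\<close>
    on the minor is negligible by weight, and for every other index except \<open>n * K\<close> the
    coefficient of \<open>P\<close> falls into the gap around exponent \<open>n * p\<close>.\<close>
  have "coeff (minor 0 K * P) (n * (K + p)) - coeff (minor 0 K) (n * K) * coeff P (n * p) \<in> ?A"
  proof -
    have "coeff (minor 0 K * P) (n * (K + p)) = coeff (minor 0 K) (n * K) * coeff P (n * (K + p) - n * K)
        + (\<Sum>u\<in>{..n * (K + p)} - {n * K}. coeff (minor 0 K) u * coeff P (n * (K + p) - u))"
      unfolding coeff_mult by (subst sum.remove[of _ "n * K"]) auto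
    moreover have "n * (K + p) - n * K = n * p"
      by (simp add: distrib_left)
    moreover have "(\<Sum>u\<in>{..n * (K + p)} - {n * K}. coeff (minor 0 K) u * coeff P (n * (K + p) - u)) \<in> ?A"
    proof (rule N.sum)
      fix u assume u: "u \<in> {..n * (K + p)} - {n * K}"
      show "coeff (minor 0 K) u * coeff P (n * (K + p) - u) \<in> ?A"
      proof (cases "n * K + (p - 1) \<le> u")
        case True
        then have "coeff (minor 0 K) u \<in> ?A"
          using sl by (intro ideal_power_pfiltD minor_coeff_large) simp
        then show ?thesis by (rule N.absorb_right)
      next
        case False
        have "n * (K + p) = n * K + n * p" by (simp add: distrib_left)
        then have "n * (K + p) - u \<noteq> n * p" "n * p < n * (K + p) - u + (p - 1)"
          using False u by auto
        then have "n * (K + p) - u \<noteq> i + (p - 1) * k" if "i \<le> n" "k \<le> i" for i k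
          using high[OF that] by auto
        then show ?thesis
          by (intro N.absorb vanish)
      qed
    qed
    ultimately show ?thesis by simp
  qed
  from N.diff[OF this coeffs_inD[OF P[of 0], of "n * (K + p)"]]
  have "coeff (minor 0 (K + p)) (n * (K + p)) - coeff (minor 0 K) (n * K) * coeff P (n * p) \<in> ?A"
    by simp
  moreover have "coeff (minor 0 (K + p)) (n * (K + p)) - coeff (minor 0 K) (n * K) \<in> ?A"
  proof (rule top_coeff_prime[OF p K s(1)])
    have "2 * (slope + 1) * s' \<le> 2 * (slope + 1) * s"
      by (intro mult_left_mono) (simp_all add: s')
    then show "2 * (slope + 1) * (s - 1) < p"
      using s(2) by (simp only: s' diff_Suc_1)
  qed
  ultimately have "(coeff (minor 0 (K + p)) (n * (K + p)) - coeff (minor 0 K) (n * K))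
      - (coeff (minor 0 (K + p)) (n * (K + p)) - coeff (minor 0 K) (n * K) * coeff P (n * p)) \<in> ?A"
    by (rule N.diff[rotated])
  then have "coeff (minor 0 K) (n * K) * (coeff P (n * p) - 1) \<in> ?A"
    by (simp add: right_diff_distrib)
  moreover have "coeff (minor 0 K) (n * K) - 1 \<in> pfilt p 1"
    using monic_minor_pfilt[of p K 0] by (simp add: N.monic_mod_def)
  ultimately have "coeff P (n * p) - 1 \<in> ?A"
    by (rule N.cancel_unit[rotated])
  from N.diff_trans[OF N.diff_commute[OF Pnp] this] have "c n - 1 \<in> ?A" .
  from N.absorb[OF this, of "(-1) ^ n"] have "c n * (-1) ^ n - (-1) ^ n \<in> ?A"
    by (simp add: algebra_simps)
  from N.diff_trans[OF Pn this] show "coeff P n - (-1) ^ n \<in> ?A" .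
qed

text \<open>The window starting at \<open>a\<close> lies to the left of all \<open>l r\<close>, and its translate by \<open>p\<close> to the
  right of them, so that the minor over it is a unit at \<open>\<epsilon> = 0\<close>.\<close>

lemma window_unit:
  assumes p: "prime p" and l: "\<And>r. r \<in> {1..n} \<Longrightarrow> \<bar>l r\<bar> \<le> int Lm"
    and large: "2 * K + 4 * Lm + 1 < p" and a: "a = - int (Lm + 1 + K)"
  obtains D where "poly (minor a K) 0 - of_int D \<in> pfilt p 1" "\<not> int p dvd D"
proof -
  have "\<not> int p dvd a + int j - l r" if "j < K" "r \<in> {1..n}" for j r
  proof
    assume "int p dvd a + int j - l r"
    then have "int p dvd - (a + int j - l r)"
      by (simp only: dvd_minus_iff)
    then have "int p dvd l r - a - int j"
      by (simp add: algebra_simps)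
    moreover have "0 < l r - a - int j" "l r - a - int j < int p"
      using l[OF that(2)] that(1) large a by auto
    ultimately show False
      using zdvd_imp_le by force
  qed
  then have "\<not> int p dvd (\<Prod>j<K. \<Prod>r=1..n. a + int j - l r)"
    using p by (auto simp: prime_dvd_prod_iff)
  then show ?thesis
    by (rule that[OF poly_minor_pfilt])
qed

text \<open>At epsilon zero the window of length \<open>K + p\<close> from \<open>a\<close> splits
  at 0. Its left block, translated by p, occupies the places from \<open>v\<close> to
  \<open>p - 1\<close> and overlaps the right block in \<open>K\<close> places. The cluster relation
  turns the product of both blocks into \<open>minor 0 p\<close> times the minor over the overlap,
  which is a unit.\<close>

lemma periodic_quotient_at_0:
  assumes p: "prime p" and l: "\<And>r. r \<in> {1..n} \<Longrightarrow> \<bar>l r\<bar> \<le> int Lm"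
    and P: "\<And>a. minor a K * P - minor a (K + p) \<in> coeffs_in (pfilt p s)"
    and K: "m * s \<le> K + 1" and large: "2 * K + 4 * Lm + 1 < p"
  shows "coeff P 0 - Det_p n m l p \<in> pfilt p s"
proof -
  define q where "q = Lm + 1 + K"
  define v where "v = p - q"
  define a where "a = - int q"
  have q: "q + v = p" "K \<le> q" using large by (auto simp: q_def v_def)
  let ?A = "pfilt p s"
  let ?e = "\<lambda>a k. poly (minor a k) 0"
  have 1: "?e a K * coeff P 0 - ?e a (K + p) \<in> ?A"
    using N.poly_cong[OF P[of a], of 0] by (simp only: poly_diff poly_mult poly_0_coeff_0[of P])
  have 2: "?e a (K + p) = ?e a q * ?e 0 (K + v)"
    using minor_block[of q "K + v"] q by (simp add: a_def ac_simps)
  have cl: "minor 0 p * minor (int v) K - minor 0 (K + v) * minor (int v) q \<in> coeffs_in ?A"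
    using coeffs_in_pfilt[OF minor_cluster[OF K, of 0 v "q - K"], of p] q
    by (simp add: ac_simps)
  have 3: "?e 0 p * ?e (int v) K - ?e 0 (K + v) * ?e (int v) q \<in> ?A"
    using N.poly_cong[OF cl, of 0] by simp
  have "int v = a + int p" using q by (simp add: a_def)
  then have per: "?e (int v) k - ?e a k \<in> ?A" for k
    using N.poly_cong[OF minor_period[of a p k s], of 0] by simp
  have "?e 0 p * ?e (int v) K - ?e 0 p * ?e a K \<in> ?A"
    "?e 0 (K + v) * ?e (int v) q - ?e 0 (K + v) * ?e a q \<in> ?A"
    by (intro N.cong_mult per; simp add: N.zero)+
  from N.diff_trans[OF N.diff_trans[OF N.diff_commute[OF this(1)] 3] this(2)]
  have "?e 0 p * ?e a K - ?e 0 (K + v) * ?e a q \<in> ?A" .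
  from N.diff[OF 1 this] have 4: "?e a K * (coeff P 0 - ?e 0 p) \<in> ?A"
    unfolding 2 by (simp add: algebra_simps)
  obtain D where D: "?e a K - of_int D \<in> pfilt p 1" "\<not> int p dvd D"
    using window_unit[OF p l large a_def[unfolded q_def]] .
  obtain c where c: "of_int c * of_int D - (1 :: int tpoly) \<in> pfilt p 1"
    using coprime_inverse_pfilt[OF p D(2)] .
  have "of_int c * ?e a K - of_int c * of_int D \<in> pfilt p 1"
    by (intro N.cong_mult D(1)) (simp add: N.zero)
  from N.diff_trans[OF this c] have "of_int c * ?e a K - 1 \<in> pfilt p 1" .
  moreover have "of_int c * ?e a K * (coeff P 0 - ?e 0 p) \<in> ?A"
    using N.absorb[OF 4, of "of_int c"] by (simp add: mult.assoc)
  ultimately show ?thesis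
    unfolding Det_p_eq by (rule N.cancel_unit)
qed

text \<open>Modulo p and I the longer minor has a zero of order \<open>n\<close> at epsilon zero,
  while \<open>minor a K\<close> is invertible there, so the zero passes to
  \<open>P\<close>.\<close>

lemma periodic_quotient_low:
  assumes p: "prime p" and l: "\<And>r. r \<in> {1..n} \<Longrightarrow> \<bar>l r\<bar> \<le> int Lm"
    and P: "\<And>a. minor a K * P - minor a (K + p) \<in> coeffs_in (pfilt p s)"
    and s: "1 \<le> s" and large: "2 * K + 4 * Lm + 1 < p"
  shows "i < n \<Longrightarrow> coeff P i \<in> pfilt p 1"
proof (induction i rule: less_induct)
  case (less i)
  define a where "a = - int (Lm + 1 + K)"
  have "coeff (minor a (K + p)) i \<in> pfilt p 1"
  proof (intro ideal_power_pfiltD minor_coeff_small(1))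
    show "a \<le> l r \<and> l r < a + int (K + p)" if "r \<in> {1..n}" for r
      using l[OF that] large by (auto simp: a_def)
  qed (use less.prems in simp)
  moreover have "coeff (minor a K * P - minor a (K + p)) i \<in> pfilt p 1"
    using N.antimonoD[OF coeffs_inD[OF P[of a]] s] .
  ultimately have "coeff (minor a K * P) i \<in> pfilt p 1"
    using N.cong_mem[of "coeff (minor a K * P) i" "coeff (minor a (K + p)) i"] by simp
  moreover have "coeff (minor a K * P) i = coeff (minor a K) 0 * coeff P i
      + (\<Sum>j\<in>{..i} - {0}. coeff (minor a K) j * coeff P (i - j))"
    unfolding coeff_mult by (subst sum.remove[of _ 0]) auto
  moreover have "(\<Sum>j\<in>{..i} - {0}. coeff (minor a K) j * coeff P (i - j)) \<in> pfilt p 1"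
    using less by (intro N.sum N.absorb) auto
  ultimately have "coeff (minor a K) 0 * coeff P i \<in> pfilt p 1"
    using N.diff by (metis (no_types, lifting) add_diff_cancel_right')
  then have e: "poly (minor a K) 0 * coeff P i \<in> pfilt p 1"
    by (simp only: poly_0_coeff_0)
  obtain D where D: "poly (minor a K) 0 - of_int D \<in> pfilt p 1" "\<not> int p dvd D"
    using window_unit[OF p l large a_def] .
  have "poly (minor a K) 0 * coeff P i - (poly (minor a K) 0 - of_int D) * coeff P i \<in> pfilt p 1"
    by (rule N.diff[OF e N.absorb_right[OF D(1)]])
  then have "of_int D * coeff P i \<in> pfilt p 1"
    by (simp add: algebra_simps)
  then show ?case
    by (rule pfilt_cancel_coprime[OF p D(2)])
qed

end

section \<open>The completed ring\<close>

abbreviation (input) lookup :: "('a \<Rightarrow>\<^sub>0 'b::zero) \<Rightarrow> 'a \<Rightarrow> 'b" where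
  "lookup \<equiv> Poly_Mapping.lookup"

abbreviation (input) single :: "'a \<Rightarrow> 'b \<Rightarrow> 'a \<Rightarrow>\<^sub>0 'b::zero" where
  "single \<equiv> Poly_Mapping.single"

abbreviation (input) keys :: "('a \<Rightarrow>\<^sub>0 'b::zero) \<Rightarrow> 'a set" where
  "keys \<equiv> Poly_Mapping.keys"

lemma tpoly_sum_single: "f = (\<Sum>\<mu>\<in>keys f. single \<mu> (lookup f \<mu>))"
  by (rule poly_mapping_eqI) (auto simp: lookup_sum lookup_single when_def in_keys_iff)

lemma lookup_rat_tpoly: "lookup (rat_tpoly f) \<mu> = of_int (lookup f \<mu>)"
  by (simp add: rat_tpoly_def map.rep_eq when_def)

lemma rat_tpoly_add: "rat_tpoly (f + g) = rat_tpoly f + rat_tpoly g"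
  by (rule poly_mapping_eqI) (simp add: lookup_rat_tpoly lookup_add)

lemma rat_tpoly_sum: "rat_tpoly (sum f S) = (\<Sum>i\<in>S. rat_tpoly (f i))"
  by (rule poly_mapping_eqI) (simp add: lookup_rat_tpoly lookup_sum)

lemma rat_tpoly_single: "rat_tpoly (single \<mu> c) = single \<mu> (of_int c)"
  by (rule poly_mapping_eqI) (simp add: lookup_rat_tpoly lookup_single when_def)

lemma rat_tpoly_1: "rat_tpoly 1 = 1"
  by (simp only: single_one[symmetric] rat_tpoly_single of_int_1)

lemma rat_tpoly_mult: "rat_tpoly (f * g) = rat_tpoly f * rat_tpoly g"
proof -
  let ?s = "\<lambda>f \<mu>. single \<mu> (lookup f \<mu>)"
  have "rat_tpoly ((\<Sum>\<mu>\<in>keys f. ?s f \<mu>) * (\<Sum>\<nu>\<in>keys g. ?s g \<nu>))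
      = rat_tpoly (\<Sum>\<mu>\<in>keys f. ?s f \<mu>) * rat_tpoly (\<Sum>\<nu>\<in>keys g. ?s g \<nu>)"
    by (simp add: sum_product rat_tpoly_sum mult_single rat_tpoly_single)
  then show ?thesis
    by (simp only: tpoly_sum_single[symmetric])
qed

lemma of_tpoly_add: "of_tpoly (f + g) = of_tpoly f + of_tpoly g"
  by transfer (simp add: rat_tpoly_add lim_rel_def compatible_const tideal_rat_0)

lemma of_tpoly_mult: "of_tpoly (f * g) = of_tpoly f * of_tpoly g"
  by transfer (simp add: rat_tpoly_mult lim_rel_def compatible_const tideal_rat_0)

lemma of_tpoly_1: "of_tpoly 1 = 1"
  by transfer (simp add: rat_tpoly_1 lim_rel_def compatible_const tideal_rat_0)

interpretation of_tpoly: comm_ring_hom of_tpoly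
proof
  show "of_tpoly 0 = 0"
    using of_tpoly_add[of 0 0] by simp
qed (rule of_tpoly_add of_tpoly_mult of_tpoly_1)+

lemma tideal_rat_times: "x \<in> tideal_rat j \<Longrightarrow> y \<in> tideal_rat k \<Longrightarrow> x * y \<in> tideal_rat (j + k)"
  unfolding tideal_rat_def
proof (rule ideal_gen_times)
  fix u v assume "u \<in> rat_tpoly ` tideal_power j" "v \<in> rat_tpoly ` tideal_power k"
  then obtain f g where "u * v = rat_tpoly (f * g)" "f * g \<in> tideal_power (j + k)"
    using R.I_mult by (auto simp: rat_tpoly_mult)
  then show "u * v \<in> ideal_gen (rat_tpoly ` tideal_power (j + k))"
    by (auto intro: ideal_gen_base)
qed

lemma tideal_rat_0_UNIV: "tideal_rat 0 = UNIV"
proof -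
  have "rat_tpoly 1 \<in> tideal_rat 0"
    unfolding tideal_rat_def by (intro ideal_gen_base imageI) (simp add: ideal_power_0)
  from tideal_rat_mult[OF this] have "x \<in> tideal_rat 0" for x
    by (simp add: rat_tpoly_1)
  then show ?thesis by blast
qed

lemma level_ker_absorb: "b \<in> level_ker k \<Longrightarrow> a * b \<in> level_ker k"
  unfolding level_ker_def mem_Collect_eq by transfer (simp add: tideal_rat_mult)

lemma level_ker_times:
  assumes "a \<in> level_ker j" "b \<in> level_ker k"
  shows "a * b \<in> level_ker (j + k)"
  using assms unfolding level_ker_def mem_Collect_eq
proof (transfer fixing: j k)
  fix a b assume "lim_rel a a" "lim_rel b b" and ab: "a j \<in> tideal_rat j" "b k \<in> tideal_rat k"
  then have "a (j + k) - a j \<in> tideal_rat j" "b (j + k) - b k \<in> tideal_rat k"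
    by (auto simp: lim_rel_def intro: compatible_le)
  from tideal_rat_add[OF this(1) ab(1)] tideal_rat_add[OF this(2) ab(2)]
  show "a (j + k) * b (j + k) \<in> tideal_rat (j + k)"
    by (simp add: tideal_rat_times)
qed

lemma level_ker_0_UNIV: "level_ker 0 = UNIV"
proof -
  have "in_level_ker 0 a" for a
    by transfer (simp add: tideal_rat_0_UNIV)
  then show ?thesis by (simp add: level_ker_def)
qed

interpretation J: filtration level_ker
proof
  show "level_ker (Suc k) \<subseteq> level_ker k" for k
    by (rule level_ker_antimono) simp
qed (auto intro: level_ker_0 level_ker_add level_ker_absorb level_ker_times simp: level_ker_0_UNIV)

section \<open>Completeness and units of the ring S\<close>

lemma of_tpoly_level_ker: "f \<in> tideal_power k \<Longrightarrow> of_tpoly f \<in> level_ker k"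
  unfolding level_ker_def mem_Collect_eq
  by transfer (auto simp: tideal_rat_def intro: ideal_gen_base)

text \<open>The limit is presented by the diagonal of the representatives of the
  \<open>a k\<close>.\<close>

lemma level_ker_complete:
  assumes "\<And>k. a (Suc k) - a k \<in> level_ker k"
  obtains x where "\<And>k. x - a k \<in> level_ker k"
proof -
  define r where "r k = rep_compl_ring (a k)" for k
  have r: "lim_rel (r k) (r k)" "abs_compl_ring (r k) = a k" for k
    using Quotient_rep_reflp[OF Quotient_compl_ring] Quotient_abs_rep[OF Quotient_compl_ring]
    by (simp_all add: r_def)
  have in_level: "b - c \<in> level_ker k \<longleftrightarrow> f k - g k \<in> tideal_rat k"
    if "lim_rel f f" "lim_rel g g" "abs_compl_ring f = b" "abs_compl_ring g = c" for b c f g k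
  proof -
    have "b - c = abs_compl_ring (\<lambda>k. f k + - g k)"
      using that plus_compl_ring.abs_eq[of f "\<lambda>k. - g k"] uminus_compl_ring.abs_eq[of g]
      by (simp add: minus_compl_ring_def lim_rel_def compatible_minus tideal_rat_0)
    moreover have "lim_rel (\<lambda>k. f k + - g k) (\<lambda>k. f k + - g k)"
      using that compatible_add[OF _ compatible_minus, of f g] by (simp add: lim_rel_def tideal_rat_0)
    ultimately show ?thesis
      by (simp add: level_ker_def in_level_ker.abs_eq)
  qed
  define b where "b k = r k k" for k
  have "b (Suc k) - b k \<in> tideal_rat k" for k
  proof -
    have "r (Suc k) k - r k k \<in> tideal_rat k"
      using assms[of k] in_level r by blast
    moreover have "r (Suc k) (Suc k) - r (Suc k) k \<in> tideal_rat k"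
      using r(1)[of "Suc k"] by (simp add: lim_rel_def compatible_seq_def)
    ultimately show ?thesis
      using tideal_rat_add by (fastforce simp: b_def)
  qed
  then have b: "lim_rel b b"
    by (simp add: lim_rel_def compatible_seq_def tideal_rat_0)
  have "abs_compl_ring b - a k \<in> level_ker k" for k
    using in_level[OF b r(1) refl r(2)] by (simp add: b_def tideal_rat_0)
  then show ?thesis by (rule that)
qed

lemma of_int_dvd_1:
  assumes "D \<noteq> 0"
  shows "(of_int D :: compl_ring) dvd 1"
proof -
  have e: "of_int D = of_tpoly (single 0 D)"
    using of_tpoly.hom_of_int[of D] single_of_int[where ?'b = int, of D, where ?'a = "(nat \<times> nat) \<Rightarrow>\<^sub>0 nat"]
    by simp
  have c: "lim_rel (\<lambda>_. f) (\<lambda>_. f)" for f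
    by (simp add: lim_rel_def compatible_const tideal_rat_0)
  have "rat_tpoly (single 0 D) * single 0 (1 / of_int D) = 1"
    by (simp only: rat_tpoly_single mult_single) (simp add: assms)
  then have "of_tpoly (single 0 D) * abs_compl_ring (\<lambda>_. single 0 (1 / of_int D)) = 1"
    by (simp only: of_tpoly_def map_fun_def o_def id_apply times_compl_ring.abs_eq[OF c c] one_compl_ring_def)
  then show ?thesis
    unfolding e by (metis dvd_triv_left)
qed

lemma fps_dvd_1: "fps_nth F 0 dvd 1 \<Longrightarrow> F dvd 1" for F :: "'a::comm_ring_1 fps"
  by (metis dvd_def fps_right_inverse)

text \<open>Banach's fixed point argument for the coefficientwise topology: the iterates from 0
  stabilize at every level, and completeness of S supplies each coefficient of the limit.\<close>

lemma compl_ring_contraction: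
  fixes T :: "compl_ring fps \<Rightarrow> compl_ring fps"
  assumes T: "\<And>x y k i. (\<And>i. fps_nth (x - y) i \<in> level_ker k) \<Longrightarrow> fps_nth (T x - T y) i \<in> level_ker (Suc k)"
  obtains x where "T x = x"
proof -
  define a where "a k = (T ^^ k) 0" for k
  have step: "fps_nth (a (Suc k)) i - fps_nth (a k) i \<in> level_ker k" for k i
  proof (induction k arbitrary: i)
    case (Suc k)
    then show ?case using T[of "a (Suc k)" "a k" k i] by (simp add: a_def)
  qed (simp add: level_ker_0_UNIV)
  have "\<exists>x. \<forall>k. x - fps_nth (a k) i \<in> level_ker k" for i
    using level_ker_complete[of "\<lambda>k. fps_nth (a k) i"] step by metis
  then obtain f where f: "f i - fps_nth (a k) i \<in> level_ker k" for i k
    by metis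
  define x where "x = Abs_fps f"
  have "fps_nth (T x - x) i \<in> level_ker k" for i k
  proof -
    have "fps_nth (T x - T (a k)) i \<in> level_ker (Suc k)"
      by (rule T) (simp add: x_def f)
    then have "fps_nth (T x) i - fps_nth (a (Suc k)) i \<in> level_ker k"
      using J.I_Suc by (auto simp: a_def)
    moreover have "fps_nth (a (Suc k)) i - fps_nth x i \<in> level_ker k"
      using J.diff_commute[OF f[of i "Suc k"]] J.I_Suc by (auto simp: x_def)
    ultimately show ?thesis
      using J.diff_trans by fastforce
  qed
  then have "fps_nth (T x - x) i = 0" for i
    by (intro level_ker_separated)
  then show ?thesis
    by (intro that[of x] fps_ext) simp
qed

lemma fps_mult_coeff_mem:
  "(\<And>i. fps_nth G i \<in> level_ker k) \<Longrightarrow> fps_nth (F * G) i \<in> level_ker k"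
  by (auto simp: fps_mult_nth intro: J.sum J.absorb)

lemma fps_mult_coeff_mem_mult:
  "(\<And>i. fps_nth F i \<in> level_ker j) \<Longrightarrow> (\<And>i. fps_nth G i \<in> level_ker k) \<Longrightarrow>
    fps_nth (F * G) i \<in> level_ker (j + k)"
  by (auto simp: fps_mult_nth intro: J.sum J.I_mult)

text \<open>Nonzero integers are invertible in S, which reduces the claim to 1 - h with
  \<open>h\<close> in \<open>level_ker 1\<close>. The geometric series arises as the constant
  coefficient of a fixed point of 1 + h x.\<close>

lemma compl_ring_unit:
  assumes "u - of_int D \<in> level_ker 1" "D \<noteq> 0"
  shows "u dvd (1 :: compl_ring)"
proof -
  obtain d where d: "of_int D * d = (1 :: compl_ring)"
    using of_int_dvd_1[OF assms(2)] by (metis dvdE)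
  define h where "h = 1 - d * u"
  have "d * (of_int D - u) \<in> level_ker 1"
    using J.diff_commute[OF assms(1)] by (rule J.absorb)
  then have h: "h \<in> level_ker 1"
    using d by (simp add: h_def algebra_simps)
  obtain x :: "compl_ring fps" where x: "1 + fps_const h * x = x"
  proof (rule compl_ring_contraction)
    fix x y :: "compl_ring fps" and k i
    assume "\<And>i. fps_nth (x - y) i \<in> level_ker k"
    from J.I_mult[OF h this[of i]]
    show "fps_nth ((1 + fps_const h * x) - (1 + fps_const h * y)) i \<in> level_ker (Suc k)"
      by (simp add: algebra_simps plus_1_eq_Suc)
  qed
  have "fps_nth (1 + fps_const h * x) 0 = fps_nth x 0"
    by (simp only: x)
  then have "u * (d * fps_nth x 0) = 1"
    by (simp add: h_def algebra_simps)
  then show ?thesis by (metis dvd_triv_left)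
qed

section \<open>Weierstrass polynomials\<close>

text \<open>With F = P + X^n u, \<open>u\<close> a unit with inverse \<open>v\<close> and
  \<open>P\<close> small, a multiplier v Z is sought for which the coefficients of F v Z from degree
  \<open>n\<close> on are 1, 0, 0 and so on. This is the equation for \<open>Z\<close> below, whose
  right side is a contraction.\<close>

lemma weierstrass_exists:
  fixes F :: "compl_ring fps"
  assumes low: "\<And>i. i < n \<Longrightarrow> fps_nth F i \<in> level_ker 1"
    and D: "fps_nth F n - of_int D \<in> level_ker 1" "D \<noteq> 0"
  obtains W where "is_weierstrass_poly n F W"
proof -
  define P where "P = fps_cutoff n F"
  define u where "u = fps_shift n F"
  have F: "F = P + fps_X ^ n * u"
    using fps_shift_cutoff'[of n F] by (simp add: P_def u_def add.commute)
  have "fps_nth u 0 dvd 1"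
    using compl_ring_unit[OF D] by (simp add: u_def)
  then obtain v where v: "u * v = 1"
    using fps_dvd_1 by (metis dvdE)
  have P: "fps_nth P i \<in> level_ker 1" for i
    using low by (simp add: P_def J.zero)
  obtain Z where Z: "1 - fps_shift n (P * v * Z) = Z"
  proof (rule compl_ring_contraction)
    fix x y :: "compl_ring fps" and k i
    assume "\<And>i. fps_nth (x - y) i \<in> level_ker k"
    then have "fps_nth (P * (v * (y - x))) (i + n) \<in> level_ker (1 + k)"
      by (intro fps_mult_coeff_mem_mult fps_mult_coeff_mem P) (metis J.diff_commute fps_sub_nth)
    then show "fps_nth ((1 - fps_shift n (P * v * x)) - (1 - fps_shift n (P * v * y))) i \<in> level_ker (Suc k)"
      by (simp add: algebra_simps plus_1_eq_Suc)
  qed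
  define G where "G = F * (v * Z)"
  have PvZ: "fps_nth (P * v * Z) i \<in> level_ker 1" for i
    using fps_mult_coeff_mem[of P 1 "v * Z" i] P by (simp add: mult_ac)
  have G: "G = P * v * Z + fps_X ^ n * Z"
  proof -
    have "G = P * v * Z + fps_X ^ n * (u * v) * Z"
      unfolding G_def by (subst F) (simp add: algebra_simps)
    then show ?thesis by (simp add: v)
  qed
  have G_high: "fps_nth G (i + n) = fps_nth 1 i" for i
  proof -
    have "fps_nth Z i = fps_nth (1 - fps_shift n (P * v * Z)) i"
      by (simp only: Z)
    then show ?thesis
      unfolding G by (simp add: fps_X_power_mult_nth)
  qed
  have G_low: "fps_nth G i \<in> level_ker 1" if "i < n" for i
    unfolding G using PvZ[of i] that by (simp add: fps_X_power_mult_nth)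
  have G_coeff: "fps_nth G i = (if i = n then 1 else 0)" if "n \<le> i" for i
    using G_high[of "i - n"] that by (auto simp: One_nat_def)
  define W where "W = (\<Sum>i\<le>n. monom (fps_nth G i) i)"
  have W_coeff: "coeff W i = fps_nth G i" for i
    using G_coeff[of i] by (auto simp: W_def coeff_sum)
  have W: "degree W = n" "lead_coeff W = 1"
  proof -
    show "degree W = n"
    proof (rule antisym)
      show "degree W \<le> n"
        by (rule degree_le) (simp add: W_coeff G_coeff)
      show "n \<le> degree W"
        by (rule le_degree) (simp add: W_coeff G_coeff)
    qed
    then show "lead_coeff W = 1"
      by (simp add: W_coeff G_coeff)
  qed
  have "fps_nth Z 0 - of_int 1 \<in> level_ker 1"
  proof -
    have "fps_nth Z 0 = fps_nth (1 - fps_shift n (P * v * Z)) 0"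
      by (simp only: Z)
    then show ?thesis
      using J.minus[OF PvZ[of n]] by simp
  qed
  then have "Z dvd 1"
    by (intro fps_dvd_1) (rule compl_ring_unit[of _ 1], simp_all)
  then obtain Z' where Z': "Z * Z' = 1" by (metis dvdE)
  have "F = fps_of_poly W * (u * Z')"
  proof -
    have "fps_of_poly W = G"
      by (rule fps_ext) (simp add: W_coeff)
    then have "fps_of_poly W * (u * Z') = F * ((u * v) * (Z * Z'))"
      by (simp add: G_def mult_ac)
    then show ?thesis by (simp add: v Z')
  qed
  moreover have "u * Z' dvd 1"
  proof -
    have "(u * Z') * (v * Z) = (u * v) * (Z * Z')" by (simp only: mult_ac)
    then show ?thesis using v Z' by (metis dvd_triv_left mult_1)
  qed
  ultimately have "is_weierstrass_poly n F W"
    using W G_low W_coeff by (auto simp: is_weierstrass_poly_def)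
  then show ?thesis by (rule that)
qed

text \<open>After division by units, W - W' agrees with W' H up to level \<open>s\<close>. The left
  side has no terms from degree \<open>n\<close> on, which forces \<open>H\<close> into
  \<open>level_ker s\<close>. For equal series this is uniqueness, in general it is stability of the
  factorization.\<close>

lemma weierstrass_congruent:
  assumes W: "is_weierstrass_poly n F W" "is_weierstrass_poly n F' W'"
    and u: "u dvd 1" "u' dvd 1" and F: "\<And>i. fps_nth (F * u - F' * u') i \<in> level_ker s"
  shows "coeff W i - coeff W' i \<in> level_ker s"
proof -
  obtain Q Q' where Q: "Q dvd 1" "F = fps_of_poly W * Q" "F' = fps_of_poly W' * Q'"
    using W unfolding is_weierstrass_poly_def by blast
  obtain v where v: "(Q * u) * v = 1"
    using Q(1) u(1) by (metis dvdE mult_dvd_mono mult_1)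
  define H where "H = Q' * u' * v - 1"
  have "(F * u - F' * u') * v = fps_of_poly W * (Q * u * v) - fps_of_poly W' * (Q' * u' * v)"
    unfolding Q by (simp add: algebra_simps)
  also have "\<dots> = fps_of_poly W - fps_of_poly W' - fps_of_poly W' * H"
    unfolding v by (simp add: H_def algebra_simps)
  finally have "fps_nth (fps_of_poly W - fps_of_poly W' - fps_of_poly W' * H) i \<in> level_ker s" for i
    using fps_mult_coeff_mem[of "F * u - F' * u'" s v i] F by (simp add: mult.commute)
  then have e: "(coeff W i - coeff W' i) - fps_nth (fps_of_poly W' * H) i \<in> level_ker s" for i
    by simp
  have W_high: "coeff W i = coeff W' i" if "n \<le> i" for i
    using W that unfolding is_weierstrass_poly_def by (cases "i = n") (auto simp: coeff_eq_0)
  have conv: "(\<Sum>j\<le>i. coeff W' j * fps_nth H (i - j)) \<in> level_ker s" if "n \<le> i" for i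
    using J.minus[OF e[of i]] W_high[OF that] by (simp add: fps_mult_nth atLeast0AtMost)
  have H: "fps_nth H i \<in> level_ker s" for i
  \<comment> \<open>No coefficient is out of control here, so the bound is chosen just large enough
    for the given \<open>i\<close>.\<close>
  proof (rule weierstrass_truncated[of level_ker n "coeff W'" s "i + n * s + 1" _ s i])
    show "(coeff W' n - 1) * x \<in> level_ker s" for x
      using W(2) by (auto simp: is_weierstrass_poly_def J.zero)
    show "coeff W' j * x \<in> level_ker s" if "n < j" for j x
      using W(2) that by (auto simp: is_weierstrass_poly_def J.zero coeff_eq_0)
    show "coeff W' j * x \<in> level_ker (Suc k)" if "j < n" "x \<in> level_ker k" for j x k
      using W(2) that J.I_mult[of "coeff W' j" 1 x k] by (auto simp: is_weierstrass_poly_def plus_1_eq_Suc)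
  qed (use conv in \<open>auto intro: J.zero J.diff J.antimonoD simp: level_ker_0_UNIV\<close>)
  show ?thesis
    using J.add[OF e[of i] fps_mult_coeff_mem[OF H, of "fps_of_poly W'" i]] by simp
qed

lemma weierstrass_poly_is:
  assumes "is_weierstrass_poly n F W"
  shows "is_weierstrass_poly n F (weierstrass_poly n F)"
  unfolding weierstrass_poly_def
proof (rule theI)
  fix W' assume "is_weierstrass_poly n F W'"
  then have "coeff W' i - coeff W i \<in> level_ker s" for i s
    using assms by (rule weierstrass_congruent[of _ _ _ _ _ 1 1]) (simp_all add: J.zero)
  then have "coeff W' i - coeff W i = 0" for i
    by (rule level_ker_separated)
  then show "W' = W"
    by (intro poly_eqI) simp
qed (rule assms)

definition lift_poly :: "int tpoly poly \<Rightarrow> compl_ring fps" where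
  "lift_poly P = fps_of_poly (map_poly of_tpoly P)"

lemma lift_poly_nth [simp]: "fps_nth (lift_poly P) i = of_tpoly (coeff P i)"
  by (simp add: lift_poly_def coeff_map_poly)

lemma lift_poly_mult: "lift_poly (P * Q) = lift_poly P * lift_poly Q"
  by (rule fps_ext)
    (simp add: coeff_mult fps_mult_nth of_tpoly.hom_sum of_tpoly.hom_mult atLeast0AtMost)

lemma lift_poly_diff_mem:
  "P - Q \<in> coeffs_in (tideal_power s) \<Longrightarrow> fps_nth (lift_poly P - lift_poly Q) i \<in> level_ker s"
  using of_tpoly_level_ker[of "coeff P i - coeff Q i" s] coeffs_inD[of "P - Q" _ i]
  by (simp add: of_tpoly.hom_minus)

section \<open>Integrality at a prime\<close>

text \<open>With \<open>A = UNIV\<close> this is p-integrality up to level \<open>s\<close>; with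
  \<open>A = pfilt p s\<close> it says that, in addition, the reduction modulo p vanishes.\<close>

definition localized :: "nat \<Rightarrow> nat \<Rightarrow> int tpoly set \<Rightarrow> compl_ring set" where
  "localized p s A = {a. \<exists>q f. coprime q (int p) \<and> f \<in> A \<and> of_int q * a - of_tpoly f \<in> level_ker s}"

lemma localizedI:
  "coprime q (int p) \<Longrightarrow> f \<in> A \<Longrightarrow> of_int q * a - of_tpoly f \<in> level_ker s \<Longrightarrow> a \<in> localized p s A"
  unfolding localized_def by blast

lemma localizedE:
  assumes "a \<in> localized p s A"
  obtains q f where "coprime q (int p)" "f \<in> A" "of_int q * a - of_tpoly f \<in> level_ker s"
  using assms unfolding localized_def by blast

lemma localized_of_tpoly: "f \<in> A \<Longrightarrow> of_tpoly f \<in> localized p s A"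
  by (rule localizedI[of 1 p f]) (simp_all add: J.zero)

lemma localized_level_ker: "0 \<in> A \<Longrightarrow> a \<in> level_ker s \<Longrightarrow> a \<in> localized p s A"
  by (rule localizedI[of 1 _ 0]) simp_all

lemma localized_mono: "a \<in> localized p s A \<Longrightarrow> A \<subseteq> B \<Longrightarrow> s' \<le> s \<Longrightarrow> a \<in> localized p s' B"
  unfolding localized_def using level_ker_antimono by blast

text \<open>Numerators of \<open>a\<close> in the \<open>j\<close>-th power of I push an error of
  \<open>b\<close> from level \<open>s'\<close> to level \<open>s' + j\<close>. In this way
  integrality gains one level per step in \<open>localized_cofactor\<close>.\<close>

lemma localized_mult_gen:
  assumes "a \<in> localized p s A" "b \<in> localized p s' B" "\<And>f g. f \<in> A \<Longrightarrow> g \<in> B \<Longrightarrow> f * g \<in> C"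
    and "A \<subseteq> tideal_power j" "j \<le> s" "s'' \<le> s" "s'' \<le> s' + j"
  shows "a * b \<in> localized p s'' C"
proof -
  obtain q f where q: "coprime q (int p)" "f \<in> A" "of_int q * a - of_tpoly f \<in> level_ker s"
    using assms(1) by (rule localizedE)
  obtain r g where r: "coprime r (int p)" "g \<in> B" "of_int r * b - of_tpoly g \<in> level_ker s'"
    using assms(2) by (rule localizedE)
  have "of_tpoly f \<in> level_ker j"
    using assms(4) q(2) by (intro of_tpoly_level_ker) blast
  from J.I_mult_le[OF r(3) this assms(7)]
  have 1: "(of_int r * b - of_tpoly g) * of_tpoly f \<in> level_ker s''" .
  have 2: "(of_int q * a - of_tpoly f) * (of_int r * b) \<in> level_ker s''"
    using J.absorb_right[OF q(3)] assms(6) by (rule J.antimonoD)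
  have "of_int (q * r) * (a * b) - of_tpoly (f * g) =
      (of_int q * a - of_tpoly f) * (of_int r * b) + (of_int r * b - of_tpoly g) * of_tpoly f"
    by (simp add: of_tpoly.hom_mult algebra_simps)
  then have "of_int (q * r) * (a * b) - of_tpoly (f * g) \<in> level_ker s''"
    using J.add[OF 2 1] by simp
  moreover have "coprime (q * r) (int p)"
    using q(1) r(1) by simp
  ultimately show ?thesis
    using assms(3)[OF q(2) r(2)] by (intro localizedI)
qed

lemma localized_mult:
  assumes "a \<in> localized p s A" "b \<in> localized p s B" "\<And>f g. f \<in> A \<Longrightarrow> g \<in> B \<Longrightarrow> f * g \<in> C"
  shows "a * b \<in> localized p s C"
  by (rule localized_mult_gen[OF assms, of 0]) (simp_all add: ideal_power_0)

lemma localized_diff: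
  assumes A: "ideal_set A" and "a \<in> localized p s A" "b \<in> localized p s A"
  shows "a - b \<in> localized p s A"
proof -
  interpret ideal_set A by (rule A)
  obtain q f where q: "coprime q (int p)" "f \<in> A" "of_int q * a - of_tpoly f \<in> level_ker s"
    using assms(2) by (rule localizedE)
  obtain r g where r: "coprime r (int p)" "g \<in> A" "of_int r * b - of_tpoly g \<in> level_ker s"
    using assms(3) by (rule localizedE)
  have "of_int r * (of_int q * a - of_tpoly f) - of_int q * (of_int r * b - of_tpoly g) \<in> level_ker s"
    by (intro J.diff J.absorb q(3) r(3))
  then have "of_int (q * r) * (a - b) - of_tpoly (of_int r * f - of_int q * g) \<in> level_ker s"
    by (simp add: of_tpoly.hom_mult of_tpoly.hom_minus of_tpoly.hom_of_int algebra_simps)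
  moreover have "coprime (q * r) (int p)"
    using q(1) r(1) by simp
  moreover have "of_int r * f - of_int q * g \<in> A"
    by (intro diff absorb q(2) r(2))
  ultimately show ?thesis
    by (intro localizedI)
qed

lemma localized_0: "ideal_set A \<Longrightarrow> 0 \<in> localized p s A"
  by (intro localized_level_ker ideal_set.zero J.zero)

lemma localized_add:
  assumes A: "ideal_set A" "a \<in> localized p s A" "b \<in> localized p s A"
  shows "a + b \<in> localized p s A"
  using localized_diff[OF A(1,2) localized_diff[OF A(1) localized_0[OF A(1)] A(3)]] by simp

lemma localized_sum:
  "ideal_set A \<Longrightarrow> (\<And>i. i \<in> S \<Longrightarrow> f i \<in> localized p s A) \<Longrightarrow> sum f S \<in> localized p s A"
  by (induction S rule: infinite_finite_induct) (auto intro: localized_0 localized_add)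

lemma localized_cancel:
  assumes "coprime D (int p)" "of_int D * a \<in> localized p s A"
  shows "a \<in> localized p s A"
proof -
  obtain q f where q: "coprime q (int p)" "f \<in> A" "of_int q * (of_int D * a) - of_tpoly f \<in> level_ker s"
    using assms(2) by (rule localizedE)
  then show ?thesis
    using assms(1) by (intro localizedI[of "q * D" p f]) (simp_all add: mult.assoc)
qed

lemma reduces_to_iff: "reduces_to p s a d \<longleftrightarrow> a - of_tpoly d \<in> localized p s (pfilt p s)"
proof
  assume "reduces_to p s a d"
  then obtain f q g h where q: "coprime q (int p)" "of_int q * a - of_tpoly f \<in> level_ker s"
    "h \<in> tideal_power s" "f - of_int q * d = of_nat p * g + h"
    unfolding reduces_to_def by blast
  have "f - of_int q * d \<in> pfilt p s"
    unfolding pfilt_def using q(3,4) by blast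
  moreover have "of_int q * (a - of_tpoly d) - of_tpoly (f - of_int q * d) \<in> level_ker s"
    using q(2) by (simp add: of_tpoly.hom_mult of_tpoly.hom_minus of_tpoly.hom_of_int algebra_simps)
  ultimately show "a - of_tpoly d \<in> localized p s (pfilt p s)"
    using q(1) by (intro localizedI)
next
  assume "a - of_tpoly d \<in> localized p s (pfilt p s)"
  then obtain q f where q: "coprime q (int p)" "f \<in> pfilt p s"
    "of_int q * (a - of_tpoly d) - of_tpoly f \<in> level_ker s"
    by (rule localizedE)
  obtain g h where "f = of_nat p * g + h" "h \<in> tideal_power s"
    using q(2) unfolding pfilt_def by blast
  moreover have "of_int q * a - of_tpoly (f + of_int q * d) \<in> level_ker s"
    using q(3) by (simp add: of_tpoly.hom_mult of_tpoly.hom_add of_tpoly.hom_of_int algebra_simps)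
  ultimately show "reduces_to p s a d"
    unfolding reduces_to_def using q(1)
    by (intro exI[of _ "f + of_int q * d"] exI[of _ q] conjI exI[of _ g] bexI[of _ h]) simp_all
qed

text \<open>If \<open>F V\<close> is a monic polynomial, then \<open>V\<close> inherits the integrality of \<open>F\<close>: the coefficient
  of \<open>\<epsilon>\<^sup>n\<^sup>+\<^sup>i\<close> determines the \<open>i\<close>-th coefficient of \<open>V\<close> up to terms which involve earlier
  coefficients of \<open>V\<close>, or a factor in the ideal.\<close>

lemma localized_cofactor:
  assumes D: "coprime D (int p)" "coeff F n - of_int D \<in> tideal_power 1"
    and low: "\<And>i. i < n \<Longrightarrow> coeff F i \<in> tideal_power 1"
    and W: "lift_poly F * V = fps_of_poly W" "coeff W n = 1" "\<And>i. n < i \<Longrightarrow> coeff W i = 0"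
  shows "fps_nth V i \<in> localized p k UNIV"
proof (induction k arbitrary: i)
  case 0
  show ?case
    by (rule localized_level_ker) (simp_all add: level_ker_0_UNIV)
next
  case (Suc k)
  have U: "ideal_set (UNIV :: int tpoly set)"
    by unfold_locales simp_all
  have mem: "of_tpoly f * fps_nth V i \<in> localized p (Suc k) UNIV" if "f \<in> tideal_power 1" for f i
    by (rule localized_mult_gen[OF localized_of_tpoly[OF that, where s = "Suc k"] Suc.IH,
          where j = 1 and s'' = "Suc k"]) simp_all
  show ?case
  proof (induction i rule: less_induct)
    case (less i)
    let ?f = "\<lambda>j. of_tpoly (coeff F j) * fps_nth V (n + i - j)"
    have "(\<Sum>j\<le>n + i. ?f j) = coeff W (n + i)"
      using arg_cong[OF W(1), of "\<lambda>G. fps_nth G (n + i)"] by (simp add: fps_mult_nth atLeast0AtMost)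
    moreover have "(\<Sum>j\<le>n + i. ?f j) = ?f n + (\<Sum>j\<in>{..n + i} - {n}. ?f j)"
      by (subst sum.remove[of _ n]) auto
    ultimately have "of_tpoly (coeff F n) * fps_nth V i = coeff W (n + i) - (\<Sum>j\<in>{..n + i} - {n}. ?f j)"
      by (simp add: algebra_simps)
    then have e: "of_int D * fps_nth V i = coeff W (n + i) - (\<Sum>j\<in>{..n + i} - {n}. ?f j)
        - of_tpoly (coeff F n - of_int D) * fps_nth V i"
      by (simp add: of_tpoly.hom_minus of_tpoly.hom_of_int algebra_simps)
    have "coeff W (n + i) = of_tpoly (if i = 0 then 1 else 0)"
      using W(2,3) by auto
    then have 1: "coeff W (n + i) \<in> localized p (Suc k) UNIV"
      using localized_of_tpoly by simp
    have 2: "?f j \<in> localized p (Suc k) UNIV" if j: "j \<in> {..n + i} - {n}" for j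
    proof (cases "j < n")
      case True
      then show ?thesis using low by (intro mem)
    next
      case False
      then have "fps_nth V (n + i - j) \<in> localized p (Suc k) UNIV"
        using j by (intro less.IH) auto
      then show ?thesis
        by (intro localized_mult[OF localized_of_tpoly]) auto
    qed
    have "of_int D * fps_nth V i \<in> localized p (Suc k) UNIV"
      unfolding e by (intro localized_diff[OF U] 1 localized_sum[OF U] 2 mem D(2))
    then show ?case
      by (rule localized_cancel[OF D(1)])
  qed
qed

section \<open>Uniqueness of universal lifts\<close>

lemma lookup_scalar_mult:
  "lookup (single 0 c * f) \<mu> = c * lookup f \<mu>"
  for f :: "'c::comm_ring_1 tpoly"
proof -
  have "single 0 c * (\<Sum>\<nu>\<in>keys f. single \<nu> (lookup f \<nu>))
      = (\<Sum>\<nu>\<in>keys f. single \<nu> (c * lookup f \<nu>))"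
    by (simp add: sum_distrib_left mult_single)
  then have "lookup (single 0 c * f) \<mu>
      = lookup (\<Sum>\<nu>\<in>keys f. single \<nu> (c * lookup f \<nu>)) \<mu>"
    by (simp only: tpoly_sum_single[symmetric])
  then show ?thesis
    by (auto simp: lookup_sum lookup_single when_def in_keys_iff)
qed

lemma lookup_of_nat_mult: "lookup (of_nat p * f) \<mu> = int p * lookup f \<mu>"
  for f :: "int tpoly"
  using lookup_scalar_mult[of "int p" f \<mu>] by (simp del: single_of_nat add: single_of_nat[symmetric])

lemma lookup_rat_tpoly_of_int_mult:
  "lookup (rat_tpoly (of_int q) * \<beta>) \<mu> = of_int q * lookup \<beta> \<mu>"
proof -
  have "rat_tpoly (of_int q) = single 0 (of_int q)"
    by (simp only: single_of_int[symmetric] rat_tpoly_single) simp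
  then show ?thesis by (simp only: lookup_scalar_mult)
qed

text \<open>I is generated by variables, so the order of a monomial is the number of these variables
  in it, counted with multiplicity, and membership in a power can be tested coefficient by
  coefficient.\<close>

definition ideal_weight :: "(nat \<times> nat \<Rightarrow>\<^sub>0 nat) \<Rightarrow> nat" where
  "ideal_weight \<mu> = (\<Sum>x\<in>keys \<mu>. if fst x \<le> snd x then lookup \<mu> x else 0)"

lemma ideal_weight_superset:
  assumes "finite S" "keys \<mu> \<subseteq> S"
  shows "ideal_weight \<mu> = (\<Sum>x\<in>S. if fst x \<le> snd x then lookup \<mu> x else 0)"
  unfolding ideal_weight_def using assms
  by (intro sum.mono_neutral_left) (auto simp: in_keys_iff)

lemma ideal_weight_add: "ideal_weight (\<mu> + \<nu>) = ideal_weight \<mu> + ideal_weight \<nu>"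
proof -
  let ?S = "keys \<mu> \<union> keys \<nu>"
  have "keys (\<mu> + \<nu>) \<subseteq> ?S"
    by (rule Poly_Mapping.keys_add)
  then show ?thesis
    by (simp add: ideal_weight_superset[of ?S] lookup_add flip: sum.distrib) (rule sum.cong, auto simp: lookup_add)
qed

lemma ideal_weight_single: "ideal_weight (single (i, j) 1) = (if i \<le> j then 1 else 0)"
  by (simp add: ideal_weight_def)

definition high_weight :: "nat \<Rightarrow> 'c::comm_ring_1 tpoly set" where
  "high_weight k = {f. \<forall>\<mu>. ideal_weight \<mu> < k \<longrightarrow> lookup f \<mu> = 0}"

lemma high_weight_mult:
  assumes "f \<in> high_weight j" "g \<in> high_weight k"
  shows "f * g \<in> high_weight (j + k)"
proof -
  have "lookup (f * g) \<rho> = 0" if "ideal_weight \<rho> < j + k" for \<rho>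
  proof -
    have "f * g = (\<Sum>\<mu>\<in>keys f. \<Sum>\<nu>\<in>keys g.
        single (\<mu> + \<nu>) (lookup f \<mu> * lookup g \<nu>))"
      by (subst (1) tpoly_sum_single[of f], subst (1) tpoly_sum_single[of g])
        (simp add: sum_product mult_single)
    moreover have "lookup (single (\<mu> + \<nu>) (lookup f \<mu> * lookup g \<nu>)) \<rho> = 0"
      for \<mu> \<nu>
    proof (cases "\<mu> + \<nu> = \<rho>")
      case True
      then have "ideal_weight \<mu> < j \<or> ideal_weight \<nu> < k"
        using that ideal_weight_add[of \<mu> \<nu>] by auto
      then show ?thesis
        using assms by (auto simp: high_weight_def)
    qed (simp add: lookup_single)
    ultimately show ?thesis
      by (simp add: lookup_sum)
  qed
  then show ?thesis by (simp add: high_weight_def)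
qed

lemma ideal_set_high_weight: "ideal_set (high_weight k)"
proof
  show "c * x \<in> high_weight k" if "x \<in> high_weight k" for c x :: "'a tpoly"
    using high_weight_mult[of c 0 x k] that by (simp add: high_weight_def)
qed (auto simp: high_weight_def lookup_add)

lemma ideal_gen_subset:
  assumes "ideal_set A" "X \<subseteq> A"
  shows "ideal_gen X \<subseteq> A"
proof -
  interpret ideal_set A by (rule assms(1))
  show ?thesis
    using assms(2) by (intro ideal_gen_minimal) (auto simp: zero add absorb)
qed

lemma tideal_high_weight: "tideal \<subseteq> high_weight 1"
  unfolding tideal_def
proof (rule ideal_gen_subset[OF ideal_set_high_weight])
  show "{tvar i j | i j. i \<le> j} \<subseteq> (high_weight 1 :: int tpoly set)"
  proof safe
    fix i j :: nat assume "i \<le> j"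
    then show "tvar i j \<in> (high_weight 1 :: int tpoly set)"
      using ideal_weight_single[of i j] by (auto simp: high_weight_def tvar_def lookup_single when_def)
  qed
qed

lemma ideal_power_high_weight: "tideal_power k \<subseteq> high_weight k"
  unfolding ideal_power_def
proof (rule ideal_gen_subset[OF ideal_set_high_weight])
  have "(\<Prod>i<k. a i) \<in> high_weight k" if "\<forall>i<k. a i \<in> tideal" for a :: "nat \<Rightarrow> int tpoly" and k
    using that
  proof (induction k)
    case (Suc k)
    have "a k \<in> high_weight 1"
      using Suc.prems tideal_high_weight by auto
    then have "(\<Prod>i<k. a i) * a k \<in> high_weight (k + 1)"
      using Suc by (intro high_weight_mult) auto
    then show ?case by (simp add: One_nat_def)
  qed (simp add: high_weight_def)
  then show "{\<Prod>i<k. a i | a. \<forall>i<k. a i \<in> tideal} \<subseteq> high_weight k"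
    by blast
qed

lemma tideal_rat_high_weight: "tideal_rat k \<subseteq> high_weight k"
  unfolding tideal_rat_def
proof (rule ideal_gen_subset[OF ideal_set_high_weight])
  show "rat_tpoly ` tideal_power k \<subseteq> high_weight k"
    using ideal_power_high_weight[of k] by (auto simp: high_weight_def lookup_rat_tpoly)
qed

lemma single_tideal_rat: "k \<le> ideal_weight \<mu> \<Longrightarrow> single \<mu> c \<in> tideal_rat k"
proof (induction k arbitrary: \<mu>)
  case (Suc k)
  then have "ideal_weight \<mu> \<noteq> 0" by simp
  then obtain x where x: "x \<in> keys \<mu>" "fst x \<le> snd x"
    unfolding ideal_weight_def by (metis (mono_tags, lifting) sum.neutral)
  define \<nu> where "\<nu> = \<mu> - single x 1"
  have \<mu>: "\<mu> = single x 1 + \<nu>"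
    using x(1) by (intro poly_mapping_eqI)
      (auto simp: \<nu>_def lookup_add lookup_minus lookup_single when_def in_keys_iff)
  have "ideal_weight (single x 1) = 1"
    using ideal_weight_single[of "fst x" "snd x"] x(2) by simp
  then have "k \<le> ideal_weight \<nu>"
    using Suc.prems ideal_weight_add[of "single x 1" \<nu>] \<mu> by simp
  then have "single \<nu> c \<in> tideal_rat k"
    by (rule Suc.IH)
  moreover have "rat_tpoly (tvar (fst x) (snd x)) \<in> tideal_rat 1"
    unfolding tideal_rat_def using x(2) by (intro ideal_gen_base imageI tvar_mem)
  ultimately have "rat_tpoly (tvar (fst x) (snd x)) * single \<nu> c \<in> tideal_rat (1 + k)"
    by (intro tideal_rat_times)
  moreover have "rat_tpoly (tvar (fst x) (snd x)) * single \<nu> c = single \<mu> c"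
    by (simp only: tvar_def rat_tpoly_single mult_single prod.collapse \<mu>[symmetric]) simp
  ultimately show ?case by (simp add: plus_1_eq_Suc)
qed (simp add: tideal_rat_0_UNIV)

lemma tideal_rat_iff: "f \<in> tideal_rat k \<longleftrightarrow> f \<in> high_weight k"
proof
  assume f: "f \<in> high_weight k"
  have "(\<Sum>\<mu>\<in>keys f. single \<mu> (lookup f \<mu>)) \<in> tideal_rat k"
  proof (intro ideal_set.sum[of "tideal_rat k"])
    show "ideal_set (tideal_rat k)"
      unfolding tideal_rat_def by (rule ideal_set_ideal_gen)
    fix \<mu> assume "\<mu> \<in> keys f"
    then have "k \<le> ideal_weight \<mu>"
      using f by (auto simp: high_weight_def in_keys_iff not_less[symmetric])
    then show "single \<mu> (lookup f \<mu>) \<in> tideal_rat k"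
      by (rule single_tideal_rat)
  qed
  then show "f \<in> tideal_rat k"
    by (simp only: tpoly_sum_single[symmetric])
qed (use tideal_rat_high_weight in blast)

lemma level_representative:
  "\<exists>\<beta>. (a \<in> level_ker k \<longleftrightarrow> \<beta> \<in> tideal_rat k) \<and>
    (\<forall>f g. of_tpoly f * a - of_tpoly g \<in> level_ker k \<longleftrightarrow> rat_tpoly f * \<beta> - rat_tpoly g \<in> tideal_rat k)"
proof -
  define r where "r = rep_compl_ring a"
  have r: "lim_rel r r" "abs_compl_ring r = a"
    using Quotient_rep_reflp[OF Quotient_compl_ring] Quotient_abs_rep[OF Quotient_compl_ring]
    by (simp_all add: r_def)
  have c: "lim_rel (\<lambda>_. f) (\<lambda>_. f)" for f
    by (simp add: lim_rel_def compatible_const tideal_rat_0)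
  have rr: "lim_rel (\<lambda>k. f * r k) (\<lambda>k. f * r k)" for f
    using r(1) compatible_mult[OF compatible_const, of r f] by (simp add: lim_rel_def tideal_rat_0)
  have rrr: "lim_rel (\<lambda>k. f * r k + - g) (\<lambda>k. f * r k + - g)" for f g
    using rr[of f] compatible_add[OF _ compatible_const, of "\<lambda>k. f * r k" "- g"] by (simp add: lim_rel_def tideal_rat_0)
  have t: "of_tpoly f = abs_compl_ring (\<lambda>_. rat_tpoly f)" for f
    by (simp add: of_tpoly_def)
  have "of_tpoly f * a - of_tpoly g = abs_compl_ring (\<lambda>k. rat_tpoly f * r k + - rat_tpoly g)" for f g
    unfolding minus_compl_ring_def t r(2)[symmetric] times_compl_ring.abs_eq[OF c r(1)]
      uminus_compl_ring.abs_eq[OF c] by (rule plus_compl_ring.abs_eq[OF rr c])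
  then have "of_tpoly f * a - of_tpoly g \<in> level_ker k \<longleftrightarrow> rat_tpoly f * r k - rat_tpoly g \<in> tideal_rat k" for f g
    using in_level_ker.abs_eq[OF rrr] by (simp add: level_ker_def)
  moreover have "a \<in> level_ker k \<longleftrightarrow> r k \<in> tideal_rat k"
    using in_level_ker.abs_eq[OF r(1)] by (simp add: level_ker_def r(2))
  ultimately show ?thesis by blast
qed

text \<open>A coefficient of a representative would be divisible by all large primes.\<close>

lemma level_ker_of_localized:
  assumes "\<And>p. prime p \<Longrightarrow> p0 \<le> p \<Longrightarrow> a \<in> localized p k (pfilt p k)"
  shows "a \<in> level_ker k"
proof -
  obtain \<beta> where \<beta>: "a \<in> level_ker k \<longleftrightarrow> \<beta> \<in> tideal_rat k"
    "\<And>f g. of_tpoly f * a - of_tpoly g \<in> level_ker k \<longleftrightarrow> rat_tpoly f * \<beta> - rat_tpoly g \<in> tideal_rat k"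
    using level_representative[of a k] by blast
  have "lookup \<beta> \<mu> = 0" if \<mu>: "ideal_weight \<mu> < k" for \<mu>
  proof -
    obtain x y where xy: "quotient_of (lookup \<beta> \<mu>) = (x, y)"
      by (cases "quotient_of (lookup \<beta> \<mu>)")
    then have y: "y > 0" and \<beta>\<mu>: "lookup \<beta> \<mu> = of_int x / of_int y"
      by (rule quotient_of_denom_pos, rule quotient_of_div)
    obtain p where p: "prime p" "p > max p0 (nat \<bar>x\<bar>)"
      using bigger_prime by blast
    then obtain q f where q: "coprime q (int p)" "f \<in> pfilt p k" "of_int q * a - of_tpoly f \<in> level_ker k"
      using assms[of p] by (auto elim: localizedE)
    obtain g h where f: "f = of_nat p * g + h" "h \<in> tideal_power k"
      using q(2) unfolding pfilt_def by blast
    have "lookup h \<mu> = 0"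
      using ideal_power_high_weight[of k] f(2) \<mu> by (auto simp: high_weight_def)
    then have f\<mu>: "lookup f \<mu> = int p * lookup g \<mu>"
      unfolding f(1) lookup_add by (simp add: lookup_of_nat_mult)
    have "rat_tpoly (of_int q) * \<beta> - rat_tpoly f \<in> tideal_rat k"
      using q(3) \<beta>(2)[of "of_int q" f] by (simp add: of_tpoly.hom_of_int)
    then have "lookup (rat_tpoly (of_int q) * \<beta>) \<mu> = of_int (lookup f \<mu>)"
      using \<mu> by (auto simp: tideal_rat_iff high_weight_def lookup_minus lookup_rat_tpoly)
    then have "of_int q * lookup \<beta> \<mu> = of_int (int p * lookup g \<mu>)"
      by (simp add: f\<mu> lookup_rat_tpoly_of_int_mult)
    then have "(of_int (q * x) :: rat) = of_int (int p * lookup g \<mu> * y)"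
      using y by (simp add: \<beta>\<mu> field_simps)
    then have "q * x = int p * lookup g \<mu> * y"
      by (simp only: of_int_eq_iff)
    then have "int p dvd q * x"
      by simp
    then have "int p dvd x"
      using q(1) by (simp add: coprime_dvd_mult_right_iff coprime_commute)
    moreover have "\<bar>x\<bar> < int p"
      using p(2) by linarith
    ultimately have "x = 0"
      using zdvd_not_zless[of "\<bar>x\<bar>" "int p"] by auto
    then show ?thesis by (simp add: \<beta>\<mu>)
  qed
  then show ?thesis
    by (simp add: \<beta>(1) tideal_rat_iff high_weight_def)
qed

text \<open>The levels \<open>C * p\<close> exceed any fixed \<open>k\<close> for large p, so at
  level \<open>k\<close> the difference of two lifts vanishes modulo almost all primes.\<close>

lemma universal_lift_unique:
  assumes "is_universal_lift n m l a" "is_universal_lift n m l b"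
  shows "a = b"
proof -
  obtain C C' where C: "C > 0" "\<And>p. prime p \<Longrightarrow> reduces_to p (nat \<lceil>C * real p\<rceil>) a (Det_p n m l p)"
    and C': "C' > 0" "\<And>p. prime p \<Longrightarrow> reduces_to p (nat \<lceil>C' * real p\<rceil>) b (Det_p n m l p)"
    using assms unfolding is_universal_lift_def by blast
  have large: "k \<le> nat \<lceil>c * real p\<rceil>" if "c > 0" "nat \<lceil>real k / c\<rceil> \<le> p" for k p and c :: real
  proof -
    have "real k / c \<le> real p"
      using that(2) by linarith
    then have "real k \<le> c * real p"
      using that(1) by (simp add: field_simps)
    then show ?thesis by linarith
  qed
  have "a - b \<in> level_ker k" for k
  proof (rule level_ker_of_localized)
    fix p :: nat
    assume p: "prime p" "max (nat \<lceil>real k / C\<rceil>) (nat \<lceil>real k / C'\<rceil>) \<le> p"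
    define d where "d = of_tpoly (Det_p n m l p)"
    have k: "k \<le> nat \<lceil>C * real p\<rceil>" "k \<le> nat \<lceil>C' * real p\<rceil>"
      using p(2) by (auto intro: large C(1) C'(1))
    have "a - d \<in> localized p k (pfilt p k)"
      unfolding d_def
      by (rule localized_mono[OF C(2)[OF p(1), unfolded reduces_to_iff] N.antimono[OF k(1)] k(1)])
    moreover have "b - d \<in> localized p k (pfilt p k)"
      unfolding d_def
      by (rule localized_mono[OF C'(2)[OF p(1), unfolded reduces_to_iff] N.antimono[OF k(2)] k(2)])
    ultimately have "(a - d) - (b - d) \<in> localized p k (pfilt p k)"
      by (rule localized_diff[OF N.ideal])
    then show "a - b \<in> localized p k (pfilt p k)" by simp
  qed
  then have "a - b = 0"
    by (rule level_ker_separated)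
  then show ?thesis by simp
qed

section \<open>Stability and the limit\<close>

locale bounded_diff_operator = diff_operator +
  fixes Lm :: nat
  assumes l_bound: "r \<in> {1..n} \<Longrightarrow> \<bar>l r\<bar> \<le> int Lm"
begin

abbreviation weier :: "nat \<Rightarrow> nat \<Rightarrow> compl_ring poly" where
  "weier \<equiv> B_weierstrass n m l"

lemma weier_eq: "weier M N = weierstrass_poly n (lift_poly (minor (- int M) (M + N + 1)))"
  unfolding B_weierstrass_def det_B_matrix lift_poly_def ..

lemma lift_minor_unit:
  assumes "\<And>r j. r \<in> {1..n} \<Longrightarrow> j < k \<Longrightarrow> a + int j \<noteq> l r"
  shows "lift_poly (minor a k) dvd 1"
proof (rule fps_dvd_1, rule compl_ring_unit)
  show "fps_nth (lift_poly (minor a k)) 0 - of_int (\<Prod>j<k. \<Prod>r=1..n. a + int j - l r) \<in> level_ker 1"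
    using of_tpoly_level_ker[OF poly_minor_mod_ideal[of a k]]
    by (simp only: lift_poly_nth of_tpoly.hom_minus of_tpoly.hom_of_int poly_0_coeff_0)
  show "(\<Prod>j<k. \<Prod>r=1..n. a + int j - l r) \<noteq> 0"
    using assms by auto
qed

lemma weier_is:
  assumes "Lm \<le> M" "Lm \<le> N"
  shows "is_weierstrass_poly n (lift_poly (minor (- int M) (M + N + 1))) (weier M N)"
proof -
  define a k where "a = - int M" and "k = M + N + 1"
  have w: "a \<le> l r \<and> l r < a + int k" if "r \<in> {1..n}" for r
    using l_bound[OF that] assms by (auto simp: a_def k_def)
  define D where "D = (\<Prod>r=1..n. \<Prod>j\<in>{j. j < k \<and> a + int j \<noteq> l r}. a + int j - l r)"
  have "of_tpoly (coeff (minor a k) n - of_int D) \<in> level_ker 1"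
    unfolding D_def by (rule of_tpoly_level_ker[OF minor_coeff_small(2)[OF w]])
  then have 1: "fps_nth (lift_poly (minor a k)) n - of_int D \<in> level_ker 1"
    by (simp add: of_tpoly.hom_minus of_tpoly.hom_of_int)
  have 2: "fps_nth (lift_poly (minor a k)) i \<in> level_ker 1" if "i < n" for i
    using of_tpoly_level_ker[OF minor_coeff_small(1)[OF w that]] by simp
  have "D \<noteq> 0"
    by (simp add: D_def)
  then obtain W where "is_weierstrass_poly n (lift_poly (minor a k)) W"
    using weierstrass_exists[of n "lift_poly (minor a k)" D] 1 2 by blast
  then show ?thesis
    unfolding weier_eq a_def k_def by (rule weierstrass_poly_is)
qed

lemma weier_congruent:
  assumes "Lm \<le> M" "Lm \<le> N" "Lm \<le> M'" "Lm \<le> N'"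
    and unit: "lift_poly P dvd 1" "lift_poly P' dvd 1"
    and cong: "minor (- int M) (M + N + 1) * P - minor (- int M') (M' + N' + 1) * P'
      \<in> coeffs_in (tideal_power s)"
  shows "coeff (weier M N) i - coeff (weier M' N') i \<in> level_ker s"
  by (rule weierstrass_congruent[OF weier_is[OF assms(1,2)] weier_is[OF assms(3,4)] unit])
    (use lift_poly_diff_mem[OF cong] in \<open>simp add: lift_poly_mult\<close>)

text \<open>Both cofactors in the cluster relation are minors over windows to the left of all
  \<open>l r\<close>, hence units as power series.\<close>

lemma weier_step_left:
  assumes "m * s + Lm \<le> M" "m * s + Lm \<le> N"
  shows "coeff (weier (Suc M) N) i - coeff (weier M N) i \<in> level_ker s"
proof -
  define K where "K = m * s"
  define a where "a = - int (Suc M)"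
  define j where "j = M + N + 1 - K"
  have K: "K + j = M + N + 1" "m * s \<le> K + 1" "K + Lm \<le> M"
    using assms by (auto simp: K_def j_def)
  have a: "a + 1 = - int M" by (simp add: a_def)
  have u1: "lift_poly (minor (- int M) K) dvd 1"
  proof (rule lift_minor_unit)
    show "- int M + int j \<noteq> l r" if "r \<in> {1..n}" "j < K" for r j
      using l_bound[OF that(1)] that(2) K(3) by auto
  qed
  have u2: "lift_poly (minor a (K + 1)) dvd 1"
  proof (rule lift_minor_unit)
    show "a + int j \<noteq> l r" if "r \<in> {1..n}" "j < K + 1" for r j
      using l_bound[OF that(1)] that(2) K(3) by (auto simp: a_def)
  qed
  show ?thesis
    by (rule weier_congruent[OF _ _ _ _ u1 u2])
      (use assms minor_cluster_1[OF K(2), of a j, unfolded K(1) a]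
        in \<open>simp_all add: a_def mult.commute One_nat_def\<close>)
qed

lemma weier_step_right:
  assumes "m * s + Lm \<le> M" "m * s + Lm \<le> N"
  shows "coeff (weier M (Suc N)) i - coeff (weier M N) i \<in> level_ker s"
proof -
  define K where "K = m * s"
  define a where "a = - int M"
  define q where "q = M + N + 1 - K"
  have K: "q + K = M + N + 1" "m * s \<le> K + 1" "K + Lm \<le> N"
    using assms by (auto simp: K_def q_def)
  then have q: "a + int q = int N + 1 - int K"
    by (simp add: a_def)
  have u: "lift_poly (minor (a + int q) k) dvd 1" for k
  proof (rule lift_minor_unit)
    show "a + int q + int j \<noteq> l r" if "r \<in> {1..n}" for r j
      using l_bound[OF that(1)] K(3) unfolding q by auto
  qed
  show ?thesis
    by (rule weier_congruent[OF _ _ _ _ u[of K] u[of "K + 1"]])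
      (use assms minor_cluster[OF K(2), of a q 1, unfolded K(1)]
        in \<open>simp_all add: a_def One_nat_def\<close>)
qed

lemma weier_stable:
  assumes "m * s + Lm \<le> M" "m * s + Lm \<le> N" "M \<le> M'" "N \<le> N'"
  shows "coeff (weier M' N') i - coeff (weier M N) i \<in> level_ker s"
proof -
  have "coeff (weier (M + d) N) i - coeff (weier M N) i \<in> level_ker s" for d
  proof (induction d)
    case (Suc d)
    have "coeff (weier (Suc (M + d)) N) i - coeff (weier (M + d) N) i \<in> level_ker s"
      using assms by (intro weier_step_left) auto
    from J.diff_trans[OF this Suc.IH] show ?case by simp
  qed (simp add: J.zero)
  from this[of "M' - M"] have 1: "coeff (weier M' N) i - coeff (weier M N) i \<in> level_ker s"
    using assms by simp
  have "coeff (weier M' (N + d)) i - coeff (weier M' N) i \<in> level_ker s" for d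
  proof (induction d)
    case (Suc d)
    have "coeff (weier M' (Suc (N + d))) i - coeff (weier M' (N + d)) i \<in> level_ker s"
      using assms by (intro weier_step_right) auto
    from J.diff_trans[OF this Suc.IH] show ?case by simp
  qed (simp add: J.zero)
  from this[of "N' - N"] have "coeff (weier M' N') i - coeff (weier M' N) i \<in> level_ker s"
    using assms by simp
  from J.diff_trans[OF this 1] show ?thesis .
qed

text \<open>The linear rate is needed besides convergence: the window attached to a prime p has
  length about p and must already agree with the limit up to level \<open>s\<close>.\<close>

lemma limit_weierstrass_level:
  assumes "m * s + Lm \<le> M" "m * s + Lm \<le> N"
  shows "coeff (weier M N) i - coeff (limit_weierstrass n m l) i \<in> level_ker s"
proof -
  define a where "a i k = coeff (weier (m * k + Lm) (m * k + Lm)) i" for i k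
  have a: "a i (Suc k) - a i k \<in> level_ker k" for i k
    unfolding a_def by (rule weier_stable) auto
  have "\<exists>x. \<forall>k. x - a i k \<in> level_ker k" for i
    using level_ker_complete[of "a i"] a by metis
  then obtain x where x: "x i - a i k \<in> level_ker k" for i k
    by metis
  define w where "w = (\<Sum>i\<le>n. monom (x i) i)"
  have level: "coeff (weier M N) i - coeff w i \<in> level_ker s"
    if M: "m * s + Lm \<le> M" "m * s + Lm \<le> N" for M N s i
  proof (cases "i \<le> n")
    case True
    then have "coeff w i = x i"
      by (simp add: w_def coeff_sum)
    moreover have "coeff (weier M N) i - a i s \<in> level_ker s"
      unfolding a_def using M by (intro weier_stable) auto
    ultimately show ?thesis
      using J.diff_trans[OF _ J.diff_commute[OF x[of i s]]] by simp
  next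
    case False
    moreover have "degree (weier M N) = n"
      using weier_is[of M N] M by (simp add: is_weierstrass_poly_def)
    ultimately have "coeff (weier M N) i = 0" "coeff w i = 0"
      by (auto simp: w_def coeff_sum coeff_eq_0)
    then show ?thesis by (simp add: J.zero)
  qed
  have lim: "((\<lambda>(M, N). coeff (weier M N) i) \<longlongrightarrow> coeff w i) (sequentially \<times>\<^sub>F sequentially)" for i
    unfolding tendsto_def
  proof (intro allI impI)
    fix U :: "compl_ring set" assume "open U" "coeff w i \<in> U"
    then obtain k where k: "\<And>b. b - coeff w i \<in> level_ker k \<Longrightarrow> b \<in> U"
      unfolding open_compl_ring_def by blast
    have "eventually (\<lambda>M. m * k + Lm \<le> M) sequentially"
      by (rule eventually_ge_at_top)
    from eventually_prodI[OF this this]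
    show "\<forall>\<^sub>F z in sequentially \<times>\<^sub>F sequentially. (case z of (M, N) \<Rightarrow> coeff (weier M N) i) \<in> U"
      by (rule eventually_mono) (auto intro!: k level)
  qed
  have "limit_weierstrass n m l = w"
    unfolding limit_weierstrass_def
  proof (rule the_equality)
    fix w' assume "\<forall>i. ((\<lambda>(M, N). coeff (weier M N) i) \<longlongrightarrow> coeff w' i) (sequentially \<times>\<^sub>F sequentially)"
    moreover have "sequentially \<times>\<^sub>F sequentially \<noteq> (bot :: (nat \<times> nat) filter)"
      by (simp add: prod_filter_eq_bot)
    ultimately have "coeff w' i = coeff w i" for i
      using tendsto_unique lim by metis
    then show "w' = w" by (rule poly_eqI)
  qed (use lim in blast)
  then show ?thesis
    using level[OF assms] by simp
qed

section \<open>The limit is the universal lift\<close>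

definition lift_value :: compl_ring where
  "lift_value = (-1) ^ n * coeff (limit_weierstrass n m l) 0"

text \<open>Both sides vanish modulo p and I. The constant coefficient of a Weierstrass polynomial
  lies in I, and modulo I the p-determinant contains the factors \<open>j - l 1\<close> for a
  complete system of residues \<open>j\<close>.\<close>

lemma reduces_to_level_1:
  assumes "prime p"
  shows "reduces_to p 1 lift_value (Det_p n m l p)"
proof -
  have "0 < p" using assms prime_gt_0_nat by blast
  define M where "M = m * 1 + Lm"
  have "coeff (weier M M) 0 \<in> level_ker 1"
    using weier_is[of M M] n_pos by (simp add: M_def is_weierstrass_poly_def)
  then have "coeff (limit_weierstrass n m l) 0 \<in> level_ker 1"
    using J.cong_mem[OF limit_weierstrass_level[of 1 M M 0]] by (simp add: M_def)
  then have 1: "lift_value \<in> localized p 1 (pfilt p 1)"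
    unfolding lift_value_def by (intro localized_level_ker J.absorb N.zero)
  have "int p dvd (\<Prod>j<p. \<Prod>r=1..n. 0 + int j - l r)"
  proof -
    define j where "j = nat (l 1 mod int p)"
    have j: "j < p" "int j = l 1 mod int p"
      using \<open>0 < p\<close> by (simp_all add: j_def nat_less_iff)
    then have "int p dvd 0 + int j - l 1"
      by (simp add: mod_eq_dvd_iff[symmetric])
    moreover have "0 + int j - l 1 dvd (\<Prod>r=1..n. 0 + int j - l r)"
      using n_pos by (intro dvd_prodI) auto
    moreover have "(\<Prod>r=1..n. 0 + int j - l r) dvd (\<Prod>j<p. \<Prod>r=1..n. 0 + int j - l r)"
      using j(1) by (intro dvd_prodI) auto
    ultimately show ?thesis
      by (blast intro: dvd_trans)
  qed
  then obtain c where c: "(\<Prod>j<p. \<Prod>r=1..n. 0 + int j - l r) = int p * c"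
    by (elim dvdE)
  have "Det_p n m l p - of_int (int p * c) \<in> pfilt p 1"
    using poly_minor_pfilt[of 0 p p] unfolding c Det_p_eq .
  moreover have "of_int (int p * c) \<in> pfilt p 1"
    using N.absorb_right[OF of_nat_pfilt[of p 1], where c = "of_int c"] by simp
  ultimately have "Det_p n m l p \<in> pfilt p 1"
    using N.cong_mem by blast
  then have "lift_value - of_tpoly (Det_p n m l p) \<in> localized p 1 (pfilt p 1)"
    by (intro localized_diff[OF N.ideal 1] localized_of_tpoly)
  then show ?thesis
    by (simp add: reduces_to_iff)
qed

text \<open>For F = W Q and V the inverse of Q, the relation of F to \<open>P\<close> gives W = P' G
  modulo p, with a p-integral series G. Modulo eps^p the factor P' is monic of degree
  \<open>n\<close> with lower coefficients in I, so truncated uniqueness yields G(0) = 1 and the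
  constant coefficients agree.\<close>

lemma weier_coeff_0:
  assumes p: "prime p" and s: "1 \<le> s" and K: "K = m * s"
    and large: "2 * K + 4 * Lm + 1 < p" "2 * (slope + 1) * s + n + 1 \<le> p" "n * s < p"
  shows "coeff (weier (Lm + 1 + K) (p - Lm - 2)) 0 - (-1) ^ n * of_tpoly (Det_p n m l p)
    \<in> localized p s (pfilt p s)"
proof -
  \<comment> \<open>The first \<open>K\<close> places lie to the left of all \<open>l r\<close>, the
    length is \<open>K + p\<close>, and yet every difference \<open>a + j - l r\<close> stays below
    p in absolute value.\<close>
  define M N where "M = Lm + 1 + K" and "N = p - Lm - 2"
  define a where "a = - int M"
  have MN: "M + N + 1 = K + p" "m * s + Lm \<le> M" "m * s + Lm \<le> N" "Lm \<le> M" "Lm \<le> N"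
    using large(1) by (auto simp: M_def N_def K)
  define W where "W = weier M N"
  define F where "F = minor a (K + p)"
  have W: "is_weierstrass_poly n (lift_poly F) W"
    using weier_is[OF MN(4,5)] unfolding MN(1) W_def F_def a_def .
  then obtain Q where Q: "Q dvd 1" "lift_poly F = fps_of_poly W * Q"
    unfolding is_weierstrass_poly_def by blast
  obtain V where V: "Q * V = 1" using Q(1) by (metis dvdE)
  have FV: "lift_poly F * V = fps_of_poly W"
    unfolding Q(2) mult.assoc V by simp
  have W_top: "coeff W n = 1" "\<And>i. n < i \<Longrightarrow> coeff W i = 0"
    using W by (auto simp: is_weierstrass_poly_def coeff_eq_0)
  have w: "a \<le> l r \<and> l r < a + int (K + p)" if "r \<in> {1..n}" for r
    using l_bound[OF that] large(1) by (auto simp: a_def M_def)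
  define D where "D = (\<Prod>r=1..n. \<Prod>j\<in>{j. j < K + p \<and> a + int j \<noteq> l r}. a + int j - l r)"
  \<comment> \<open>Makes the coefficient of degree \<open>n\<close> of \<open>F\<close> a unit at p
    modulo I; otherwise the cofactor \<open>V\<close> might acquire p in its denominators.\<close>
  have "\<not> int p dvd a + int j - l r" if r: "r \<in> {1..n}" and j: "j < K + p" "a + int j \<noteq> l r" for r j
  proof
    assume "int p dvd a + int j - l r"
    moreover have "a + int j - l r < int p" "- int p < a + int j - l r"
      using l_bound[OF r] j large(1) by (auto simp: a_def M_def)
    moreover from this have "\<bar>a + int j - l r\<bar> < int p"
      by linarith
    ultimately show False
      using j(2) zdvd_not_zless[of "\<bar>a + int j - l r\<bar>" "int p"] by auto
  qed
  then have "\<not> int p dvd D"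
    using p by (auto simp: D_def prime_dvd_prod_iff)
  then have D: "coprime D (int p)"
    using p by (metis coprime_commute prime_imp_coprime prime_int_nat_transfer prime_nat_int_transfer)
  have integral: "fps_nth V i \<in> localized p s UNIV" for i
    by (rule localized_cofactor[OF D _ _ FV W_top, of i s])
      (use minor_coeff_small[OF w] in \<open>auto simp: F_def D_def\<close>)
  obtain P where P: "\<And>a. minor a K * P - minor a (K + p) \<in> coeffs_in (pfilt p s)"
    using periodic_quotient[OF p l_bound _ large(1), of s] K by auto
  have K': "m * s \<le> K + 1" by (simp add: K)
  note P_n = periodic_quotient_coeffs(1)[OF p P K' s large(2)]
    and P_mid = periodic_quotient_coeffs(2)[OF p P K' s large(2)]
    and P_0 = periodic_quotient_at_0[OF p l_bound P K' large(1)]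
    and P_low = periodic_quotient_low[OF p l_bound P s large(1)]
  let ?N = "localized p s (pfilt p s)"
  have U: "ideal_set (UNIV :: int tpoly set)"
    by unfold_locales simp_all
  define P' where "P' = Polynomial.smult ((-1) ^ n) P"
  define G where "G = fps_const ((-1) ^ n) * lift_poly (minor a K) * V"
  define H where "H i = fps_nth G i - (if i = 0 then 1 else 0)" for i
  have sq: "(-1) ^ n * ((-1) ^ n * x) = (x :: 'b :: comm_ring_1)" for x
    by (simp flip: mult.assoc power_mult_distrib)
  have G_int: "fps_nth G i \<in> localized p s UNIV" for i
  proof -
    have "fps_nth (lift_poly (minor a K) * V) i \<in> localized p s UNIV"
      unfolding fps_mult_nth
      by (intro localized_sum[OF U] localized_mult[OF _ integral, where A = UNIV])
        (simp_all add: localized_of_tpoly)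
    moreover have "(-1) ^ n \<in> localized p s UNIV"
      using localized_of_tpoly[of "(-1) ^ n" UNIV p s] by (simp add: of_tpoly.hom_power of_tpoly.hom_uminus)
    ultimately have "(-1) ^ n * fps_nth (lift_poly (minor a K) * V) i \<in> localized p s UNIV"
      by (intro localized_mult[where A = UNIV and B = UNIV]) auto
    then show ?thesis
      by (simp add: G_def mult.assoc)
  qed
  have H_int: "H i \<in> localized p s UNIV" for i
    unfolding H_def using localized_of_tpoly[of "if i = 0 then 1 else 0" UNIV p s]
    by (intro localized_diff[OF U] G_int) (auto simp: if_distrib split: if_splits)
  have conv_G: "coeff W i - fps_nth (lift_poly P' * G) i \<in> ?N" for i
  proof -
    have lift_P': "lift_poly P' = fps_const ((-1) ^ n) * lift_poly P"
      by (rule fps_ext) (simp add: P'_def of_tpoly.hom_mult of_tpoly.hom_power of_tpoly.hom_uminus)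
    have csq: "fps_const ((-1) ^ n) * (fps_const ((-1) ^ n) * X) = X" for X :: "compl_ring fps"
      by (simp only: mult.assoc[symmetric] fps_const_mult power_mult_distrib[symmetric]) simp
    have "lift_poly P' * G = fps_const ((-1) ^ n) * (fps_const ((-1) ^ n) * (lift_poly P * lift_poly (minor a K) * V))"
      by (simp only: lift_P' G_def mult_ac)
    also have "\<dots> = lift_poly (minor a K * P) * V"
      by (simp only: csq) (simp only: lift_poly_mult mult_ac)
    finally have "fps_of_poly W - lift_poly P' * G = (lift_poly F - lift_poly (minor a K * P)) * V"
      by (simp add: FV left_diff_distrib)
    then have "coeff W i - fps_nth (lift_poly P' * G) i = fps_nth ((lift_poly F - lift_poly (minor a K * P)) * V) i"
      by (metis fps_of_poly_nth fps_sub_nth)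
    also have "\<dots> = (\<Sum>j=0..i. of_tpoly (coeff F j - coeff (minor a K * P) j) * fps_nth V (i - j))"
      by (simp add: fps_mult_nth of_tpoly.hom_minus)
    also have "\<dots> \<in> ?N"
    proof (intro localized_sum[OF N.ideal])
      fix j
      have "coeff F j - coeff (minor a K * P) j \<in> pfilt p s"
        using N.diff_commute[of "coeff (minor a K * P) j" "coeff F j"] coeffs_inD[OF P[of a], of j]
        by (simp add: F_def)
      then show "of_tpoly (coeff F j - coeff (minor a K * P) j) * fps_nth V (i - j) \<in> ?N"
        by (intro localized_mult[OF localized_of_tpoly integral]) (auto intro: N.absorb_right)
    qed
    finally show ?thesis .
  qed
  have conv_H: "(coeff W i - of_tpoly (coeff P' i)) - (\<Sum>j\<le>i. of_tpoly (coeff P' j) * H (i - j)) \<in> ?N" for i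
  proof -
    have "(\<Sum>j\<le>i. of_tpoly (coeff P' j) * H (i - j)) =
        (\<Sum>j\<le>i. of_tpoly (coeff P' j) * fps_nth G (i - j)) - (\<Sum>j\<le>i. if j = i then of_tpoly (coeff P' j) else 0)"
      unfolding sum_subtractf[symmetric] H_def
      by (intro sum.cong refl) (auto simp: right_diff_distrib)
    then show ?thesis
      using conv_G[of i] by (simp add: fps_mult_nth atLeast0AtMost)
  qed
  have P'_n: "coeff P' n - 1 \<in> pfilt p s"
    using N.absorb[OF P_n, of "(-1) ^ n"] sq[of 1] by (simp add: P'_def right_diff_distrib)
  have P'_mid: "coeff P' i \<in> pfilt p s" if "n < i" "i < p" for i
    unfolding P'_def coeff_smult by (intro N.absorb P_mid that)
  have P'_low: "coeff P' i \<in> pfilt p 1" if "i < n" for i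
    unfolding P'_def coeff_smult by (intro N.absorb P_low that)
  \<comment> \<open>Nothing is known about \<open>P\<close> from degree p on, so the truncation
    bound is p. The condition \<open>n * s < p\<close> leaves enough coefficients to reach level
    \<open>s\<close> at index 0.\<close>
  have "H 0 \<in> ?N"
  proof (rule weierstrass_truncated[of "\<lambda>k. localized p s (pfilt p k)" n "\<lambda>i. of_tpoly (coeff P' i)" s p])
    show "0 \<in> localized p s (pfilt p k)" for k
      by (rule localized_0[OF N.ideal])
    show "x - y \<in> localized p s (pfilt p k)"
      if "x \<in> localized p s (pfilt p k)" "y \<in> localized p s (pfilt p k)" for k x y
      by (rule localized_diff[OF N.ideal that])
    show "x \<in> localized p s (pfilt p j)" if "x \<in> localized p s (pfilt p k)" "j \<le> k" for j k x
      by (rule localized_mono[OF that(1) N.antimono[OF that(2)] order_refl])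
    show "of_tpoly (coeff P' i) * x \<in> localized p s (pfilt p (Suc k))"
      if "i < n" "x \<in> localized p s (pfilt p k)" for i k x
      by (rule localized_mult[OF localized_of_tpoly[OF P'_low[OF that(1)]] that(2)])
        (use N.I_mult[of _ p 1 _ k] in \<open>simp add: plus_1_eq_Suc\<close>)
    show "(of_tpoly (coeff P' n) - 1) * x \<in> ?N" if "x \<in> localized p s (pfilt p 0)" for x
      using localized_mult[OF localized_of_tpoly[OF P'_n] that N.absorb_right]
      by (simp add: of_tpoly.hom_minus)
    show "of_tpoly (coeff P' i) * x \<in> ?N"
      if "n < i" "i < p" "x \<in> localized p s (pfilt p 0)" for i x
      by (rule localized_mult[OF localized_of_tpoly[OF P'_mid[OF that(1,2)]] that(3) N.absorb_right])
    show "H i \<in> localized p s (pfilt p 0)" for i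
      using H_int by (simp add: N.I_0)
    show "(\<Sum>j\<le>i. of_tpoly (coeff P' j) * H (i - j)) \<in> ?N" if "n \<le> i" "i < p" for i
    proof -
      have "coeff W i - of_tpoly (coeff P' i) \<in> ?N"
      proof (cases "i = n")
        case True
        have "of_tpoly (1 - coeff P' n) \<in> ?N"
          by (rule localized_of_tpoly[OF N.diff_commute[OF P'_n]])
        then show ?thesis
          using True W_top(1) by (simp add: of_tpoly.hom_minus)
      next
        case False
        then have "of_tpoly (- coeff P' i) \<in> ?N"
          using that by (intro localized_of_tpoly N.minus P'_mid) auto
        then show ?thesis
          using False that W_top(2)[of i] by (simp add: of_tpoly.hom_uminus)
      qed
      from localized_diff[OF N.ideal this conv_H[of i]] show ?thesis by simp
    qed
  qed (use large(3) in auto)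
  then have "of_tpoly (coeff P' 0) * H 0 \<in> ?N"
    by (rule localized_mult[OF localized_of_tpoly[OF UNIV_I]]) (rule N.absorb)
  from localized_add[OF N.ideal conv_H[of 0, simplified] this]
  have 1: "coeff W 0 - of_tpoly (coeff P' 0) \<in> ?N"
    by simp
  have "of_tpoly ((-1) ^ n * (coeff P 0 - Det_p n m l p)) \<in> ?N"
    by (intro localized_of_tpoly N.absorb P_0)
  from localized_add[OF N.ideal 1 this] show ?thesis
    by (simp add: P'_def W_def M_def N_def of_tpoly.hom_mult of_tpoly.hom_minus of_tpoly.hom_power
        of_tpoly.hom_uminus algebra_simps)
qed

lemma reduces_to_large:
  assumes p: "prime p" and s: "1 \<le> s"
    and large: "2 * (m * s) + 4 * Lm + 1 < p" "2 * (slope + 1) * s + n + 1 \<le> p" "n * s < p"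
  shows "reduces_to p s lift_value (Det_p n m l p)"
proof -
  define W where "W = weier (Lm + 1 + m * s) (p - Lm - 2)"
  let ?N = "localized p s (pfilt p s)" and ?w = "coeff (limit_weierstrass n m l) 0"
  have 1: "coeff W 0 - (-1) ^ n * of_tpoly (Det_p n m l p) \<in> ?N"
    unfolding W_def by (rule weier_coeff_0[OF p s refl large])
  have "?w - coeff W 0 \<in> level_ker s"
    unfolding W_def using large(1) by (intro J.diff_commute[OF limit_weierstrass_level]) auto
  then have "?w - coeff W 0 \<in> ?N"
    by (rule localized_level_ker[OF N.zero])
  from localized_add[OF N.ideal this 1]
  have "?w - (-1) ^ n * of_tpoly (Det_p n m l p) \<in> ?N" by simp
  then have "of_tpoly ((-1) ^ n) * (?w - (-1) ^ n * of_tpoly (Det_p n m l p)) \<in> ?N"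
    by (rule localized_mult[OF localized_of_tpoly[OF UNIV_I]]) (rule N.absorb)
  moreover have "of_tpoly ((-1) ^ n) * (?w - (-1) ^ n * of_tpoly (Det_p n m l p))
      = lift_value - ((-1) ^ n * (-1) ^ n) * of_tpoly (Det_p n m l p)"
    by (simp add: lift_value_def of_tpoly.hom_power of_tpoly.hom_uminus right_diff_distrib mult.assoc)
  moreover have "(-1) ^ n * (-1) ^ n = (1 :: compl_ring)"
    by (simp flip: power_mult_distrib)
  ultimately show ?thesis
    unfolding reduces_to_iff by simp
qed

text \<open>With \<open>C = 1 / Q\<close>, the level is \<open>1\<close> for all primes up to \<open>Q\<close>, and for the larger ones it is
  small enough compared to the prime.\<close>

lemma is_universal_lift_value: "is_universal_lift n m l lift_value"
proof -
  \<comment> \<open>The sum of the constants in the size conditions of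
    \<open>reduces_to_large\<close>, so that \<open>c * s < p\<close> implies all of them. Doubling
    it in \<open>Q\<close> makes up for rounding the level upwards.\<close>
  define c where "c = 2 * m + 2 * (slope + 1) + n + 4 * Lm + n + 2"
  define Q where "Q = 2 * c"
  have Q: "0 < Q" by (simp add: Q_def c_def)
  have "reduces_to p (nat \<lceil>1 / real Q * real p\<rceil>) lift_value (Det_p n m l p)" if p: "prime p" for p
  proof -
    have p0: "0 < p" using p prime_gt_0_nat by blast
    define s where "s = nat \<lceil>1 / real Q * real p\<rceil>"
    have "0 < 1 / real Q * real p" using Q p0 by simp
    then have s1: "1 \<le> s" unfolding s_def by linarith
    have "real s < 1 / real Q * real p + 1"
      using \<open>0 < 1 / real Q * real p\<close> unfolding s_def by linarith
    then have "real s * real Q < real p + real Q"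
      using Q by (simp add: field_simps)
    then have sQ: "s * Q < p + Q"
      by (metis of_nat_add of_nat_less_iff of_nat_mult)
    show ?thesis
    proof (cases "p \<le> Q")
      case True
      then have "s * Q < 2 * Q" using sQ by linarith
      then have "s < 2" by (simp only: mult_less_cancel2)
      then have "s = 1" using s1 by linarith
      then show ?thesis
        using reduces_to_level_1[OF p] by (simp add: s_def)
    next
      case False
      then have lt: "c * s < p"
        using sQ by (simp add: Q_def algebra_simps)
      have e: "c * s = 2 * (m * s) + 2 * (slope + 1) * s + n * s + (4 * Lm + n + 2) * s"
        by (simp add: c_def algebra_simps)
      have "2 * (m * s) + 2 * (slope + 1) * s + n * s + (4 * Lm + n + 2) * 1
          \<le> 2 * (m * s) + 2 * (slope + 1) * s + n * s + (4 * Lm + n + 2) * s"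
        using s1 by (intro add_left_mono mult_left_mono) auto
      from le_less_trans[OF this lt[unfolded e]]
      have sum: "2 * (m * s) + 2 * (slope + 1) * s + n * s + (4 * Lm + n + 2) < p"
        by (simp only: mult_1_right)
      have "2 * (m * s) + 4 * Lm + 1 < p" "2 * (slope + 1) * s + n + 1 \<le> p" "n * s < p"
        subgoal by (rule le_less_trans[OF _ sum]) linarith
        subgoal by (rule less_imp_le[OF le_less_trans[OF _ sum]]) linarith
        subgoal by (rule le_less_trans[OF _ sum]) linarith
        done
      then show ?thesis
        unfolding s_def[symmetric] by (rule reduces_to_large[OF p s1])
    qed
  qed
  then show ?thesis
    unfolding is_universal_lift_def using Q by (intro exI[of _ "1 / real Q"]) simp
qed

end

theorem theorem4:
  fixes n m :: nat and l :: "nat \<Rightarrow> int"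
  assumes "n \<ge> 1" and "m \<ge> 1" and "mono_on {1..n} l"
  shows "universal_lift n m l = (-1) ^ n * poly (limit_weierstrass n m l) 0"
proof -
  define Lm where "Lm = (\<Sum>r=1..n. nat \<bar>l r\<bar>)"
  have "\<bar>l r\<bar> \<le> int Lm" if "r \<in> {1..n}" for r
    using member_le_sum[OF that, of "\<lambda>r. nat \<bar>l r\<bar>"] by (simp add: Lm_def nat_le_iff)
  then interpret bounded_diff_operator n m l Lm
    using assms by unfold_locales auto
  have "universal_lift n m l = lift_value"
    unfolding universal_lift_def
    using is_universal_lift_value universal_lift_unique by (intro the_equality)
  then show ?thesis
    by (simp add: lift_value_def poly_0_coeff_0)
qed

end
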